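(* Let $r\geq 2$, $m\geq 0$, and let $G$ be a connected graph with vertex set $V_G=[r+m]$ such that the subgraph induced by $G$ on $[r]$ is connected and the endpoints $r+1,\dots,r+m$ are pairwise non-adjacent in $G$. If $m=0$, assume that $\mu$ is a finite diffuse measure on $\mathbb{R}^d$ and that $\varphi:\mathbb{R}^d\times\mathbb{R}^d\to[0,1]$ is symmetric and measurable. If $m\geq 1$, assume that $\mu$ is the Lebesgue measure on $\mathbb{R}^d$ and that $\varphi:\mathbb{R}^d\times\mathbb{R}^d\to[0,1]$ is symmetric, measurable, translation invariant (i.e. $\varphi(x,y)=\varphi(0,y-x)$ for all $x,y$), with $\int_{\mathbb{R}^d}\varphi(0,x)\,\mathrm{d}x<\infty$. Suppose that the balance condition $$\frac{e(H)-a_m(G)}{v(H)-m-1}\leq \frac{e(G)-a_m(G)}{r-1}\qquad\text{for all subgraphs } H\subset G \text{ with } v(H)\geq m+2$$ holds. Then the cumulant $\kappa_n(\overline{N}_G)$ of order $n\geq 1$ of the normalized subgraph count $\overline{N}_G:=\dfrac{N_G-\kappa_1(N_G)}{\sqrt{\kappa_2(N_G)}}$ satisfies $$|\kappa_n(\overline{N}_G)|\leq \frac{n!^r}{\Delta_\lambda^{n-2}},\qquad n\ge 1,$$ where $\Delta_\lambda>0$ does not depend on $n$ and, as $\lambda\to\infty$, $$\Delta_\lambda\asymp\begin{cases}\lambda^{r/2}c_\lambda^{e(G)/2} & \text{if } c_\lambda\lesssim\lambda^{-(r-1)/(e(G)-a_m(G))},\\[2pt] \lambda^{1/2}c_\lambda^{a_m(G)/2}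 & \text{if } 1\gtrsim c_\lambda\gtrsim\lambda^{-(r-1)/(e(G)-a_m(G))}.\end{cases}$$ In particular, when $G$ has no endpoints ($m=0$), one has, as $\lambda\to\infty$, $$\Delta_\lambda\asymp\begin{cases}\lambda^{v(G)/2}c_\lambda^{e(G)/2} & \text{if } c_\lambda\lesssim\lambda^{-(v(G)-1)/e(G)},\\[2pt] \lambda^{1/2} & \text{if } 1\gtrsim c_\lambda\gtrsim\lambda^{-(v(G)-1)/e(G)},\end{cases}$$ and the balance condition becomes the strong balance condition $\frac{e(H)}{v(H)-1}\leq\frac{e(G)}{v(G)-1}$, $H\subset G$.
   Context: Notation: $[n]:=\{1,\dots,n\}$; for a graph $H$, $v(H)$ and $e(H)$ are its numbers of vertices and edges, and $E_H$ its edge set. For functions $f(\lambda)$ and $g(\lambda)>0$, as $\lambda\to\infty$: $f\lesssim g$ means $\limsup f/g<\infty$; $f\gtrsim g$ means $\liminf f/g>0$; $f\asymp g$ means both. For $G$ with $V_G=[r+m]$, vertices $r+1,\dots,r+m$ are called endpoints, and $a_m(G):=\max_{i\in[r]}|\{j\in\{r+1,\dots,r+m\}:\{i,j\}\in E_G\}|$ (so $a_0(G)=0$). Random-connection model: let $d\ge1$, let $y_1,\dots,y_m\in\mathbb{R}^d$ be fixed distinct points, let $\lambda>0$, let $\mu$ be a diffuse sigma-finite measure on $\mathbb{R}^d$, and under the probability $\mathbb{P}_\lambda$ let $\eta=\sum_{i=1}^\tau\delta_{X_i}$ be a Poisson point process on $\mathbb{R}^d$ with intensity measure $\lambda\cdot\mu$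 ($\tau$ is $\mathbb{N}\cup\{\infty\}$-valued). Given $\varphi$ symmetric measurable with values in $[0,1]$ and $c_\lambda\in(0,1)$, set $\varphi_\lambda:=c_\lambda\varphi$. The random graph $G_\varphi(\eta\cup\{y_1,\dots,y_m\})$ has vertex set $\eta\cup\{y_1,\dots,y_m\}$, any two distinct vertices $x,y$ being independently connected by an edge (written $x\leftrightarrow y$) with probability $\varphi_\lambda(x,y)$. Subgraph count: $N_G$ is the number of (labelled) copies of $G$ in this random graph in which endpoint $r+l$ is mapped to $y_l$, $l=1,\dots,m$, that is $$N_G=\sum_{(\alpha_1,\dots,\alpha_r)}\ \prod_{\{i,j\}\in E_G,\ i,j\in[r]}\mathbf{1}_{\{X_{\alpha_i}\leftrightarrow X_{\alpha_j}\}}\prod_{\{r+j,i\}\in E_G,\ i\in[r],\,j\in[m]}\mathbf{1}_{\{y_j\leftrightarrow X_{\alpha_i}\}},$$ the sum being over $r$-tuples of pairwise distinct indices $\alpha_1,\dots,\alpha_r\in\{1,\dots,\tau\}$. $\kappa_n(X)$ denotes the cumulant of order $n$ of $X$ under $\mathbb{P}_\lambda$. *)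

theory Defs
  imports "HOL-Probability.Probability"
begin

section \<open>Finite simple graphs\<close>

text \<open>A graph is given by its vertex set \<open>V\<close> and its edge set \<open>E\<close>, edges being two-element
  sets of vertices.\<close>

definition simple_graph :: "'v set \<Rightarrow> 'v set set \<Rightarrow> bool" where
  "simple_graph V E \<longleftrightarrow> finite V \<and> E \<subseteq> {{u, v} | u v. u \<in> V \<and> v \<in> V \<and> u \<noteq> v}"

definition connected_graph :: "'v set \<Rightarrow> 'v set set \<Rightarrow> bool" where
  "connected_graph V E \<longleftrightarrow>
     simple_graph V E \<and> V \<noteq> {} \<and> (\<forall>u\<in>V. \<forall>v\<in>V. (u, v) \<in> {(a, b). {a, b} \<in> E}\<^sup>*)"

definition induced_edges :: "'v set set \<Rightarrow> 'v set \<Rightarrow> 'v set set" where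
  "induced_edges E S = {e \<in> E. e \<subseteq> S}"

definition subgraph_of :: "'v set \<Rightarrow> 'v set set \<Rightarrow> 'v set \<Rightarrow> 'v set set \<Rightarrow> bool" where
  "subgraph_of W F V E \<longleftrightarrow> simple_graph W F \<and> W \<subseteq> V \<and> F \<subseteq> E"

text \<open>In the graphs with endpoints the vertex set is \<open>{1..r + m}\<close> and the endpoints are
  \<open>r + 1, \<dots>, r + m\<close>.\<close>

definition max_endpoint_degree :: "nat \<Rightarrow> nat \<Rightarrow> nat set set \<Rightarrow> nat" where
  "max_endpoint_degree r m E = Max ((\<lambda>i. card {j \<in> {r+1..r+m}. {i, j} \<in> E}) ` {1..r})"

text \<open>The subgraphs \<open>(W, F)\<close> are arbitrary; in particular they need not contain the endpoints.\<close>

definition balanced :: "nat \<Rightarrow> nat \<Rightarrow> nat set set \<Rightarrow> bool" where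
  "balanced r m E \<longleftrightarrow>
     (\<forall>W F. subgraph_of W F {1..r+m} E \<longrightarrow> card W \<ge> m + 2 \<longrightarrow>
        (real (card F) - real (max_endpoint_degree r m E)) / (real (card W) - real m - 1)
          \<le> (real (card E) - real (max_endpoint_degree r m E)) / (real r - 1))"

text \<open>The ratio \<open>e(H) / (v(H) - 1)\<close> is meaningful only for subgraphs with at least two vertices.\<close>

definition strongly_balanced :: "'v set \<Rightarrow> 'v set set \<Rightarrow> bool" where
  "strongly_balanced V E \<longleftrightarrow>
     (\<forall>W F. subgraph_of W F V E \<longrightarrow> card W \<ge> 2 \<longrightarrow>
        real (card F) / (real (card W) - 1) \<le> real (card E) / (real (card V) - 1))"

section \<open>Asymptotic comparison as the argument tends to infinity\<close>

definition asymp_le :: "(real \<Rightarrow> real) \<Rightarrow> (real \<Rightarrow> real) \<Rightarrow> bool" where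
  "asymp_le f g \<longleftrightarrow> Limsup at_top (\<lambda>t. ereal (f t / g t)) < \<infinity>"

definition asymp_ge :: "(real \<Rightarrow> real) \<Rightarrow> (real \<Rightarrow> real) \<Rightarrow> bool" where
  "asymp_ge f g \<longleftrightarrow> 0 < Liminf at_top (\<lambda>t. ereal (f t / g t))"

definition asymp_eq :: "(real \<Rightarrow> real) \<Rightarrow> (real \<Rightarrow> real) \<Rightarrow> bool" where
  "asymp_eq f g \<longleftrightarrow> asymp_le f g \<and> asymp_ge f g"

section \<open>Cumulants\<close>

text \<open>Moment-cumulant formula, summing over the set partitions of \<open>{1..n}\<close>. (The moment generating
  function of a subgraph count is in general infinite, so cumulants cannot be defined through its
  logarithm.) The value is meaningful only if the moments up to order \<open>n\<close> exist.\<close>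

definition cumulant :: "'w measure \<Rightarrow> ('w \<Rightarrow> real) \<Rightarrow> nat \<Rightarrow> real" where
  "cumulant M Z n =
     (\<Sum>\<pi> | partition_on {1..n} \<pi>.
        (-1) ^ (card \<pi> - 1) * fact (card \<pi> - 1) * (\<Prod>B\<in>\<pi>. \<integral>\<omega>. Z \<omega> ^ card B \<partial>M))"

definition normalized :: "'w measure \<Rightarrow> ('w \<Rightarrow> real) \<Rightarrow> 'w \<Rightarrow> real" where
  "normalized M Z \<omega> = (Z \<omega> - cumulant M Z 1) / sqrt (cumulant M Z 2)"

section \<open>Poisson point processes\<close>

definition diffuse :: "'a measure \<Rightarrow> bool" where
  "diffuse \<mu> \<longleftrightarrow> (\<forall>x. emeasure \<mu> {x} = 0)"

definition index_set :: "enat \<Rightarrow> nat set" where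
  "index_set t = {i. 1 \<le> i \<and> enat i \<le> t}"

text \<open>The point measure \<open>\<Sum>\<^sub>i\<^sub>\<le>\<^sub>t \<delta>\<^bsub>x i\<^esub>\<close>, as the image of the counting measure on the indices.\<close>

definition point_configuration :: "enat \<Rightarrow> (nat \<Rightarrow> 'a::topological_space) \<Rightarrow> 'a measure" where
  "point_configuration t x = distr (count_space (index_set t)) borel x"

definition poisson_point_process ::
    "'w measure \<Rightarrow> ('w \<Rightarrow> 'a::topological_space measure) \<Rightarrow> 'a measure \<Rightarrow> bool" where
  "poisson_point_process M \<eta> \<Lambda> \<longleftrightarrow>
     (\<forall>A\<in>sets borel. emeasure \<Lambda> A < \<infinity> \<longrightarrow>
        (\<forall>k::nat. measure M {\<omega> \<in> space M. emeasure (\<eta> \<omega>) A = of_nat k}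
                    = measure \<Lambda> A ^ k / fact k * exp (- measure \<Lambda> A))) \<and>
     (\<forall>A\<in>sets borel. emeasure \<Lambda> A = \<infinity> \<longrightarrow> (AE \<omega> in M. emeasure (\<eta> \<omega>) A = \<infinity>)) \<and>
     (\<forall>(I :: nat set) A. finite I \<longrightarrow> disjoint_family_on A I \<longrightarrow> A ` I \<subseteq> sets borel \<longrightarrow>
        prob_space.indep_vars M (\<lambda>_. borel) (\<lambda>i \<omega>. emeasure (\<eta> \<omega>) (A i)) I)"

section \<open>The random-connection model\<close>

text \<open>Vertices of the random graph are referred to by label: \<open>Pt i\<close> is the \<open>i\<close>-th point of the
  Poisson process, located at \<open>X i \<omega>\<close>, and \<open>Fixed l\<close> is the fixed point \<open>y l\<close>. Random edges are
  two-element sets of labels.\<close>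

datatype vertex = Pt nat | Fixed nat

fun location :: "(nat \<Rightarrow> 'a) \<Rightarrow> (nat \<Rightarrow> 'a) \<Rightarrow> vertex \<Rightarrow> 'a" where
  "location x y (Pt i) = x i"
| "location x y (Fixed l) = y l"

definition rcm_vertices :: "enat \<Rightarrow> nat \<Rightarrow> vertex set" where
  "rcm_vertices t m = Pt ` index_set t \<union> Fixed ` {1..m}"

definition vertex_algebra ::
    "'w measure \<Rightarrow> ('w \<Rightarrow> enat) \<Rightarrow> (nat \<Rightarrow> 'w \<Rightarrow> 'a::topological_space) \<Rightarrow> 'w measure" where
  "vertex_algebra M \<tau> X =
     vimage_algebra (space M) (\<lambda>\<omega>. (\<tau> \<omega>, \<lambda>i. X i \<omega>))
       (count_space UNIV \<Otimes>\<^sub>M Pi\<^sub>M UNIV (\<lambda>_. borel))"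

text \<open>On the probability space \<open>M\<close>, the points \<open>X 1, X 2, \<dots>\<close> (up to the index \<open>\<tau>\<close>) form a Poisson
  process with intensity measure \<open>\<Lambda>\<close>, and \<open>\<Gamma>\<close> is the edge set of the random graph: given the
  vertices, distinct pairs of vertices are connected independently of each other, the pair
  \<open>(u, v)\<close> with probability \<open>\<psi>\<close> evaluated at the locations of \<open>u\<close> and \<open>v\<close>. A set \<open>D\<close> of pairs on
  which \<open>(u, v) \<mapsto> {u, v}\<close> is injective lists each unordered pair at most once; \<open>S\<close> is the set
  of pairs in \<open>D\<close> that are connected. The values \<open>X i\<close> with \<open>i\<close> outside \<open>{1..\<tau>}\<close> are not points of
  the process; they enter only through the conditioning sigma-algebra.\<close>

definition random_connection_model ::
    "'w measure \<Rightarrow> ('w \<Rightarrow> enat) \<Rightarrow> (nat \<Rightarrow> 'w \<Rightarrow> 'a::topological_space) \<Rightarrow> ('w \<Rightarrow> vertex set set) \<Rightarrow>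
     nat \<Rightarrow> (nat \<Rightarrow> 'a) \<Rightarrow> 'a measure \<Rightarrow> ('a \<Rightarrow> 'a \<Rightarrow> real) \<Rightarrow> bool" where
  "random_connection_model M \<tau> X \<Gamma> m y \<Lambda> \<psi> \<longleftrightarrow>
     prob_space M \<and>
     \<tau> \<in> measurable M (count_space UNIV) \<and>
     (\<forall>i. X i \<in> borel_measurable M) \<and>
     poisson_point_process M (\<lambda>\<omega>. point_configuration (\<tau> \<omega>) (\<lambda>i. X i \<omega>)) \<Lambda> \<and>
     (\<forall>\<omega>\<in>space M. \<Gamma> \<omega> \<subseteq> {{u, v} | u v. u \<in> rcm_vertices (\<tau> \<omega>) m \<and> v \<in> rcm_vertices (\<tau> \<omega>) m \<and> u \<noteq> v}) \<and>
     (\<forall>u v. {\<omega> \<in> space M. {u, v} \<in> \<Gamma> \<omega>} \<in> sets M) \<and>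
     (\<forall>D S. finite D \<longrightarrow> (\<forall>(u, v)\<in>D. u \<noteq> v) \<longrightarrow> inj_on (\<lambda>(u, v). {u, v}) D \<longrightarrow> S \<subseteq> D \<longrightarrow>
        (AE \<omega> in M. (\<forall>(u, v)\<in>D. {u, v} \<subseteq> rcm_vertices (\<tau> \<omega>) m) \<longrightarrow>
           real_cond_exp M (vertex_algebra M \<tau> X)
             (indicator {\<omega> \<in> space M. {(u, v) \<in> D. {u, v} \<in> \<Gamma> \<omega>} = S}) \<omega>
           = (\<Prod>(u, v)\<in>D.
                let p = \<psi> (location (\<lambda>i. X i \<omega>) y u) (location (\<lambda>i. X i \<omega>) y v)
                in if (u, v) \<in> S then p else 1 - p)))"

definition injective_tuples :: "nat \<Rightarrow> enat \<Rightarrow> (nat \<Rightarrow> nat) set" where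
  "injective_tuples r t = {\<alpha> \<in> {1..r} \<rightarrow>\<^sub>E index_set t. inj_on \<alpha> {1..r}}"

text \<open>\<open>t\<close> is the number of points and \<open>\<gamma>\<close> the edge set of the realized random graph.\<close>

definition copy_indicator ::
    "nat \<Rightarrow> nat \<Rightarrow> nat set set \<Rightarrow> vertex set set \<Rightarrow> (nat \<Rightarrow> nat) \<Rightarrow> real" where
  "copy_indicator r m E \<gamma> \<alpha> =
     (\<Prod>e\<in>induced_edges E {1..r}. of_bool ((\<lambda>i. Pt (\<alpha> i)) ` e \<in> \<gamma>)) *
     (\<Prod>(i, j)\<in>{(i, j). i \<in> {1..r} \<and> j \<in> {1..m} \<and> {r + j, i} \<in> E}.
        of_bool ({Fixed j, Pt (\<alpha> i)} \<in> \<gamma>))"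

definition subgraph_count :: "nat \<Rightarrow> nat \<Rightarrow> nat set set \<Rightarrow> enat \<Rightarrow> vertex set set \<Rightarrow> real" where
  "subgraph_count r m E t \<gamma> = (\<Sum>\<^sub>\<infinity>\<alpha>\<in>injective_tuples r t. copy_indicator r m E \<gamma> \<alpha>)"

end

theory Submission
  imports Defs
begin

text \<open>
  Expand the \<open>n\<close>-th power of the count and sort the \<open>n\<close>-tuples of copies by their coincidence pattern
  \<open>\<rho>\<close>, a non-flat partition of \<open>{1..n} \<times> {1..r}\<close>. By the factorial moment formula for Poisson
  processes, the \<open>n\<close>-th moment is the sum over all \<open>\<rho>\<close> of an integral of order \<open>\<lambda>^|\<rho>| * c^e(\<rho>)\<close>,
  where \<open>e(\<rho>)\<close> is the number of edges of the glued graph. These integrals are multiplicative over the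
  connected components of \<open>\<rho>\<close>, so the \<open>n\<close>-th cumulant is the sum over the connected patterns only.
  Put \<open>A = \<lambda>^r * c^e(G)\<close> and \<open>B = \<lambda>^(r-1) * c^(e(G)-a)\<close>. When the copies are glued one after the
  other, the balance condition shows that each new copy contributes a factor of at most \<open>max 1 B\<close>, so
  every term is of order at most \<open>A * (max 1 B)^(n-1)\<close>, and there are at most \<open>n!^r\<close> times an
  exponential number of patterns. The variance is at least of order \<open>A * max 1 B\<close>: all terms are
  nonnegative, and two copies may share all their vertices, or just one vertex with the maximal number
  \<open>a\<close> of adjacent endpoints. Hence \<open>\<Delta>\<close> can be taken of the order of \<open>sqrt (A / max 1 B)\<close>.
\<close>

section \<open>Set partitions and joint cumulants\<close>

text \<open>Cumulants see only connected patterns because of a sign cancellation: once the sums are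
  exchanged, a pattern \<rho> carries the sum of Moebius signs over all partitions of the rows that
  respect its blocks, and this sum is 0 as soon as \<rho> has two components. Scaling the measure by
  \<lambda> and the connection function by \<open>c\<close> takes powers out of every integral and
  leaves integrals in \<phi> and \<mu> alone, so all constants are fixed before \<lambda>. Their
  finiteness is an obstacle when \<mu> is infinite: every vertex of a glued graph must be joined by
  a path to a fixed endpoint, whence a case distinction on \<open>m\<close>. The balance condition
  acts by interpolation: a copy sharing t vertices contributes at most \<open>B\<close> to the power
  (r - t)/(r - 1), which is at most \<open>max 1 B\<close>. The number of patterns leaves a factor
  D^n where the claim allows only powers of order n - 2; since n <= 3(n - 2) for n >= 3, it is
  absorbed in \<Delta> as a cubed constant, and n = 1, 2 are treated apart. If the expected count is
  zero, the count vanishes almost surely and the normalized count is 0, division by zero being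
  0.\<close>

text \<open>The new element \<open>x\<close> either forms a block of its own or joins an existing
  block \<open>B\<close>. The map \<open>h\<close> treats both cases alike by letting the pair
  \<open>(\<pi>, {})\<close> stand for the singleton; \<open>g\<close> inverts it by deleting
  \<open>x\<close> from its block \<open>b\<close> and dropping \<open>b\<close> if nothing
  remains.\<close>

lemma sum_partitions_insert:
  fixes f :: "'a set set \<Rightarrow> 'b::comm_monoid_add"
  assumes "finite T" "x \<notin> T"
  shows "(\<Sum>\<pi> | partition_on (insert x T) \<pi>. f \<pi>)
    = (\<Sum>\<pi> | partition_on T \<pi>. f (insert {x} \<pi>) + (\<Sum>B\<in>\<pi>. f (insert (insert x B) (\<pi> - {B}))))"
proof -
  define h where "h = (\<lambda>(\<pi>, B). insert (insert x B) (\<pi> - {B}))"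
  define g where "g = (\<lambda>\<pi>. let b = \<Union>{b\<in>\<pi>. x \<in> b} in (insert (b - {x}) (\<pi> - {b}) - {{}}, b - {x}))"
  let ?P = "{\<pi>. partition_on T \<pi>}" and ?Q = "{\<pi>. partition_on (insert x T) \<pi>}"
  have finP: "finite ?P" using assms(1) by (rule finitely_many_partition_on)
  have h1: "h (g \<pi>) = \<pi> \<and> g \<pi> \<in> (SIGMA \<pi>:?P. insert {} \<pi>)" if "\<pi> \<in> ?Q" for \<pi>
  proof -
    from that have \<pi>: "partition_on (insert x T) \<pi>" by simp
    then obtain b where b: "b \<in> \<pi>" "x \<in> b" by (auto simp: partition_on_def)
    have uniq: "{b\<in>\<pi>. x \<in> b} = {b}"
      using b \<pi> by (auto simp: partition_on_def disjoint_def)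
    have sub: "b \<subseteq> insert x T" using b \<pi> by (auto simp: partition_on_def)
    have ins: "insert b (\<pi> - {b}) = \<pi>" using b by auto
    have dj: "disjnt b (\<Union>(\<pi> - {b}))"
      using b \<pi> by (auto simp: partition_on_def disjoint_def disjnt_def)
    have part: "partition_on (insert x T - b) (\<pi> - {b})"
      using partition_on_insert[OF dj, of "insert x T"] \<pi> unfolding ins by auto
    have xn: "x \<notin> \<Union>(\<pi> - {b})" using dj b by (auto simp: disjnt_def)
    have ne: "{} \<notin> \<pi>" using \<pi> by (auto simp: partition_on_def)
    have gp: "g \<pi> = (insert (b - {x}) (\<pi> - {b}) - {{}}, b - {x})"
      unfolding g_def uniq by simp
    have nb: "b - {x} \<notin> \<pi> - {b}"
    proof
      assume *: "b - {x} \<in> \<pi> - {b}"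
      then have "b - {x} = {}" using dj by (auto simp: disjnt_def)
      with * have "{} \<in> \<pi>" by (metis DiffD1)
      then show False using ne by simp
    qed
    show ?thesis
    proof (cases "b = {x}")
      case True
      then have "g \<pi> = (\<pi> - {b}, {})" using gp ne by auto
      moreover have "partition_on T (\<pi> - {b})"
        using part True assms(2) by (simp add: insert_Diff_if)
      moreover have "insert {x} (\<pi> - {{x}} - {{}}) = \<pi>" using ne b True by auto
      ultimately show ?thesis using True by (auto simp: h_def)
    next
      case False
      then have ne2: "b - {x} \<noteq> {}" using b by auto
      then have g2: "g \<pi> = (insert (b - {x}) (\<pi> - {b}), b - {x})" using gp ne by auto
      have dj2: "disjnt (b - {x}) (\<Union>(\<pi> - {b}))" using dj by (auto simp: disjnt_def)
      have "T - (b - {x}) = insert x T - b" using b assms by auto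
      then have "partition_on T (insert (b - {x}) (\<pi> - {b}))"
        using part sub ne2 by (auto simp: partition_on_insert[OF dj2])
      moreover have "h (insert (b - {x}) (\<pi> - {b}), b - {x}) = \<pi>"
        using nb b by (auto simp: h_def insert_absorb)
      ultimately show ?thesis using g2 by auto
    qed
  qed
  have h2: "g (h p) = p \<and> h p \<in> ?Q" if pin: "p \<in> (SIGMA \<pi>:?P. insert {} \<pi>)" for p
  proof -
    obtain \<pi> B where p: "p = (\<pi>, B)" "partition_on T \<pi>" "B = {} \<or> B \<in> \<pi>"
      using pin by (cases p) auto
    have ne: "{} \<notin> \<pi>" using p by (auto simp: partition_on_def)
    have xT: "x \<notin> \<Union>\<pi>" using p assms by (auto simp: partition_on_def)
    then have xB: "x \<notin> B" using p by auto
    have uniq: "{b \<in> h p. x \<in> b} = {insert x B}"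
      using xT p by (auto simp: h_def)
    have nb: "insert x B \<notin> \<pi> - {B}" using xT by auto
    have gh: "g (h p) = (insert B (\<pi> - {B}) - {{}}, B)"
      unfolding g_def uniq using xB nb by (auto simp: p h_def)
    have gp: "insert B (\<pi> - {B}) - {{}} = \<pi>" using ne p(3) by auto
    have dj: "disjnt (insert x B) (\<Union>(\<pi> - {B}))"
      using p(2,3) xT by (auto simp: disjnt_def partition_on_def disjoint_def)
    have "disjnt B (\<Union>(\<pi> - {B}))" using dj by (auto simp: disjnt_def)
    have "partition_on (T - B) (\<pi> - {B})"
    proof (cases "B = {}")
      case True then show ?thesis using p ne by simp
    next
      case False
      then have "insert B (\<pi> - {B}) = \<pi>" using p by auto
      then show ?thesis
        using partition_on_insert[OF \<open>disjnt B (\<Union>(\<pi> - {B}))\<close>, of T] p(2) by auto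
    qed
    moreover have "insert x T - insert x B = T - B" using assms by auto
    moreover have "B \<subseteq> T" using p by (auto simp: partition_on_def)
    ultimately have "h p \<in> ?Q"
      by (auto simp: p h_def partition_on_insert[OF dj])
    then show ?thesis using gh gp p by auto
  qed
  have "(\<Sum>\<pi>\<in>?Q. f \<pi>) = (\<Sum>p\<in>(SIGMA \<pi>:?P. insert {} \<pi>). f (h p))"
    by (rule sum.reindex_bij_witness[of _ h g]) (use h1 h2 in auto)
  also have "\<dots> = (\<Sum>\<pi>\<in>?P. \<Sum>B\<in>insert {} \<pi>. f (h (\<pi>, B)))"
    using finP finite_elements[OF assms(1)] by (subst sum.Sigma) auto
  also have "\<dots> = (\<Sum>\<pi>\<in>?P. f (insert {x} \<pi>) + (\<Sum>B\<in>\<pi>. f (insert (insert x B) (\<pi> - {B}))))"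
  proof (rule sum.cong[OF refl])
    fix \<pi> assume "\<pi> \<in> ?P"
    then have \<pi>: "partition_on T \<pi>" by simp
    have "{} \<notin> \<pi>" "finite \<pi>" using \<pi> finite_elements[OF assms(1)] by (auto simp: partition_on_def)
    then show "(\<Sum>B\<in>insert {} \<pi>. f (h (\<pi>, B)))
      = f (insert {x} \<pi>) + (\<Sum>B\<in>\<pi>. f (insert (insert x B) (\<pi> - {B})))"
      by (simp add: h_def)
  qed
  finally show ?thesis .
qed

lemma card_partition_insert:
  assumes "finite T" "x \<notin> T" "partition_on T \<pi>"
  shows "card (insert {x} \<pi>) = card \<pi> + 1"
    "B \<in> \<pi> \<Longrightarrow> card (insert (insert x B) (\<pi> - {B})) = card \<pi>"
proof -
  have fin: "finite \<pi>" using assms finite_elements by blast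
  have x: "x \<notin> \<Union>\<pi>" using assms by (auto simp: partition_on_def)
  then have "{x} \<notin> \<pi>" "insert x B \<notin> \<pi>" by auto
  then show "card (insert {x} \<pi>) = card \<pi> + 1" using fin by simp
  assume "B \<in> \<pi>"
  then show "card (insert (insert x B) (\<pi> - {B})) = card \<pi>"
    using fin \<open>insert x B \<notin> \<pi>\<close> by (simp add: card.remove[of \<pi> B] del: card_Diff_insert)
qed

text \<open>This is the Moebius function of the partition lattice between \<pi> and the one-block
  partition, the coefficient in the moment-cumulant formula.\<close>

definition partition_sign :: "'a set set \<Rightarrow> real" where
  "partition_sign \<pi> = (-1) ^ (card \<pi> - 1) * fact (card \<pi> - 1)"

text \<open>With k blocks, a new singleton gives the sign of k + 1 blocks, (-1)^k k!, while each of
  the k ways to enlarge a block keeps (-1)^(k-1) (k-1)!; these add up to zero. Nonemptiness of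
  \<open>T\<close> ensures k >= 1, so that the truncated subtraction in the sign is
  harmless.\<close>

lemma partition_sign_cancel:
  assumes "finite T" "x \<notin> T" "partition_on T \<pi>" "T \<noteq> {}"
  shows "partition_sign (insert {x} \<pi>) + real (card \<pi>) * partition_sign \<pi> = 0"
proof -
  have "card \<pi> > 0"
    using assms finite_elements[of T \<pi>] by (auto simp: card_gt_0_iff partition_on_def)
  then obtain k where "card \<pi> = Suc k" by (cases "card \<pi>") auto
  then show ?thesis
    unfolding partition_sign_def card_partition_insert(1)[OF assms(1-3)] by simp
qed

text \<open>Partitions of \<open>insert x T\<close> are grouped by their trace on \<open>T\<close>;
  each group cancels unless \<open>T\<close> is empty. This is the defining identity of the Moebius
  function.\<close>

lemma sum_partition_sign:
  fixes S :: "'a set"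
  assumes "finite S" "S \<noteq> {}"
  shows "(\<Sum>\<pi> | partition_on S \<pi>. partition_sign \<pi>) = of_bool (card S = 1)"
proof -
  obtain x T where S: "S = insert x T" "x \<notin> T" using assms(2) by (meson Set.set_insert ex_in_conv)
  then have T: "finite T" using assms by simp
  show ?thesis
  proof (cases "T = {}")
    case True
    moreover have "Collect (partition_on ({}::'a set)) = {{}}" by (auto simp: partition_on_empty)
    ultimately show ?thesis
      unfolding S(1) by (subst sum_partitions_insert) (auto simp: partition_sign_def)
  next
    case False
    have "(\<Sum>\<pi> | partition_on S \<pi>. partition_sign \<pi>) = (\<Sum>\<pi> | partition_on T \<pi>. 0)"
      unfolding S(1) sum_partitions_insert[OF T S(2)]
    proof (rule sum.cong[OF refl])
      fix \<pi> assume "\<pi> \<in> {\<pi>. partition_on T \<pi>}"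
      then have \<pi>: "partition_on T \<pi>" by simp
      have "(\<Sum>B\<in>\<pi>. partition_sign (insert (insert x B) (\<pi> - {B}))) = (\<Sum>B\<in>\<pi>. partition_sign \<pi>)"
        by (rule sum.cong) (simp_all add: partition_sign_def card_partition_insert(2)[OF T S(2) \<pi>])
      then show "partition_sign (insert {x} \<pi>) + (\<Sum>B\<in>\<pi>. partition_sign (insert (insert x B) (\<pi> - {B}))) = 0"
        using partition_sign_cancel[OF T S(2) \<pi> False] by simp
    qed
    then show ?thesis using False T S by (simp add: card_gt_0_iff)
  qed
qed

text \<open>Here \<open>f B\<close> plays the role of the joint moment of the variables with index
  in \<open>B\<close>. Working with set functions instead of powers of one variable lets the
  variables be altered one at a time and lets moments be replaced by sums over patterns.\<close>

definition joint_cumulant :: "'a set \<Rightarrow> ('a set \<Rightarrow> real) \<Rightarrow> real" where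
  "joint_cumulant R f = (\<Sum>\<pi> | partition_on R \<pi>. partition_sign \<pi> * (\<Prod>B\<in>\<pi>. f B))"

lemma cumulant_joint_cumulant:
  "cumulant M Z n = joint_cumulant {1..n} (\<lambda>B. \<integral>\<omega>. Z \<omega> ^ card B \<partial>M)"
  by (simp add: cumulant_def joint_cumulant_def partition_sign_def)

section \<open>Cumulants under shifts and scalings\<close>

lemma joint_cumulant_cong:
  assumes "\<And>B. B \<subseteq> R \<Longrightarrow> f B = g B"
  shows "joint_cumulant R f = joint_cumulant R g"
  unfolding joint_cumulant_def
  by (intro sum.cong prod.cong refl arg_cong2[where f="(*)"] assms) (auto simp: partition_on_def)

text \<open>Adding the constant \<open>a\<close> to the single variable with index \<open>x\<close>
  changes \<open>f\<close> only on sets containing \<open>x\<close>, by \<open>a * f B\<close>. For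
  a fixed partition \<pi> of \<open>T\<close>, every way of inserting \<open>x\<close> produces the
  same extra term \<open>a * p\<close>, up to sign (for the singleton because
  \<open>f {} = 1\<close>), and the signs cancel. Thus a joint cumulant with a constant entry
  vanishes as soon as there is another variable.\<close>

lemma joint_cumulant_add_const:
  assumes T: "finite T" "x \<notin> T" "T \<noteq> {}" and f0: "f {} = 1"
    and g1: "\<And>B. B \<subseteq> T \<Longrightarrow> g B = f B"
    and g2: "\<And>B. B \<subseteq> T \<Longrightarrow> g (insert x B) = f (insert x B) + a * f B"
  shows "joint_cumulant (insert x T) g = joint_cumulant (insert x T) f"
  unfolding joint_cumulant_def sum_partitions_insert[OF T(1,2)]
proof (rule sum.cong[OF refl])
  fix \<pi> assume "\<pi> \<in> {\<pi>. partition_on T \<pi>}"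
  then have \<pi>: "partition_on T \<pi>" by simp
  have fin: "finite \<pi>" using \<pi> T finite_elements by blast
  have sub: "B \<subseteq> T" if "B \<in> \<pi>" for B using that \<pi> by (auto simp: partition_on_def)
  have x: "x \<notin> B" if "B \<in> \<pi>" for B using sub[OF that] T by auto
  have xn: "{x} \<notin> \<pi>" using x by auto
  define p where "p = (\<Prod>B\<in>\<pi>. f B)"
  have pg: "(\<Prod>B\<in>\<pi>. g B) = p" unfolding p_def by (rule prod.cong) (auto simp: g1 sub)
  have A: "(\<Prod>B\<in>insert {x} \<pi>. g B) = (\<Prod>B\<in>insert {x} \<pi>. f B) + a * p"
    using fin xn g2[of "{}"] f0 by (simp add: pg p_def algebra_simps)
  have B: "(\<Prod>C\<in>insert (insert x B) (\<pi> - {B}). g C) = (\<Prod>C\<in>insert (insert x B) (\<pi> - {B}). f C) + a * p"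
    if B: "B \<in> \<pi>" for B
  proof -
    have n: "insert x B \<notin> \<pi> - {B}" using x by auto
    have "(\<Prod>C\<in>\<pi> - {B}. g C) = (\<Prod>C\<in>\<pi> - {B}. f C)"
      by (rule prod.cong) (auto simp: g1 sub)
    moreover have "p = f B * (\<Prod>C\<in>\<pi> - {B}. f C)" unfolding p_def using fin B by (rule prod.remove)
    ultimately show ?thesis using fin n g2[OF sub[OF B]] by (simp add: algebra_simps)
  qed
  have S: "partition_sign (insert (insert x B) (\<pi> - {B})) = partition_sign \<pi>" if "B \<in> \<pi>" for B
    using that by (simp add: partition_sign_def card_partition_insert(2)[OF T(1,2) \<pi>])
  have "(\<Sum>B\<in>\<pi>. partition_sign (insert (insert x B) (\<pi> - {B})) * (\<Prod>C\<in>insert (insert x B) (\<pi> - {B}). g C))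
    = (\<Sum>B\<in>\<pi>. partition_sign (insert (insert x B) (\<pi> - {B})) * (\<Prod>C\<in>insert (insert x B) (\<pi> - {B}). f C)
        + partition_sign \<pi> * (a * p))"
    by (rule sum.cong) (simp_all add: B S distrib_left)
  also have "\<dots> = (\<Sum>B\<in>\<pi>. partition_sign (insert (insert x B) (\<pi> - {B})) * (\<Prod>C\<in>insert (insert x B) (\<pi> - {B}). f C))
        + real (card \<pi>) * partition_sign \<pi> * (a * p)"
    by (simp add: sum.distrib)
  finally have C: "(\<Sum>B\<in>\<pi>. partition_sign (insert (insert x B) (\<pi> - {B})) * (\<Prod>C\<in>insert (insert x B) (\<pi> - {B}). g C))
    = (\<Sum>B\<in>\<pi>. partition_sign (insert (insert x B) (\<pi> - {B})) * (\<Prod>C\<in>insert (insert x B) (\<pi> - {B}). f C))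
        + real (card \<pi>) * partition_sign \<pi> * (a * p)" .
  have "(partition_sign (insert {x} \<pi>) + real (card \<pi>) * partition_sign \<pi>) * (a * p) = 0"
    using partition_sign_cancel[OF T(1,2) \<pi> T(3)] by simp
  then show "partition_sign (insert {x} \<pi>) * (\<Prod>B\<in>insert {x} \<pi>. g B)
    + (\<Sum>B\<in>\<pi>. partition_sign (insert (insert x B) (\<pi> - {B})) * (\<Prod>C\<in>insert (insert x B) (\<pi> - {B}). g C))
    = partition_sign (insert {x} \<pi>) * (\<Prod>B\<in>insert {x} \<pi>. f B)
    + (\<Sum>B\<in>\<pi>. partition_sign (insert (insert x B) (\<pi> - {B})) * (\<Prod>C\<in>insert (insert x B) (\<pi> - {B}). f C))"
    unfolding A C distrib_left[of _ _ "a * p"] by (simp add: algebra_simps)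
qed

text \<open>The shift is carried out in one index after the other, each time by
  \<open>joint_cumulant_add_const\<close>; n >= 2 is what leaves at least one further index.\<close>

lemma cumulant_add_const:
  assumes M: "prob_space M" and int: "\<And>k. integrable M (\<lambda>\<omega>. Z \<omega> ^ k)" and n: "n \<ge> 2"
  shows "cumulant M (\<lambda>\<omega>. Z \<omega> + a) n = cumulant M Z n"
proof -
  have int2: "integrable M (\<lambda>\<omega>. (Z \<omega> + a) ^ i * Z \<omega> ^ j)" for i j
  proof -
    have "(Z \<omega> + a) ^ i * Z \<omega> ^ j = (\<Sum>k\<le>i. (of_nat (i choose k) * a ^ (i - k)) * Z \<omega> ^ (k + j))" for \<omega>
      unfolding binomial_ring by (simp add: sum_distrib_left sum_distrib_right power_add mult_ac)
    then show ?thesis by (simp add: int)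
  qed
  \<comment> \<open>Joint moments of an interpolating family: positions in \<open>X\<close> carry
    \<open>Z + a\<close>, the others \<open>Z\<close>. The induction moves \<open>X\<close> from the
    empty set to all of \<open>{1..n}\<close>.\<close>
  define m :: "nat set \<Rightarrow> nat set \<Rightarrow> real" where "m = (\<lambda>X B. \<integral>\<omega>. (Z \<omega> + a) ^ card (B \<inter> X) * Z \<omega> ^ card (B - X) \<partial>M)"
  have "joint_cumulant {1..n} (m X) = joint_cumulant {1..n} (m {})" if "X \<subseteq> {1..n}" for X
    using finite_subset[OF that finite_atLeastAtMost] that
  proof (induction X rule: finite_induct)
    case (insert x X)
    define T where "T = {1..n} - {x}"
    have T: "finite T" "x \<notin> T" "insert x T = {1..n}" using insert by (auto simp: T_def)
    have "card T = n - 1" using insert by (simp add: T_def)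
    then have T0: "T \<noteq> {}" using n by auto
    have "joint_cumulant (insert x T) (m (insert x X)) = joint_cumulant (insert x T) (m X)"
    proof (rule joint_cumulant_add_const[OF T(1,2) T0])
      show "m X {} = 1" using M by (simp add: m_def prob_space.prob_space)
      fix B assume B: "B \<subseteq> T"
      then have xB: "x \<notin> B" and fB: "finite B" using T finite_subset by auto
      have "B \<inter> insert x X = B \<inter> X" "B - insert x X = B - X" using xB by auto
      then show "m (insert x X) B = m X B" by (simp add: m_def)
      have 1: "insert x B \<inter> insert x X = insert x (B \<inter> X)" "insert x B - insert x X = B - X"
        "insert x B \<inter> X = B \<inter> X" "insert x B - X = insert x (B - X)"
        using xB insert by auto
      have 2: "card (insert x (B \<inter> X)) = Suc (card (B \<inter> X))"
        "card (insert x (B - X)) = Suc (card (B - X))" using fB xB by auto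
      have "m (insert x X) (insert x B) = (\<integral>\<omega>. (Z \<omega> + a) ^ card (B \<inter> X) * Z \<omega> ^ Suc (card (B - X))
        + a * ((Z \<omega> + a) ^ card (B \<inter> X) * Z \<omega> ^ card (B - X)) \<partial>M)"
        unfolding m_def 1 2 by (rule Bochner_Integration.integral_cong) (simp_all add: algebra_simps)
      also have "\<dots> = m X (insert x B) + a * m X B"
        unfolding m_def 1 2 by (subst Bochner_Integration.integral_add) (auto simp: int2 simp del: power_Suc)
      finally show "m (insert x X) (insert x B) = m X (insert x B) + a * m X B" .
    qed
    then show ?case using insert T(3) by simp
  qed simp
  from this[of "{1..n}"] have "joint_cumulant {1..n} (m {1..n}) = joint_cumulant {1..n} (m {})" by simp
  moreover have "joint_cumulant {1..n} (m {1..n}) = cumulant M (\<lambda>\<omega>. Z \<omega> + a) n"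
    unfolding cumulant_joint_cumulant
  proof (rule joint_cumulant_cong)
    fix B assume "B \<subseteq> {1..n}"
    then have e: "B \<inter> {1..n} = B" "B - {1..n} = {}" by auto
    show "m {1..n} B = (\<integral>\<omega>. (Z \<omega> + a) ^ card B \<partial>M)" unfolding m_def e by simp
  qed
  moreover have "joint_cumulant {1..n} (m {}) = cumulant M Z n"
    unfolding cumulant_joint_cumulant by (simp add: m_def)
  ultimately show ?thesis by simp
qed

lemma cumulant_mult_const:
  "cumulant M (\<lambda>\<omega>. Z \<omega> * a) n = cumulant M Z n * a ^ n"
proof -
  have "(\<Prod>B\<in>\<pi>. \<integral>\<omega>. (Z \<omega> * a) ^ card B \<partial>M) = (\<Prod>B\<in>\<pi>. \<integral>\<omega>. Z \<omega> ^ card B \<partial>M) * a ^ n"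
    if \<pi>: "partition_on {1..n} \<pi>" for \<pi>
  proof -
    have "finite B" if "B \<in> \<pi>" for B
      by (rule finite_subset[of _ "{1..n}"]) (use \<pi> that in \<open>auto simp: partition_on_def\<close>)
    from product_partition[OF \<pi> this] have "n = (\<Sum>B\<in>\<pi>. card B)" by simp
    then have "a ^ n = (\<Prod>B\<in>\<pi>. a ^ card B)" by (metis power_sum)
    then show ?thesis by (simp add: power_mult_distrib prod.distrib)
  qed
  then show ?thesis
    unfolding cumulant_joint_cumulant joint_cumulant_def
    by (auto simp: sum_distrib_right mult.assoc intro!: sum.cong)
qed

lemma cumulant_1: "cumulant M Z 1 = (\<integral>\<omega>. Z \<omega> \<partial>M)"
proof -
  have "Collect (partition_on ({}::nat set)) = {{}}" by (auto simp: partition_on_empty)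
  then show ?thesis
    using sum_partitions_insert[of "{}" "1::nat" "\<lambda>\<pi>. partition_sign \<pi> * (\<Prod>B\<in>\<pi>. \<integral>\<omega>. Z \<omega> ^ card B \<partial>M)"]
    by (simp add: cumulant_joint_cumulant joint_cumulant_def partition_sign_def)
qed

lemma cumulant_zero:
  assumes "n \<ge> 1"
  shows "cumulant M (\<lambda>_. 0) n = 0"
proof -
  have "(\<Prod>B\<in>\<pi>. \<integral>\<omega>. (0::real) ^ card B \<partial>M) = 0" if \<pi>: "partition_on {1..n} \<pi>" for \<pi>
  proof -
    obtain B where B: "B \<in> \<pi>" using \<pi> assms by (fastforce simp: partition_on_def)
    have "finite B" "B \<noteq> {}" using \<pi> B finite_subset[of B "{1..n}"] by (auto simp: partition_on_def)
    then have "card B \<noteq> 0" by simp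
    then have "(\<integral>\<omega>. (0::real) ^ card B \<partial>M) = 0" by simp
    moreover have "finite \<pi>" using \<pi> finite_elements by blast
    ultimately show ?thesis using B prod_zero[of \<pi> "\<lambda>B. \<integral>\<omega>. (0::real) ^ card B \<partial>M"] by blast
  qed
  then show ?thesis unfolding cumulant_def by (auto intro!: sum.neutral)
qed

text \<open>A coarsening of \<sigma> is the same as a partition of the finite set \<sigma> of its
  blocks: \<open>F\<close> unites the blocks in each class, \<open>G\<close> collects the blocks
  inside each member of the coarsening. The number of classes is preserved, so the sum is the one of
  \<open>sum_partition_sign\<close> over the ground set \<sigma>.\<close>

lemma sum_partition_sign_coarser:
  fixes R :: "'a set"
  assumes R: "finite R" "R \<noteq> {}" and \<sigma>: "partition_on R \<sigma>"
  shows "(\<Sum>\<pi> | refines R \<sigma> \<pi>. partition_sign \<pi>) = of_bool (card \<sigma> = 1)"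
proof -
  have fs: "finite \<sigma>" using R \<sigma> finite_elements by blast
  have s0: "\<sigma> \<noteq> {}" using R \<sigma> by (auto simp: partition_on_def)
  have ne: "{} \<notin> \<sigma>" using \<sigma> by (auto simp: partition_on_def)
  have dj: "c = c'" if "c \<in> \<sigma>" "c' \<in> \<sigma>" "z \<in> c" "z \<in> c'" for c c' z
    using that \<sigma> by (auto simp: partition_on_def disjoint_def)
  define F where "F = (\<lambda>P. Union ` P :: 'a set set)"
  define G where "G = (\<lambda>\<pi>. (\<lambda>B. {c\<in>\<sigma>. c \<subseteq> B}) ` \<pi>)"
  \<comment> \<open>A set of blocks is recovered from its union because blocks are nonempty and
    pairwise disjoint; this makes \<open>F\<close> injective.\<close>
  have inj: "{c\<in>\<sigma>. c \<subseteq> \<Union>p} = p" if "p \<subseteq> \<sigma>" for p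
  proof -
    have "c \<in> p" if c: "c \<in> \<sigma>" "c \<subseteq> \<Union>p" for c
    proof -
      obtain z where "z \<in> c" using ne c by fastforce
      then obtain c' where "c' \<in> p" "z \<in> c'" using c by auto
      then show ?thesis using dj[of c c' z] c \<open>z \<in> c\<close> \<open>p \<subseteq> \<sigma>\<close> by auto
    qed
    then show ?thesis using that by auto
  qed
  have FG: "F (G \<pi>) = \<pi> \<and> partition_on \<sigma> (G \<pi>)" if \<pi>: "refines R \<sigma> \<pi>" for \<pi>
  proof
    have U: "\<Union>{c\<in>\<sigma>. c \<subseteq> B} = B" if "B \<in> \<pi>" for B
      using refines_obtains_subset[OF \<pi> that] by (simp add: partition_on_def)
    then show "F (G \<pi>) = \<pi>" by (force simp: F_def G_def image_image)
    show "partition_on \<sigma> (G \<pi>)"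
    proof (rule partition_onI)
      show "\<Union> (G \<pi>) = \<sigma>" using \<pi> by (auto simp: G_def refines_def)
      show "{} \<notin> G \<pi>"
      proof
        assume "{} \<in> G \<pi>"
        then obtain B where B: "B \<in> \<pi>" "{c\<in>\<sigma>. c \<subseteq> B} = {}" by (auto simp: G_def)
        then have "B = {}" using U[OF B(1)] by auto
        then show False using B \<pi> by (auto simp: refines_def partition_on_def)
      qed
      fix p q assume pq: "p \<in> G \<pi>" "q \<in> G \<pi>" "p \<noteq> q"
      then obtain B C where BC: "B \<in> \<pi>" "C \<in> \<pi>" "p = {c\<in>\<sigma>. c \<subseteq> B}" "q = {c\<in>\<sigma>. c \<subseteq> C}"
        by (auto simp: G_def)
      then have "B \<noteq> C" using pq by auto
      then have BC0: "B \<inter> C = {}" using BC \<pi> by (meson refines_def partition_onD2 disjointD)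
      have "c \<notin> q" if "c \<in> p" for c
      proof
        assume "c \<in> q"
        then have "c \<subseteq> B \<inter> C" "c \<in> \<sigma>" using that BC by auto
        then show False using BC0 ne by simp
      qed
      then show "disjnt p q" by (auto simp: disjnt_def)
    qed
  qed
  have GF: "G (F P) = P \<and> refines R \<sigma> (F P)" if P: "partition_on \<sigma> P" for P
  proof
    have sub: "p \<subseteq> \<sigma>" if "p \<in> P" for p using that P by (auto simp: partition_on_def)
    show "G (F P) = P" using inj sub by (force simp: F_def G_def image_image)
    have "partition_on R (F P)"
    proof (rule partition_onI)
      show "\<Union> (F P) = R" using P \<sigma> by (auto simp: F_def partition_on_def)
      show "{} \<notin> F P"
      proof
        assume "{} \<in> F P"
        then obtain p where p: "p \<in> P" "\<Union>p = {}" by (auto simp: F_def)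
        then show False using ne sub[OF p(1)] P by (auto simp: partition_on_def) (metis ex_in_conv subsetD)
      qed
      fix B C assume BC: "B \<in> F P" "C \<in> F P" "B \<noteq> C"
      then obtain p q where pq: "p \<in> P" "q \<in> P" "B = \<Union>p" "C = \<Union>q" "p \<noteq> q" by (auto simp: F_def)
      then have "p \<inter> q = {}" using P by (auto simp: partition_on_def disjoint_def)
      moreover have "c = c'" if "c \<in> p" "c' \<in> q" "z \<in> c" "z \<in> c'" for c c' z
        using that dj[of c c' z] sub pq by blast
      ultimately show "disjnt B C" unfolding disjnt_def pq(3,4) by fastforce
    qed
    moreover have "\<exists>B\<in>F P. c \<subseteq> B" if "c \<in> \<sigma>" for c using that P by (auto simp: F_def partition_on_def)
    ultimately show "refines R \<sigma> (F P)" using \<sigma> by (simp add: refines_def)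
  qed
  have cardF: "card (F P) = card P" if "partition_on \<sigma> P" for P
    unfolding F_def
  proof (rule card_image, rule inj_onI)
    fix p q assume "p \<in> P" "q \<in> P" and e: "\<Union>p = \<Union>q"
    then have "p \<subseteq> \<sigma>" "q \<subseteq> \<sigma>" using that by (auto simp: partition_on_def)
    then show "p = q" using e by (metis inj)
  qed
  have cardG: "card (G \<pi>) = card \<pi>" if "refines R \<sigma> \<pi>" for \<pi>
    using FG[OF that] cardF[of "G \<pi>"] by simp
  have "(\<Sum>\<pi> | refines R \<sigma> \<pi>. partition_sign \<pi>) = (\<Sum>P | partition_on \<sigma> P. partition_sign P)"
    by (rule sum.reindex_bij_witness[of _ F G])
      (use FG GF cardG in \<open>auto simp: partition_sign_def\<close>)
  then show ?thesis using sum_partition_sign[OF fs s0] by simp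
qed

text \<open>The partitions compatible with a covering by blocks are the coarsenings of the partition into
  connected components, so their signs cancel unless there is a single component.\<close>

lemma sum_partition_sign_compatible:
  fixes R :: "'a set"
  assumes R: "finite R" "R \<noteq> {}" and F: "\<Union>F = R" "{} \<notin> F"
  shows "(\<Sum>\<pi> | partition_on R \<pi> \<and> (\<forall>b\<in>F. \<exists>B\<in>\<pi>. b \<subseteq> B). partition_sign \<pi>)
    = of_bool (\<forall>T. T \<subseteq> R \<longrightarrow> T \<noteq> {} \<longrightarrow> T \<noteq> R \<longrightarrow> (\<exists>b\<in>F. b \<inter> T \<noteq> {} \<and> b - T \<noteq> {}))"
proof -
  define L where "L = {(k, l). \<exists>b\<in>F. k \<in> b \<and> l \<in> b}"
  have LR: "L \<subseteq> R \<times> R" using F by (auto simp: L_def)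
  have symL: "sym L" by (auto simp: L_def sym_def)
  have eq: "equiv R (L\<^sup>+)"
  proof (rule equivI)
    show "L\<^sup>+ \<subseteq> R \<times> R" using LR by (rule trancl_subset_Sigma)
    show "refl_on R (L\<^sup>+)" using F LR by (auto simp: refl_on_def L_def)
    show "sym (L\<^sup>+)" using symL by (rule sym_trancl)
    show "trans (L\<^sup>+)" by simp
  qed
  define \<sigma> where "\<sigma> = R // L\<^sup>+"
  have \<sigma>: "partition_on R \<sigma>" unfolding \<sigma>_def by (rule partition_on_quotient[OF eq])
  have bs: "\<exists>c\<in>\<sigma>. b \<subseteq> c" if bF: "b \<in> F" for b
  proof -
    obtain k where k: "k \<in> b" using F(2) bF by (metis ex_in_conv)
    have "b \<subseteq> L\<^sup>+ `` {k}" using that k by (auto simp: L_def)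
    moreover have "L\<^sup>+ `` {k} \<in> \<sigma>" unfolding \<sigma>_def using k that F by (auto intro!: quotientI)
    ultimately show ?thesis by blast
  qed
  \<comment> \<open>A compatible partition cannot separate linked elements, hence contains each
    component in one of its members; conversely every member of \<open>F\<close> lies in a single
    component.\<close>
  have comp: "(partition_on R \<pi> \<and> (\<forall>b\<in>F. \<exists>B\<in>\<pi>. b \<subseteq> B)) \<longleftrightarrow> refines R \<sigma> \<pi>" for \<pi>
  proof
    assume *: "partition_on R \<pi> \<and> (\<forall>b\<in>F. \<exists>B\<in>\<pi>. b \<subseteq> B)"
    have part_uniq: "B = C" if "B \<in> \<pi>" "C \<in> \<pi>" "z \<in> B" "z \<in> C" for B C z
      using that * partition_onD2[of R \<pi>] disjointD[of \<pi> B C] by blast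
    have step: "l \<in> B" if "(k, l) \<in> L\<^sup>+" "k \<in> B" "B \<in> \<pi>" for k l B
      using that(1,2)
    proof (induction rule: trancl_induct)
      case (base l)
      then obtain b where "b \<in> F" "k \<in> b" "l \<in> b" by (auto simp: L_def)
      moreover obtain B' where B': "B' \<in> \<pi>" "b \<subseteq> B'" using * calculation by blast
      moreover have "B' = B"
        using part_uniq[of B' B k] calculation base that(3) by blast
      ultimately show ?case by blast
    next
      case (step l l')
      then obtain b where "b \<in> F" "l \<in> b" "l' \<in> b" by (auto simp: L_def)
      moreover obtain B' where B': "B' \<in> \<pi>" "b \<subseteq> B'" using * calculation by blast
      moreover have "B' = B"
        using part_uniq[of B' B l] calculation step that(3) by blast
      ultimately show ?case by blast
    qed
    have "\<exists>B\<in>\<pi>. c \<subseteq> B" if c: "c \<in> \<sigma>" for c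
    proof -
      obtain k where k: "k \<in> R" "c = L\<^sup>+ `` {k}" using c by (auto simp: \<sigma>_def quotient_def)
      obtain B where "B \<in> \<pi>" "k \<in> B" using * k by (auto simp: partition_on_def)
      then show ?thesis using step k by blast
    qed
    then show "refines R \<sigma> \<pi>" using * \<sigma> by (simp add: refines_def)
  next
    assume *: "refines R \<sigma> \<pi>"
    have "\<exists>B\<in>\<pi>. b \<subseteq> B" if "b \<in> F" for b
      using bs[OF that] * by (meson order_trans refines_def)
    then show "partition_on R \<pi> \<and> (\<forall>b\<in>F. \<exists>B\<in>\<pi>. b \<subseteq> B)" using * by (simp add: refines_def)
  qed
  \<comment> \<open>Having one component is rewritten as having no uncrossed cut, the form in which
    connectedness is used when rows are added one by one.\<close>
  have "card \<sigma> = 1 \<longleftrightarrow> (\<forall>T. T \<subseteq> R \<longrightarrow> T \<noteq> {} \<longrightarrow> T \<noteq> R \<longrightarrow> (\<exists>b\<in>F. b \<inter> T \<noteq> {} \<and> b - T \<noteq> {}))"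
    (is "_ \<longleftrightarrow> ?conn")
  proof
    assume "card \<sigma> = 1"
    then obtain c where "\<sigma> = {c}" by (auto simp: card_1_singleton_iff)
    then have s: "\<sigma> = {R}" using \<sigma> by (auto simp: partition_on_def)
    show ?conn
    proof (intro allI impI)
      fix T assume T: "T \<subseteq> R" "T \<noteq> {}" "T \<noteq> R"
      then obtain k l where kl: "k \<in> T" "l \<in> R" "l \<notin> T" by auto
      have "L\<^sup>+ `` {k} \<in> \<sigma>" unfolding \<sigma>_def using kl T by (auto intro!: quotientI)
      then have "(k, l) \<in> L\<^sup>+" using s kl by auto
      then have "l \<in> T \<or> (\<exists>b\<in>F. b \<inter> T \<noteq> {} \<and> b - T \<noteq> {})"
      proof (induction rule: trancl_induct)
        case (base l) then show ?case using kl by (auto simp: L_def)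
      next
        case (step l l') then show ?case by (auto simp: L_def)
      qed
      then show "\<exists>b\<in>F. b \<inter> T \<noteq> {} \<and> b - T \<noteq> {}" using kl by blast
    qed
  next
    assume conn: ?conn
    obtain c where c: "c \<in> \<sigma>" using \<sigma> R by (auto simp: partition_on_def)
    have cR: "c \<subseteq> R" "c \<noteq> {}" using c \<sigma> by (auto simp: partition_on_def)
    have "c = R"
    proof (rule ccontr)
      assume "c \<noteq> R"
      then obtain b where b: "b \<in> F" "b \<inter> c \<noteq> {}" "b - c \<noteq> {}" using conn cR by blast
      obtain c' where "c' \<in> \<sigma>" "b \<subseteq> c'" using bs[OF b(1)] by blast
      then have "c' = c" using b c \<sigma> by (auto simp: partition_on_def disjoint_def)
      then show False using b \<open>b \<subseteq> c'\<close> by auto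
    qed
    have "c' = R" if "c' \<in> \<sigma>" for c'
    proof (rule ccontr)
      assume "c' \<noteq> R"
      then have "c' \<inter> R = {}" using c that \<open>c = R\<close> \<sigma> by (meson partition_onD2 disjointD)
      moreover have "c' \<subseteq> R" "c' \<noteq> {}" using that \<sigma> by (auto simp: partition_on_def)
      ultimately show False by blast
    qed
    then have "\<sigma> = {R}" using c \<open>c = R\<close> by blast
    then show "card \<sigma> = 1" by simp
  qed
  then show ?thesis
    unfolding comp sum_partition_sign_coarser[OF R \<sigma>] by simp
qed

section \<open>Non-flat partitions\<close>

definition block :: "'a set set \<Rightarrow> 'a \<Rightarrow> 'a set" where
  "block \<rho> z = (THE b. b \<in> \<rho> \<and> z \<in> b)"

lemma block_eq:
  assumes "partition_on A \<rho>" "b \<in> \<rho>" "z \<in> b"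
  shows "block \<rho> z = b"
  unfolding block_def
proof (rule the_equality)
  fix b' assume "b' \<in> \<rho> \<and> z \<in> b'"
  then show "b' = b" using assms disjointD[OF partition_onD2[OF assms(1)], of b' b] by blast
qed (use assms in simp)

lemma block_in:
  assumes "partition_on A \<rho>" "z \<in> A"
  shows "block \<rho> z \<in> \<rho>" "z \<in> block \<rho> z"
proof -
  obtain b where "b \<in> \<rho>" "z \<in> b" using assms by (auto simp: partition_on_def)
  then show "block \<rho> z \<in> \<rho>" "z \<in> block \<rho> z" using block_eq[OF assms(1)] by auto
qed

lemma partition_on_eq_block_image:
  assumes "partition_on A \<rho>"
  shows "\<rho> = block \<rho> ` A"
proof
  show "\<rho> \<subseteq> block \<rho> ` A"
  proof
    fix b assume b: "b \<in> \<rho>"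
    then obtain z where "z \<in> b" using assms by (metis ex_in_conv partition_onD3)
    moreover have "z \<in> A" using calculation b assms by (auto simp: partition_on_def)
    ultimately show "b \<in> block \<rho> ` A" using block_eq[OF assms b] by force
  qed
qed (use block_in[OF assms] in auto)

text \<open>The first coordinate of a position is the copy (row), the second the vertex of the
  graph. Injectivity of \<open>fst\<close> on blocks says that two vertices of the same copy are
  never identified.\<close>

definition nonflat_partitions :: "nat set \<Rightarrow> nat set \<Rightarrow> (nat \<times> nat) set set set" where
  "nonflat_partitions R V = {\<rho>. partition_on (R \<times> V) \<rho> \<and> (\<forall>b\<in>\<rho>. inj_on fst b)}"

text \<open>Connectedness of the rows when those meeting a common block are linked, phrased by cuts:
  every proper nonempty set of rows is crossed by a block.\<close>

definition row_connected :: "nat set \<Rightarrow> (nat \<times> nat) set set \<Rightarrow> bool" where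
  "row_connected R \<rho> \<longleftrightarrow>
     (\<forall>T. T \<subseteq> R \<longrightarrow> T \<noteq> {} \<longrightarrow> T \<noteq> R \<longrightarrow> (\<exists>b\<in>\<rho>. fst ` b \<inter> T \<noteq> {} \<and> fst ` b - T \<noteq> {}))"

lemma finite_nonflat_partitions: "finite R \<Longrightarrow> finite V \<Longrightarrow> finite (nonflat_partitions R V)"
  unfolding nonflat_partitions_def
  by (rule finite_subset[OF _ finitely_many_partition_on[of "R \<times> V"]]) auto

lemma nonflat_partitions_rows:
  assumes "\<rho> \<in> nonflat_partitions R V" "b \<in> \<rho>"
  shows "b \<subseteq> R \<times> V" "fst ` b \<subseteq> R" "b \<noteq> {}"
proof -
  show "b \<subseteq> R \<times> V" "b \<noteq> {}" using assms by (auto simp: nonflat_partitions_def partition_on_def)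
  then show "fst ` b \<subseteq> R" by auto
qed

text \<open>Since no block of \<rho> crosses from one member of \<pi> to another, a block containing
  one position with row in \<open>B\<close> has all its rows in \<open>B\<close>.\<close>

lemma nonflat_partitions_restrict:
  assumes \<rho>: "\<rho> \<in> nonflat_partitions R V" and \<pi>: "partition_on R \<pi>" "B \<in> \<pi>"
    and comp: "\<forall>b\<in>\<rho>. \<exists>B\<in>\<pi>. fst ` b \<subseteq> B"
  shows "{b\<in>\<rho>. fst ` b \<subseteq> B} \<in> nonflat_partitions B V"
proof -
  have part: "partition_on (R \<times> V) \<rho>" using \<rho> by (simp add: nonflat_partitions_def)
  have "partition_on (B \<times> V) {b\<in>\<rho>. fst ` b \<subseteq> B}"
  proof (rule partition_onI)
    show "\<Union>{b\<in>\<rho>. fst ` b \<subseteq> B} = B \<times> V"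
    proof
      show "\<Union>{b\<in>\<rho>. fst ` b \<subseteq> B} \<subseteq> B \<times> V"
        using nonflat_partitions_rows(1)[OF \<rho>] by fastforce
      show "B \<times> V \<subseteq> \<Union>{b\<in>\<rho>. fst ` b \<subseteq> B}"
      proof
        fix z assume z: "z \<in> B \<times> V"
        then have "z \<in> R \<times> V" using \<pi> by (auto simp: partition_on_def)
        then obtain b where b: "b \<in> \<rho>" "z \<in> b" using part by (auto simp: partition_on_def)
        then obtain B' where B': "B' \<in> \<pi>" "fst ` b \<subseteq> B'" using comp by blast
        then have "fst z \<in> B'" "fst z \<in> B" using b z by auto
        then have "B' = B" using disjointD[OF partition_onD2[OF \<pi>(1)] B'(1) \<pi>(2)] by blast
        then show "z \<in> \<Union>{b\<in>\<rho>. fst ` b \<subseteq> B}" using b B' by blast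
      qed
    qed
    show "disjnt p q" if "p \<in> {b\<in>\<rho>. fst ` b \<subseteq> B}" "q \<in> {b\<in>\<rho>. fst ` b \<subseteq> B}" "p \<noteq> q" for p q
      using that disjointD[OF partition_onD2[OF part], of p q] by (auto simp: disjnt_def)
    show "{} \<notin> {b\<in>\<rho>. fst ` b \<subseteq> B}" using partition_onD3[OF part] by simp
  qed
  then show ?thesis using \<rho> by (simp add: nonflat_partitions_def)
qed

text \<open>After expanding the product, a choice of one pattern per member of \<pi> is the same as
  one pattern on all of \<open>R\<close> whose blocks respect \<pi>: \<open>j\<close> takes the
  union of the choices and \<open>i\<close> restricts to the members.\<close>

lemma prod_sum_nonflat_partitions:
  fixes I :: "(nat \<times> nat) set set \<Rightarrow> real"
  assumes fin: "finite R" "finite V" and \<pi>: "partition_on R \<pi>"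
  shows "(\<Prod>B\<in>\<pi>. \<Sum>\<rho>\<in>nonflat_partitions B V. I \<rho>)
    = (\<Sum>\<rho> | \<rho> \<in> nonflat_partitions R V \<and> (\<forall>b\<in>\<rho>. \<exists>B\<in>\<pi>. fst ` b \<subseteq> B). \<Prod>B\<in>\<pi>. I {b\<in>\<rho>. fst ` b \<subseteq> B})"
proof -
  have fp: "finite \<pi>" using fin \<pi> finite_elements by blast
  have fB: "finite B" if "B \<in> \<pi>" for B
    by (rule finite_subset[OF _ fin(1)]) (use that \<pi> in \<open>auto simp: partition_on_def\<close>)
  have uniq: "B = C" if "B \<in> \<pi>" "C \<in> \<pi>" "z \<in> B" "z \<in> C" for B C z
    using that disjointD[OF partition_onD2[OF \<pi>], of B C] by blast
  let ?S = "{\<rho>. \<rho> \<in> nonflat_partitions R V \<and> (\<forall>b\<in>\<rho>. \<exists>B\<in>\<pi>. fst ` b \<subseteq> B)}"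
  let ?P = "PiE \<pi> (\<lambda>B. nonflat_partitions B V)"
  define i where "i = (\<lambda>\<rho>. \<lambda>B\<in>\<pi>. {b\<in>\<rho>::(nat \<times> nat) set set. fst ` b \<subseteq> B})"
  define j where "j = (\<lambda>g. \<Union>B\<in>\<pi>. g B :: (nat \<times> nat) set set)"
  have g1: "{b \<in> j g. fst ` b \<subseteq> B} = g B" if g: "g \<in> ?P" and B: "B \<in> \<pi>" for g B
  proof -
    have "b \<in> g B" if b: "b \<in> j g" "fst ` b \<subseteq> B" for b
    proof -
      obtain C where C: "C \<in> \<pi>" "b \<in> g C" using b by (auto simp: j_def)
      have gC: "g C \<in> nonflat_partitions C V" using g C by auto
      obtain z where "z \<in> b" using nonflat_partitions_rows(3)[OF gC C(2)] by blast
      then have "fst z \<in> C" "fst z \<in> B" using nonflat_partitions_rows(2)[OF gC C(2)] b by auto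
      then have "C = B" by (rule uniq[OF C(1) B])
      then show ?thesis using C by simp
    qed
    moreover have "b \<in> j g \<and> fst ` b \<subseteq> B" if "b \<in> g B" for b
    proof -
      have "g B \<in> nonflat_partitions B V" using g B by auto
      from nonflat_partitions_rows(2)[OF this that] show ?thesis
        using that B unfolding j_def by blast
    qed
    ultimately show ?thesis by blast
  qed
  have ij: "i (j g) = g" if g: "g \<in> ?P" for g
  proof
    fix B show "i (j g) B = g B"
      using g1[OF g, of B] g by (cases "B \<in> \<pi>") (auto simp: i_def PiE_def extensional_def)
  qed
  have jS: "j g \<in> ?S" if g: "g \<in> ?P" for g
  proof -
    have gB: "partition_on (B \<times> V) (g B)" "\<forall>b\<in>g B. inj_on fst b" if "B \<in> \<pi>" for B
      using g that by (auto simp: nonflat_partitions_def)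
    have "partition_on (R \<times> V) (j g)"
    proof (rule partition_onI)
      have "\<Union> (j g) = (\<Union>B\<in>\<pi>. \<Union>(g B))" by (auto simp: j_def)
      also have "\<dots> = (\<Union>B\<in>\<pi>. B \<times> V)" using gB(1)[THEN partition_onD1] by auto
      also have "\<dots> = R \<times> V" using \<pi> by (auto simp: partition_on_def)
      finally show "\<Union> (j g) = R \<times> V" .
      show "{} \<notin> j g" using gB(1)[THEN partition_onD3] by (auto simp: j_def)
      fix p q assume pq: "p \<in> j g" "q \<in> j g" "p \<noteq> q"
      then obtain B C where BC: "B \<in> \<pi>" "C \<in> \<pi>" "p \<in> g B" "q \<in> g C" by (auto simp: j_def)
      have "p \<subseteq> B \<times> V" "q \<subseteq> C \<times> V" using gB(1)[THEN partition_onD1] BC by auto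
      then have "B \<noteq> C \<Longrightarrow> disjnt p q" using uniq[OF BC(1,2)] by (fastforce simp: disjnt_def)
      moreover have "B = C \<Longrightarrow> disjnt p q"
        using BC pq disjointD[OF partition_onD2[OF gB(1)[OF BC(1)]], of p q] by (auto simp: disjnt_def)
      ultimately show "disjnt p q" by blast
    qed
    moreover have "\<exists>B\<in>\<pi>. fst ` b \<subseteq> B" if bj: "b \<in> j g" for b
    proof -
      obtain B where B: "B \<in> \<pi>" "b \<in> g B" using bj by (auto simp: j_def)
      then have "g B \<in> nonflat_partitions B V" using g by auto
      from nonflat_partitions_rows(2)[OF this B(2)] show ?thesis using B by blast
    qed
    moreover have "\<forall>b\<in>j g. inj_on fst b" using gB(2) by (simp add: j_def)
    ultimately show ?thesis by (simp add: nonflat_partitions_def)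
  qed
  have ji: "j (i \<rho>) = \<rho>" "i \<rho> \<in> ?P" if \<rho>: "\<rho> \<in> ?S" for \<rho>
  proof -
    show "j (i \<rho>) = \<rho>" using \<rho> by (auto simp: i_def j_def)
    show "i \<rho> \<in> ?P"
      using \<rho> nonflat_partitions_restrict[OF _ \<pi>, of \<rho> V] by (auto simp: i_def)
  qed
  have "(\<Prod>B\<in>\<pi>. \<Sum>\<rho>\<in>nonflat_partitions B V. I \<rho>) = (\<Sum>g\<in>?P. \<Prod>B\<in>\<pi>. I (g B))"
    by (rule prod_sum_PiE) (auto simp: fp fB fin intro: finite_nonflat_partitions)
  also have "\<dots> = (\<Sum>\<rho>\<in>?S. \<Prod>B\<in>\<pi>. I {b\<in>\<rho>. fst ` b \<subseteq> B})"
    by (rule sum.reindex_bij_witness[of _ i j])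
      (use ij jS ji g1 in \<open>auto intro!: prod.cong arg_cong[where f = I]\<close>)
  finally show ?thesis .
qed

text \<open>By \<open>mult\<close> the product over the members of \<pi> no longer depends on \<pi>,
  so after exchanging the two sums each \<rho> is weighted by the sum of the signs of the partitions
  compatible with it. That sum is 1 for row-connected \<rho> and 0 otherwise.\<close>

lemma joint_cumulant_nonflat_partitions:
  fixes I :: "(nat \<times> nat) set set \<Rightarrow> real"
  assumes R: "finite R" "R \<noteq> {}" and V: "finite V" "V \<noteq> {}"
    and mult: "\<And>\<rho> \<pi>. \<rho> \<in> nonflat_partitions R V \<Longrightarrow> partition_on R \<pi> \<Longrightarrow>
      (\<forall>b\<in>\<rho>. \<exists>B\<in>\<pi>. fst ` b \<subseteq> B) \<Longrightarrow> (\<Prod>B\<in>\<pi>. I {b\<in>\<rho>. fst ` b \<subseteq> B}) = I \<rho>"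
  shows "joint_cumulant R (\<lambda>B. \<Sum>\<rho>\<in>nonflat_partitions B V. I \<rho>)
    = (\<Sum>\<rho> | \<rho> \<in> nonflat_partitions R V \<and> row_connected R \<rho>. I \<rho>)"
proof -
  let ?N = "nonflat_partitions R V" and ?P = "{\<pi>. partition_on R \<pi>}"
  let ?c = "\<lambda>\<rho> \<pi>. \<forall>b\<in>\<rho>. \<exists>B\<in>\<pi>. fst ` b \<subseteq> (B :: nat set)"
  have fN: "finite ?N" using R V by (intro finite_nonflat_partitions)
  have fP: "finite ?P" using R by (intro finitely_many_partition_on)
  have "joint_cumulant R (\<lambda>B. \<Sum>\<rho>\<in>nonflat_partitions B V. I \<rho>)
    = (\<Sum>\<pi>\<in>?P. \<Sum>\<rho>\<in>?N. if ?c \<rho> \<pi> then partition_sign \<pi> * I \<rho> else 0)"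
    unfolding joint_cumulant_def
  proof (rule sum.cong[OF refl])
    fix \<pi> assume "\<pi> \<in> ?P"
    then have \<pi>: "partition_on R \<pi>" by simp
    have "(\<Prod>B\<in>\<pi>. \<Sum>\<rho>\<in>nonflat_partitions B V. I \<rho>) = (\<Sum>\<rho> | \<rho> \<in> ?N \<and> ?c \<rho> \<pi>. I \<rho>)"
      unfolding prod_sum_nonflat_partitions[OF R(1) V(1) \<pi>]
      by (rule sum.cong[OF refl]) (use mult \<pi> in auto)
    also have "\<dots> = (\<Sum>\<rho>\<in>?N. if ?c \<rho> \<pi> then I \<rho> else 0)"
      using fN by (rule sum.inter_filter)
    finally show "partition_sign \<pi> * (\<Prod>B\<in>\<pi>. \<Sum>\<rho>\<in>nonflat_partitions B V. I \<rho>)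
      = (\<Sum>\<rho>\<in>?N. if ?c \<rho> \<pi> then partition_sign \<pi> * I \<rho> else 0)"
      by (simp add: sum_distrib_left if_distrib cong: if_cong)
  qed
  also have "\<dots> = (\<Sum>\<rho>\<in>?N. \<Sum>\<pi>\<in>?P. if ?c \<rho> \<pi> then partition_sign \<pi> * I \<rho> else 0)"
    by (rule sum.swap)
  also have "\<dots> = (\<Sum>\<rho>\<in>?N. if row_connected R \<rho> then I \<rho> else 0)"
  proof (rule sum.cong[OF refl])
    fix \<rho> assume \<rho>: "\<rho> \<in> ?N"
    have U: "\<Union>\<rho> = R \<times> V" using \<rho> by (auto simp: nonflat_partitions_def partition_on_def)
    have "\<Union>((`) fst ` \<rho>) = fst ` \<Union>\<rho>" by auto
    then have UF: "\<Union>((`) fst ` \<rho>) = R" unfolding U using V by auto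
    have nF: "{} \<notin> (`) fst ` \<rho>" using nonflat_partitions_rows(3)[OF \<rho>] by auto
    have "(\<Sum>\<pi>\<in>?P. if ?c \<rho> \<pi> then partition_sign \<pi> * I \<rho> else 0)
      = (\<Sum>\<pi> | partition_on R \<pi> \<and> ?c \<rho> \<pi>. partition_sign \<pi> * I \<rho>)"
      using sum.inter_filter[OF fP, of "\<lambda>\<pi>. partition_sign \<pi> * I \<rho>" "?c \<rho>"] by simp
    also have "\<dots> = (\<Sum>\<pi> | partition_on R \<pi> \<and> (\<forall>b\<in>(`) fst ` \<rho>. \<exists>B\<in>\<pi>. b \<subseteq> B). partition_sign \<pi>) * I \<rho>"
      by (simp add: sum_distrib_right)
    also have "\<dots> = of_bool (row_connected R \<rho>) * I \<rho>"
      unfolding sum_partition_sign_compatible[OF R UF nF] row_connected_def by simp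
    finally show "(\<Sum>\<pi>\<in>?P. if ?c \<rho> \<pi> then partition_sign \<pi> * I \<rho> else 0)
      = (if row_connected R \<rho> then I \<rho> else 0)" by simp
  qed
  also have "\<dots> = (\<Sum>\<rho> | \<rho> \<in> ?N \<and> row_connected R \<rho>. I \<rho>)"
    using fN by (rule sum.inter_filter[symmetric])
  finally show ?thesis .
qed

text \<open>A partition is determined by the map sending each element to a representative of its block
  in the lowest possible row.\<close>

lemma card_nonflat_partitions:
  "card (nonflat_partitions {1..n} {1..r}) \<le> (fact n * r ^ n) ^ r"
proof -
  define Z where "Z = {1..n} \<times> {1..r}"
  \<comment> \<open>A representative in the lowest row of its block lies, for a position in row k,
    in one of the rows 1 to k, which leaves k * r choices. The product over the rows is the source
    of the factor \<open>fact n ^ r\<close>.\<close>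
  define Q where "Q = PiE Z (\<lambda>z. {1..fst z} \<times> {1..r})"
  define fib where "fib = (\<lambda>p::nat \<times> nat \<Rightarrow> nat \<times> nat. (\<lambda>v. {z\<in>Z. p z = v}) ` p ` Z)"
  have fQ: "finite Q" unfolding Q_def Z_def by (intro finite_PiE) auto
  have "nonflat_partitions {1..n} {1..r} \<subseteq> fib ` Q"
  proof
    fix \<rho> assume "\<rho> \<in> nonflat_partitions {1..n} {1..r}"
    then have \<rho>: "partition_on Z \<rho>" by (simp add: nonflat_partitions_def Z_def)
    define s where "s = (\<lambda>b. arg_min_on fst b :: nat \<times> nat)"
    have s: "s b \<in> b" "\<And>z. z \<in> b \<Longrightarrow> fst (s b) \<le> fst z" if "b \<in> \<rho>" for b
    proof -
      have "b \<subseteq> Z" "b \<noteq> {}" using that \<rho> by (auto simp: partition_on_def)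
      then have "finite b" by (auto simp: Z_def intro: finite_subset)
      then show "s b \<in> b" "\<And>z. z \<in> b \<Longrightarrow> fst (s b) \<le> fst z"
        unfolding s_def using \<open>b \<noteq> {}\<close> by (auto intro: arg_min_if_finite arg_min_least)
    qed
    define p where "p = (\<lambda>z\<in>Z. s (block \<rho> z))"
    have pZ: "p z \<in> Z" "fst (p z) \<le> fst z" if "z \<in> Z" for z
    proof -
      have b: "block \<rho> z \<in> \<rho>" "z \<in> block \<rho> z" using block_in[OF \<rho> that] by auto
      then have "block \<rho> z \<subseteq> Z" using \<rho> by (auto simp: partition_on_def)
      then show "p z \<in> Z" "fst (p z) \<le> fst z" using s[OF b(1)] b that by (auto simp: p_def)
    qed
    have "p \<in> Q" unfolding Q_def
    proof (rule PiE_I)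
      fix z assume z: "z \<in> Z"
      show "p z \<in> {1..fst z} \<times> {1..r}" using pZ[OF z] by (cases "p z") (auto simp: Z_def)
    qed (simp add: p_def)
    moreover have "fib p = \<rho>"
    proof -
      have "{z\<in>Z. p z = p w} = block \<rho> w" if w: "w \<in> Z" for w
      proof -
        have bw: "block \<rho> w \<in> \<rho>" using block_in[OF \<rho> w] by simp
        have "block \<rho> z = block \<rho> w" if z: "z \<in> Z" "p z = p w" for z
        proof -
          have "s (block \<rho> z) = s (block \<rho> w)" using z w by (simp add: p_def)
          then have "s (block \<rho> w) \<in> block \<rho> z" "s (block \<rho> w) \<in> block \<rho> w"
            using s(1)[of "block \<rho> z"] s(1)[OF bw] block_in(1)[OF \<rho> z(1)] by auto
          then show ?thesis using block_eq[OF \<rho>] block_in(1)[OF \<rho>] z w by metis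
        qed
        moreover have "p z = p w" "z \<in> Z" if "z \<in> block \<rho> w" for z
        proof -
          show "z \<in> Z" using that bw \<rho> by (auto simp: partition_on_def)
          then show "p z = p w" using block_eq[OF \<rho> bw that] w by (simp add: p_def)
        qed
        ultimately show ?thesis using block_in(2)[OF \<rho>] by blast
      qed
      then have "fib p = block \<rho> ` Z" unfolding fib_def image_image by (intro image_cong) auto
      then show ?thesis using partition_on_eq_block_image[OF \<rho>] by simp
    qed
    ultimately show "\<rho> \<in> fib ` Q" by blast
  qed
  then have "card (nonflat_partitions {1..n} {1..r}) \<le> card (fib ` Q)"
    using fQ by (intro card_mono) auto
  also have "\<dots> \<le> card Q" using fQ by (rule card_image_le)
  also have "card Q = (\<Prod>z\<in>Z. fst z * r)"
    unfolding Q_def by (subst card_PiE) (auto simp: Z_def card_cartesian_product)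
  also have "\<dots> = (\<Prod>k\<in>{1..n}. \<Prod>i\<in>{1..r}. k * r)"
    unfolding Z_def by (subst prod.cartesian_product) (simp add: case_prod_beta)
  also have "\<dots> = (fact n * r ^ n) ^ r"
    by (simp add: prod_power_distrib prod.distrib fact_prod power_mult_distrib mult.commute
        flip: power_mult)
  finally show ?thesis .
qed

section \<open>Factorial moment measures of Poisson processes\<close>

lemma nn_integral_count_space_Times:
  "(\<integral>\<^sup>+p. f p \<partial>count_space (A \<times> B)) = (\<integral>\<^sup>+a. \<integral>\<^sup>+b. f (a, b) \<partial>count_space B \<partial>count_space A)"
proof -
  have "(\<integral>\<^sup>+p. f p \<partial>count_space (A \<times> B)) = (\<integral>\<^sup>+p. f p * indicator (A \<times> B) p \<partial>count_space UNIV)"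
    by (simp add: nn_integral_count_space_indicator)
  also have "\<dots> = (\<integral>\<^sup>+a. \<integral>\<^sup>+b. f (a, b) * indicator (A \<times> B) (a, b) \<partial>count_space UNIV \<partial>count_space UNIV)"
    by (rule nn_integral_fst_count_space[of "\<lambda>p. f p * indicator (A \<times> B) p", symmetric])
  also have "\<dots> = (\<integral>\<^sup>+a. (\<integral>\<^sup>+b. f (a, b) * indicator B b \<partial>count_space UNIV) * indicator A a \<partial>count_space UNIV)"
    by (intro nn_integral_cong) (auto simp: indicator_def)
  also have "\<dots> = (\<integral>\<^sup>+a. \<integral>\<^sup>+b. f (a, b) \<partial>count_space B \<partial>count_space A)"
    by (simp add: nn_integral_count_space_indicator)
  finally show ?thesis .
qed

lemma nn_integral_count_space_PiE_insert:
  assumes "k \<notin> K"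
  shows "(\<integral>\<^sup>+g. f g \<partial>count_space (PiE (insert k K) T))
    = (\<integral>\<^sup>+g. \<integral>\<^sup>+v. f (g(k := v)) \<partial>count_space (T k) \<partial>count_space (PiE K T))"
proof -
  have "bij_betw (\<lambda>(g, v). g(k := v)) (PiE K T \<times> T k) (PiE (insert k K) T)"
  proof (rule bij_betwI[where g="\<lambda>g. (restrict g K, g k)"])
    show "(\<lambda>(g, v). g(k := v)) \<in> PiE K T \<times> T k \<rightarrow> PiE (insert k K) T"
      by (auto split: if_splits)
    show "(\<lambda>g. (restrict g K, g k)) \<in> PiE (insert k K) T \<rightarrow> PiE K T \<times> T k" by auto
    show "(restrict (case p of (g, v) \<Rightarrow> g(k := v)) K, (case p of (g, v) \<Rightarrow> g(k := v)) k) = p"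
      if "p \<in> PiE K T \<times> T k" for p
      using that assms by (auto simp: restrict_def PiE_def extensional_def fun_eq_iff)
    show "(case (restrict g K, g k) of (g, v) \<Rightarrow> g(k := v)) = g"
      if "g \<in> PiE (insert k K) T" for g
      using that assms by (auto simp: restrict_def PiE_def extensional_def fun_eq_iff)
  qed
  from nn_integral_bij_count_space[OF this, of f, symmetric] show ?thesis
    by (simp add: nn_integral_count_space_Times)
qed

lemma nn_integral_count_space_PiE_prod:
  fixes f :: "'k \<Rightarrow> 'b \<Rightarrow> ennreal"
  assumes "finite K"
  shows "(\<integral>\<^sup>+g. (\<Prod>k\<in>K. f k (g k)) \<partial>count_space (PiE K T)) = (\<Prod>k\<in>K. \<integral>\<^sup>+v. f k v \<partial>count_space (T k))"
  using assms
proof (induction K rule: finite_induct)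
  case (insert k K)
  have "(\<Prod>j\<in>insert k K. f j ((g(k := v)) j)) = f k v * (\<Prod>j\<in>K. f j (g j))" for g :: "'k \<Rightarrow> 'b" and v
  proof -
    have "(\<Prod>j\<in>K. f j ((g(k := v)) j)) = (\<Prod>j\<in>K. f j (g j))"
      using insert by (intro prod.cong) auto
    then show ?thesis using insert by simp
  qed
  then show ?case
    using insert by (simp add: nn_integral_count_space_PiE_insert nn_integral_multc nn_integral_cmult)
qed (simp add: nn_integral_count_space_finite)

lemma measurable_pair_count_space:
  assumes "countable B" "\<And>b. b \<in> B \<Longrightarrow> (\<lambda>x. f (x, b)) \<in> measurable M N"
  shows "f \<in> measurable (M \<Otimes>\<^sub>M count_space B) N"
proof -
  have "(\<lambda>p. f (snd p, fst p)) \<in> measurable (count_space B \<Otimes>\<^sub>M M) N"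
    using assms by (intro measurable_pair_measure_countable1) simp_all
  from measurable_pair_swap[OF this] show ?thesis by simp
qed

text \<open>The falling factorial, which counts injective maps from j elements into a set of size x.
  Truncated subtraction makes it 0 for natural numbers x < j, and infinity absorbs the subtracted
  terms.\<close>

definition ffact_ennreal :: "ennreal \<Rightarrow> nat \<Rightarrow> ennreal" where
  "ffact_ennreal x j = (\<Prod>i<j. x - of_nat i)"

lemma ffact_ennreal_Suc: "ffact_ennreal x (Suc j) = ffact_ennreal x j * (x - of_nat j)"
  by (simp add: ffact_ennreal_def)

lemma borel_measurable_ffact_ennreal [measurable]:
  "f \<in> borel_measurable M \<Longrightarrow> (\<lambda>x. ffact_ennreal (f x) j) \<in> borel_measurable M"
  unfolding ffact_ennreal_def
  by (intro borel_measurable_prod_ennreal borel_measurable_minus_ennreal borel_measurable_const)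

lemma ffact_ennreal_top: "ffact_ennreal top j = top ^ j"
  by (simp add: ffact_ennreal_def ennreal_top_minus)

lemma ffact_ennreal_of_nat:
  "ffact_ennreal (of_nat k) j = (if j \<le> k then of_nat (fact k div fact (k - j)) else 0)"
proof (cases "j \<le> k")
  case True
  have "ffact_ennreal (of_nat k) j = of_nat (\<Prod>i<j. k - i)"
    unfolding ffact_ennreal_def of_nat_prod
    using True by (intro prod.cong) (auto simp: ennreal_of_nat_eq_real_of_nat ennreal_minus of_nat_diff)
  moreover have "(\<Prod>i<j. k - i) * fact (k - j) = fact k" using True
  proof (induction j)
    case (Suc j)
    then have "fact (k - j) = (k - j) * fact (k - Suc j)"
      by (metis Suc_diff_Suc Suc_le_lessD fact_Suc of_nat_id)
    then show ?case using Suc by (simp add: mult.assoc)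
  qed simp
  ultimately show ?thesis using True by (metis (no_types) fact_nonzero nonzero_mult_div_cancel_right)
next
  case False
  then show ?thesis by (auto simp: ffact_ennreal_def intro!: prod_zero bexI[of _ k])
qed

lemma emeasure_point_configuration:
  assumes "A \<in> sets borel"
  shows "emeasure (point_configuration t x) A = emeasure (count_space UNIV) {i \<in> index_set t. x i \<in> A}"
proof -
  have "emeasure (point_configuration t x) A = emeasure (count_space (index_set t)) {i \<in> index_set t. x i \<in> A}"
    unfolding point_configuration_def using assms
    by (subst emeasure_distr) (auto intro!: arg_cong2[where f=emeasure])
  also have "\<dots> = emeasure (count_space UNIV) {i \<in> index_set t. x i \<in> A}"
    by (subst (1 2) emeasure_count_space) auto
  finally show ?thesis .
qed

text \<open>If the sets \<open>C j\<close> are disjoint then a new point of \<open>C (t k)\<close> has to avoid exactly the points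
  chosen before for the same cell.\<close>

lemma count_injective_cells:
  fixes C :: "'t \<Rightarrow> 'a::topological_space set"
  assumes K: "finite K" and J: "finite J" "t ` K \<subseteq> J"
    and C: "\<And>j. j \<in> J \<Longrightarrow> C j \<in> sets borel" "disjoint_family_on C J"
  shows "(\<integral>\<^sup>+\<beta>. of_bool (inj_on \<beta> K \<and> (\<forall>k\<in>K. \<beta> k \<in> index_set u \<and> x (\<beta> k) \<in> C (t k)))
        \<partial>count_space (PiE K (\<lambda>_. UNIV)))
    = (\<Prod>j\<in>J. ffact_ennreal (emeasure (point_configuration u x) (C j)) (card {k\<in>K. t k = j}))"
  using K J(2)
proof (induction K rule: finite_induct)
  case empty
  then show ?case by (simp add: nn_integral_count_space_finite ffact_ennreal_def)
next
  case (insert k K)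
  let ?\<eta> = "\<lambda>j. emeasure (point_configuration u x) (C j)"
  let ?w = "\<lambda>\<beta>. inj_on \<beta> K \<and> (\<forall>k\<in>K. \<beta> k \<in> index_set u \<and> x (\<beta> k) \<in> C (t k))"
  let ?c = "card {j\<in>K. t j = t k}"
  have tk: "t k \<in> J" "t ` K \<subseteq> J" using insert by auto
  have inner: "(\<integral>\<^sup>+v. of_bool (inj_on (\<beta>(k := v)) (insert k K) \<and>
      (\<forall>i\<in>insert k K. (\<beta>(k := v)) i \<in> index_set u \<and> x ((\<beta>(k := v)) i) \<in> C (t i))) \<partial>count_space UNIV)
      = of_bool (?w \<beta>) * (?\<eta> (t k) - of_nat ?c)" for \<beta> :: "'b \<Rightarrow> nat"
  proof -
    have upd: "inj_on (\<beta>(k := v)) K = inj_on \<beta> K" "(\<beta>(k := v)) ` K = \<beta> ` K"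
      "(\<forall>i\<in>K. (\<beta>(k := v)) i \<in> index_set u \<and> x ((\<beta>(k := v)) i) \<in> C (t i))
        = (\<forall>i\<in>K. \<beta> i \<in> index_set u \<and> x (\<beta> i) \<in> C (t i))" for v
      using insert(2) by (auto simp: inj_on_def)
    have e: "(inj_on (\<beta>(k := v)) (insert k K) \<and>
      (\<forall>i\<in>insert k K. (\<beta>(k := v)) i \<in> index_set u \<and> x ((\<beta>(k := v)) i) \<in> C (t i)))
      \<longleftrightarrow> ?w \<beta> \<and> v \<in> {i \<in> index_set u. x i \<in> C (t k)} - \<beta> ` {j\<in>K. t j = t k}" for v
    proof -
      have "v \<notin> \<beta> ` K \<longleftrightarrow> v \<notin> \<beta> ` {j\<in>K. t j = t k}" if w: "?w \<beta>" "x v \<in> C (t k)"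
      proof -
        have "t j = t k" if j: "j \<in> K" "\<beta> j = v" for j
        proof (rule ccontr)
          assume "t j \<noteq> t k"
          then have "C (t j) \<inter> C (t k) = {}"
            using C(2) tk j by (auto simp: disjoint_family_on_def)
          then show False using w j by auto
        qed
        then show ?thesis by auto
      qed
      then show ?thesis
        unfolding inj_on_insert ball_simps upd using insert(2) by (auto simp: upd)
    qed
    show ?thesis
    proof (cases "?w \<beta>")
      case True
      let ?A = "{i \<in> index_set u. x i \<in> C (t k)}" and ?B = "\<beta> ` {j\<in>K. t j = t k}"
      have BA: "?B \<subseteq> ?A" using True by auto
      have fB: "finite ?B" using insert by auto
      have cB: "card ?B = ?c" using True by (intro card_image) (auto simp: inj_on_def)
      have "(\<integral>\<^sup>+v. of_bool (v \<in> ?A - ?B) \<partial>count_space UNIV) = emeasure (count_space UNIV) (?A - ?B)"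
      proof -
        have "(\<integral>\<^sup>+v. of_bool (v \<in> ?A - ?B) \<partial>count_space UNIV) = (\<integral>\<^sup>+v. indicator (?A - ?B) v \<partial>count_space UNIV)"
          by (intro nn_integral_cong) (simp add: indicator_def)
        also have "\<dots> = emeasure (count_space UNIV) (?A - ?B)" by (rule nn_integral_indicator) simp
        finally show ?thesis .
      qed
      \<comment> \<open>Only the removed set \<open>?B\<close> has to be finite for this
        subtraction; the cell may contain infinitely many points.\<close>
      also have "\<dots> = emeasure (count_space UNIV) ?A - emeasure (count_space UNIV) ?B"
        using BA fB by (intro emeasure_Diff) auto
      also have "\<dots> = ?\<eta> (t k) - of_nat ?c"
        using fB C(1)[OF tk(1)] by (simp add: cB emeasure_point_configuration emeasure_count_space)
      finally show ?thesis using True unfolding e by simp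
    next
      case False
      then show ?thesis unfolding e by (simp only: simp_thms of_bool_eq) simp
    qed
  qed
  have cards: "card {i \<in> insert k K. t i = j} = card {i\<in>K. t i = j} + of_bool (j = t k)" for j
  proof (cases "j = t k")
    case True
    then have "{i \<in> insert k K. t i = j} = insert k {i\<in>K. t i = j}" by auto
    then show ?thesis using insert True by simp
  next
    case False
    then have "{i \<in> insert k K. t i = j} = {i\<in>K. t i = j}" by auto
    then show ?thesis using False by simp
  qed
  have "(\<Prod>j\<in>J. ffact_ennreal (?\<eta> j) (card {i \<in> insert k K. t i = j}))
    = ffact_ennreal (?\<eta> (t k)) (Suc ?c) * (\<Prod>j\<in>J - {t k}. ffact_ennreal (?\<eta> j) (card {i \<in> K. t i = j}))"
    unfolding prod.remove[OF J(1) tk(1)] cards by (intro arg_cong2[where f="(*)"] prod.cong) auto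
  also have "\<dots> = (\<Prod>j\<in>J. ffact_ennreal (?\<eta> j) (card {i \<in> K. t i = j})) * (?\<eta> (t k) - of_nat ?c)"
    unfolding prod.remove[OF J(1) tk(1)] ffact_ennreal_Suc by (simp add: mult_ac)
  finally show ?case
    unfolding nn_integral_count_space_PiE_insert[OF insert(2)] inner
    by (simp add: nn_integral_multc insert.IH[OF tk(2)])
qed

section \<open>Factorial moments of the point counts\<close>

locale poisson_points = prob_space M
  for M :: "'w measure" +
  fixes \<tau> :: "'w \<Rightarrow> enat" and X :: "nat \<Rightarrow> 'w \<Rightarrow> 'a::topological_space" and \<Lambda> :: "'a measure"
  assumes tau [measurable]: "\<tau> \<in> measurable M (count_space UNIV)"
    and X [measurable]: "\<And>i. X i \<in> borel_measurable M"
    and ppp: "poisson_point_process M (\<lambda>\<omega>. point_configuration (\<tau> \<omega>) (\<lambda>i. X i \<omega>)) \<Lambda>"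
    and sets_Lambda: "sets \<Lambda> = sets borel"
    and sigma_finite_Lambda: "sigma_finite_measure \<Lambda>"
begin

abbreviation \<eta> :: "'w \<Rightarrow> 'a measure" where
  "\<eta> \<omega> \<equiv> point_configuration (\<tau> \<omega>) (\<lambda>i. X i \<omega>)"

lemma indep_counts:
  fixes I :: "nat set"
  assumes "finite I" "disjoint_family_on A I" "\<And>i. i \<in> I \<Longrightarrow> A i \<in> sets borel"
  shows "indep_vars (\<lambda>_. borel) (\<lambda>i \<omega>. emeasure (\<eta> \<omega>) (A i)) I"
  using ppp assms unfolding poisson_point_process_def by (auto simp: image_subset_iff)

text \<open>Measurability of a count is contained in the independence statement, which is used here
  for a family with one member.\<close>

lemma measurable_count [measurable]:
  assumes "A \<in> sets borel"
  shows "(\<lambda>\<omega>. emeasure (\<eta> \<omega>) A) \<in> borel_measurable M"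
  using indep_counts[of "{0}" "\<lambda>_. A"] assms
  by (auto simp: indep_vars_def disjoint_family_on_def)

text \<open>The j-th factorial moment of a Poisson variable with mean L is L^j: the factor k!/(k-j)!
  cancels against the k! of the Poisson weights, and shifting the series by j leaves L^j times the
  total mass. For infinite intensity the count is infinite almost surely and both sides are
  \<open>top ^ j\<close>.\<close>

lemma expectation_ffact_count:
  assumes A: "A \<in> sets borel"
  shows "(\<integral>\<^sup>+\<omega>. ffact_ennreal (emeasure (\<eta> \<omega>) A) j \<partial>M) = emeasure \<Lambda> A ^ j"
proof (cases "emeasure \<Lambda> A = \<infinity>")
  case True
  then have "AE \<omega> in M. emeasure (\<eta> \<omega>) A = \<infinity>"
    using ppp A by (auto simp: poisson_point_process_def)
  then have "(\<integral>\<^sup>+\<omega>. ffact_ennreal (emeasure (\<eta> \<omega>) A) j \<partial>M) = (\<integral>\<^sup>+\<omega>. \<infinity> ^ j \<partial>M)"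
    by (intro nn_integral_cong_AE) (auto simp: ffact_ennreal_top)
  then show ?thesis using True by (simp add: emeasure_space_1)
next
  case False
  define L where "L = measure \<Lambda> A"
  have L: "emeasure \<Lambda> A = ennreal L" "L \<ge> 0"
    using False by (auto simp: L_def emeasure_eq_ennreal_measure less_top)
  define S where "S = (\<lambda>k::nat. {\<omega> \<in> space M. emeasure (\<eta> \<omega>) A = of_nat k})"
  note measurable_count[OF A, measurable]
  have S [measurable]: "S k \<in> sets M" for k unfolding S_def by measurable
  have pS: "emeasure M (S k) = ennreal (L ^ k / fact k * exp (- L))" for k
    using ppp A False unfolding poisson_point_process_def S_def L_def emeasure_eq_measure
    by (auto simp: less_top)
  have sums: "(\<lambda>k. L ^ k / fact k * exp (- L)) sums 1"
    using sums_mult2[OF exp_converges[of L], of "exp (- L)"]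
    by (simp add: exp_minus_inverse divide_inverse mult_ac)
  have dis: "disjoint_family S" by (auto simp: disjoint_family_on_def S_def)
  \<comment> \<open>The Poisson weights already sum to 1, so the count is almost surely a natural
    number and the expectation may be split according to its value.\<close>
  have "emeasure M (\<Union>k. S k) = (\<Sum>k. emeasure M (S k))"
    using dis by (intro suminf_emeasure[symmetric]) auto
  also have "\<dots> = 1"
    unfolding pS using sums L by (subst suminf_ennreal2) (auto simp: sums_iff)
  finally have "AE \<omega> in M. \<omega> \<in> (\<Union>k. S k)"
    by (intro AE_prob_1) (auto simp: measure_def)
  then have "(\<integral>\<^sup>+\<omega>. ffact_ennreal (emeasure (\<eta> \<omega>) A) j \<partial>M)
    = (\<integral>\<^sup>+\<omega>. (\<Sum>k. ffact_ennreal (of_nat k) j * indicator (S k) \<omega>) \<partial>M)"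
  proof (intro nn_integral_cong_AE, eventually_elim)
    fix \<omega> assume "\<omega> \<in> (\<Union>k. S k)"
    then obtain k where k: "\<omega> \<in> S k" by auto
    then have "indicator (S i) \<omega> = (indicator {k} i :: ennreal)" for i
      using dis by (auto simp: disjoint_family_on_def indicator_def)
    then have "(\<Sum>i. ffact_ennreal (of_nat i) j * indicator (S i) \<omega>) = ffact_ennreal (of_nat k) j"
      by (subst suminf_finite[of "{k}"]) (auto simp: indicator_def)
    then show "ffact_ennreal (emeasure (\<eta> \<omega>) A) j = (\<Sum>i. ffact_ennreal (of_nat i) j * indicator (S i) \<omega>)"
      using k by (simp add: S_def)
  qed
  also have "\<dots> = (\<Sum>k. ffact_ennreal (of_nat k) j * emeasure M (S k))"
    by (subst nn_integral_suminf) (auto simp: nn_integral_cmult)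
  also have "\<dots> = (\<Sum>k. ennreal (if j \<le> k then L ^ k / fact (k - j) * exp (- L) else 0))"
  proof (rule suminf_cong)
    fix k
    have "ennreal (real (fact k div fact (k - j)) * (L ^ k / fact k * exp (- L))) = ennreal (L ^ k / fact (k - j) * exp (- L))"
      if "j \<le> k"
    proof -
      have "fact (k - j) dvd (fact k :: nat)" by (rule fact_dvd) simp
      then have "real (fact k div fact (k - j)) = fact k / fact (k - j)"
        by (metis of_nat_fact real_of_nat_div)
      then show ?thesis by simp
    qed
    then show "ffact_ennreal (of_nat k) j * emeasure M (S k)
      = ennreal (if j \<le> k then L ^ k / fact (k - j) * exp (- L) else 0)"
      unfolding ffact_ennreal_of_nat pS
      using L by (auto simp: ennreal_of_nat_eq_real_of_nat simp flip: ennreal_mult)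
  qed
  also have "\<dots> = ennreal (L ^ j)"
  proof -
    have "(\<lambda>k. L ^ (k + j) / fact k * exp (- L)) sums (1 * L ^ j)"
      using sums_mult2[OF sums, of "L ^ j"] by (simp add: power_add mult_ac)
    then have "(\<lambda>k. (\<lambda>k. if j \<le> k then L ^ k / fact (k - j) * exp (- L) else 0) (k + j)) sums (L ^ j)"
      by simp
    then have "(\<lambda>k. if j \<le> k then L ^ k / fact (k - j) * exp (- L) else 0) sums (L ^ j)"
      by (subst (asm) sums_iff_shift) (auto simp: sum.neutral)
    then show ?thesis using L by (subst suminf_ennreal2) (auto simp: sums_iff)
  qed
  finally show ?thesis using L by (simp add: ennreal_power)
qed

text \<open>Independence is available for disjoint sets only, whereas the sides \<open>A k\<close>
  may overlap or coincide. They are therefore cut into the atoms of the algebra they generate; a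
  tuple in the rectangle picks one atom \<open>t k\<close> for each coordinate. For fixed
  \<open>t\<close> the number of injective tuples is a product of falling factorials of independent
  counts, whose expectation factorizes.\<close>

lemma expectation_count_rectangle:
  fixes K :: "'k set" and A :: "'k \<Rightarrow> 'a set"
  assumes K: "finite K" and A: "\<And>k. k \<in> K \<Longrightarrow> A k \<in> sets borel"
  shows "(\<integral>\<^sup>+\<omega>. \<integral>\<^sup>+\<beta>. of_bool (inj_on \<beta> K \<and> (\<forall>k\<in>K. \<beta> k \<in> index_set (\<tau> \<omega>) \<and> X (\<beta> k) \<omega> \<in> A k))
        \<partial>count_space (PiE K (\<lambda>_. UNIV)) \<partial>M) = (\<Prod>k\<in>K. emeasure \<Lambda> (A k))"
proof -
  \<comment> \<open>The atoms are numbered because independence of the counts is stated for families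
    indexed by natural numbers.\<close>
  obtain h n where h: "bij_betw h {..<n::nat} (Pow K)"
    using ex_bij_betw_nat_finite[of "Pow K"] K by (auto simp: atLeast0LessThan)
  define J where "J = {..<n}"
  have J: "finite J" by (simp add: J_def)
  \<comment> \<open>The atom of the points that lie in exactly those \<open>A k\<close> with
    \<open>k\<close> in \<open>h j\<close>; some atoms may be empty, and the one for the empty
    subset is the common complement.\<close>
  define C where "C = (\<lambda>j. (\<Inter>k\<in>h j. A k) - (\<Union>k\<in>K - h j. A k))"
  have hK: "h j \<subseteq> K" if "j \<in> J" for j using h that by (auto simp: bij_betw_def J_def)
  have Cset: "C j = {x. \<forall>k\<in>K. x \<in> A k \<longleftrightarrow> k \<in> h j}" if "j \<in> J" for j
    using hK[OF that] by (auto simp: C_def)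
  have C: "C j \<in> sets borel" if "j \<in> J" for j
  proof -
    have "(if k \<in> h j then A k else - A k) \<in> sets borel" if "k \<in> K" for k
      using A[OF that] by (auto intro: borel_comp)
    then have "(\<Inter>k\<in>K. if k \<in> h j then A k else - A k) \<in> sets borel"
      using sets.finite_INT[OF K, of "\<lambda>k. if k \<in> h j then A k else - A k" borel] by (cases "K = {}") simp_all
    also have "(\<Inter>k\<in>K. if k \<in> h j then A k else - A k) = C j"
      unfolding Cset[OF that] by (auto split: if_splits)
    finally show ?thesis .
  qed
  have Cdis: "disjoint_family_on C J"
  proof -
    have "h i = h j" if ij: "i \<in> J" "j \<in> J" "x \<in> C i" "x \<in> C j" for i j x
      using hK[OF ij(1)] hK[OF ij(2)] ij(3,4) unfolding Cset[OF ij(1)] Cset[OF ij(2)] by blast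
    moreover have "inj_on h J" using h by (simp add: bij_betw_def J_def)
    ultimately have "i = j" if "i \<in> J" "j \<in> J" "x \<in> C i" "x \<in> C j" for i j x
      using that by (meson inj_onD)
    then show ?thesis unfolding disjoint_family_on_def by blast
  qed
  define Jk where "Jk = (\<lambda>k. {j\<in>J. k \<in> h j})"
  have fJk: "finite (Jk k)" for k using J by (simp add: Jk_def)
  have cover: "\<exists>j\<in>J. x \<in> C j" for x
  proof -
    have "{k\<in>K. x \<in> A k} \<in> h ` J" using h by (auto simp: bij_betw_def J_def)
    then obtain j where j: "j \<in> J" "h j = {k\<in>K. x \<in> A k}" by auto
    then have "x \<in> C j" unfolding Cset[OF j(1)] by auto
    then show ?thesis using j by blast
  qed
  have AC: "A k = (\<Union>j\<in>Jk k. C j)" if k: "k \<in> K" for k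
  proof
    show "(\<Union>j\<in>Jk k. C j) \<subseteq> A k" using k Cset by (auto simp: Jk_def)
    show "A k \<subseteq> (\<Union>j\<in>Jk k. C j)"
    proof
      fix x assume x: "x \<in> A k"
      obtain j where j: "j \<in> J" "x \<in> C j" using cover by blast
      then have "k \<in> h j" using x k Cset by auto
      then show "x \<in> (\<Union>j\<in>Jk k. C j)" using j by (auto simp: Jk_def)
    qed
  qed
  have ofA: "of_bool (x \<in> A k) = (\<Sum>j\<in>Jk k. of_bool (x \<in> C j) :: ennreal)" if k: "k \<in> K" for k x
  proof -
    have "disjoint_family_on C (Jk k)"
      using Cdis by (rule disjoint_family_on_mono[rotated]) (auto simp: Jk_def)
    from indicator_UN_disjoint[OF fJk this, of x] show ?thesis
      unfolding AC[OF k] by (simp add: indicator_def of_bool_def)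
  qed
  have split: "of_bool (inj_on \<beta> K \<and> (\<forall>k\<in>K. \<beta> k \<in> index_set u \<and> x (\<beta> k) \<in> A k))
    = (\<Sum>t\<in>PiE K Jk. of_bool (inj_on \<beta> K \<and> (\<forall>k\<in>K. \<beta> k \<in> index_set u \<and> x (\<beta> k) \<in> C (t k))) :: ennreal)"
    for \<beta> and u and x :: "nat \<Rightarrow> 'a"
  proof -
    have prod_of_bool: "of_bool (\<forall>k\<in>K. Q k) = (\<Prod>k\<in>K. of_bool (Q k) :: ennreal)" for Q
      using K by (induction K rule: finite_induct) auto
    have "of_bool (inj_on \<beta> K \<and> (\<forall>k\<in>K. \<beta> k \<in> index_set u \<and> x (\<beta> k) \<in> A k))
      = of_bool (inj_on \<beta> K \<and> (\<forall>k\<in>K. \<beta> k \<in> index_set u)) * (\<Prod>k\<in>K. of_bool (x (\<beta> k) \<in> A k) :: ennreal)"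
      unfolding prod_of_bool[symmetric] by (auto simp: of_bool_def)
    also have "(\<Prod>k\<in>K. of_bool (x (\<beta> k) \<in> A k) :: ennreal) = (\<Prod>k\<in>K. \<Sum>j\<in>Jk k. of_bool (x (\<beta> k) \<in> C j))"
      by (rule prod.cong) (auto simp: ofA)
    also have "\<dots> = (\<Sum>t\<in>PiE K Jk. \<Prod>k\<in>K. of_bool (x (\<beta> k) \<in> C (t k)))"
      using K fJk by (intro prod_sum_PiE) auto
    also have "of_bool (inj_on \<beta> K \<and> (\<forall>k\<in>K. \<beta> k \<in> index_set u)) * \<dots>
      = (\<Sum>t\<in>PiE K Jk. of_bool (inj_on \<beta> K \<and> (\<forall>k\<in>K. \<beta> k \<in> index_set u \<and> x (\<beta> k) \<in> C (t k))))"
      unfolding prod_of_bool[symmetric] sum_distrib_left by (intro sum.cong) (auto simp: of_bool_def)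
    finally show ?thesis .
  qed
  have meas [measurable]: "(\<lambda>\<omega>. ffact_ennreal (emeasure (\<eta> \<omega>) (C j)) i) \<in> borel_measurable M" if "j \<in> J" for i j
    using measurable_count[OF C[OF that]] by measurable
  have cells: "(\<integral>\<^sup>+\<beta>. of_bool (inj_on \<beta> K \<and> (\<forall>k\<in>K. \<beta> k \<in> index_set (\<tau> \<omega>) \<and> X (\<beta> k) \<omega> \<in> C (t k)))
        \<partial>count_space (PiE K (\<lambda>_. UNIV)))
      = (\<Prod>j\<in>J. ffact_ennreal (emeasure (\<eta> \<omega>) (C j)) (card {k\<in>K. t k = j}))"
    if "t ` K \<subseteq> J" for t \<omega>
    using count_injective_cells[OF K J that C Cdis, of "\<tau> \<omega>" "\<lambda>i. X i \<omega>"] by simp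
  have one: "(\<integral>\<^sup>+\<omega>. \<integral>\<^sup>+\<beta>. of_bool (inj_on \<beta> K \<and> (\<forall>k\<in>K. \<beta> k \<in> index_set (\<tau> \<omega>) \<and> X (\<beta> k) \<omega> \<in> C (t k)))
        \<partial>count_space (PiE K (\<lambda>_. UNIV)) \<partial>M) = (\<Prod>k\<in>K. emeasure \<Lambda> (C (t k)))" if t: "t \<in> PiE K Jk" for t
  proof -
    have tJ: "t ` K \<subseteq> J" using t by (auto simp: Jk_def)
    let ?n = "\<lambda>j. card {k\<in>K. t k = j}"
    have "indep_vars (\<lambda>_. borel) (\<lambda>j \<omega>. ffact_ennreal (emeasure (\<eta> \<omega>) (C j)) (?n j)) J"
      by (rule indep_vars_compose2[OF indep_counts[OF J Cdis C]]) (auto intro: borel_measurable_ffact_ennreal)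
    then have "(\<integral>\<^sup>+\<omega>. (\<Prod>j\<in>J. ffact_ennreal (emeasure (\<eta> \<omega>) (C j)) (?n j)) \<partial>M)
      = (\<Prod>j\<in>J. emeasure \<Lambda> (C j) ^ ?n j)"
      using J C by (subst indep_vars_nn_integral) (auto simp: expectation_ffact_count intro!: prod.cong)
    also have "\<dots> = (\<Prod>j\<in>J. \<Prod>k\<in>{k\<in>K. t k = j}. emeasure \<Lambda> (C (t k)))"
      by (intro prod.cong refl) simp
    also have "\<dots> = (\<Prod>k\<in>K. emeasure \<Lambda> (C (t k)))"
      using K J tJ by (rule prod.group)
    finally show ?thesis
      unfolding cells[OF tJ] .
  qed
  have measc: "(\<lambda>\<omega>. \<integral>\<^sup>+\<beta>. of_bool (inj_on \<beta> K \<and> (\<forall>k\<in>K. \<beta> k \<in> index_set (\<tau> \<omega>) \<and> X (\<beta> k) \<omega> \<in> C (t k)))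
        \<partial>count_space (PiE K (\<lambda>_. UNIV))) \<in> borel_measurable M" if t: "t \<in> PiE K Jk" for t
  proof -
    have tJ: "t ` K \<subseteq> J" using t by (auto simp: Jk_def)
    show ?thesis unfolding cells[OF tJ] by measurable
  qed
  have "(\<integral>\<^sup>+\<omega>. \<integral>\<^sup>+\<beta>. of_bool (inj_on \<beta> K \<and> (\<forall>k\<in>K. \<beta> k \<in> index_set (\<tau> \<omega>) \<and> X (\<beta> k) \<omega> \<in> A k))
        \<partial>count_space (PiE K (\<lambda>_. UNIV)) \<partial>M)
    = (\<integral>\<^sup>+\<omega>. (\<Sum>t\<in>PiE K Jk. \<integral>\<^sup>+\<beta>. of_bool (inj_on \<beta> K \<and>
        (\<forall>k\<in>K. \<beta> k \<in> index_set (\<tau> \<omega>) \<and> X (\<beta> k) \<omega> \<in> C (t k)))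
        \<partial>count_space (PiE K (\<lambda>_. UNIV))) \<partial>M)"
  proof (rule nn_integral_cong)
    fix \<omega>
    show "(\<integral>\<^sup>+\<beta>. of_bool (inj_on \<beta> K \<and> (\<forall>k\<in>K. \<beta> k \<in> index_set (\<tau> \<omega>) \<and> X (\<beta> k) \<omega> \<in> A k))
        \<partial>count_space (PiE K (\<lambda>_. UNIV)))
      = (\<Sum>t\<in>PiE K Jk. \<integral>\<^sup>+\<beta>. of_bool (inj_on \<beta> K \<and>
        (\<forall>k\<in>K. \<beta> k \<in> index_set (\<tau> \<omega>) \<and> X (\<beta> k) \<omega> \<in> C (t k)))
        \<partial>count_space (PiE K (\<lambda>_. UNIV)))"
      by (subst nn_integral_sum[symmetric], simp, rule nn_integral_cong)
        (rule split[of _ "\<tau> \<omega>" "\<lambda>i. X i \<omega>"])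
  qed
  also have "\<dots> = (\<Sum>t\<in>PiE K Jk. \<Prod>k\<in>K. emeasure \<Lambda> (C (t k)))"
    by (subst nn_integral_sum) (use measc one in auto)
  also have "\<dots> = (\<Prod>k\<in>K. \<Sum>j\<in>Jk k. emeasure \<Lambda> (C j))"
    using K fJk by (intro prod_sum_PiE[symmetric]) auto
  also have "\<dots> = (\<Prod>k\<in>K. emeasure \<Lambda> (A k))"
  proof (rule prod.cong[OF refl])
    fix k assume k: "k \<in> K"
    have "disjoint_family_on C (Jk k)"
      using Cdis by (rule disjoint_family_on_mono[rotated]) (auto simp: Jk_def)
    then show "(\<Sum>j\<in>Jk k. emeasure \<Lambda> (C j)) = emeasure \<Lambda> (A k)"
      unfolding AC[OF k] using C sets_Lambda fJk by (intro sum_emeasure) (auto simp: Jk_def)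
  qed
  finally show ?thesis .
qed

text \<open>Both sides integrate \<open>f\<close>, so it is enough to identify two measures: the
  mean measure \<open>Q\<close> of the injective tuples of points and the product measure. They
  agree on rectangles by \<open>expectation_count_rectangle\<close>, and sigma-finiteness makes this
  decisive.\<close>

lemma factorial_moment_formula:
  fixes K :: "'k set"
  assumes K: "finite K" and f: "f \<in> borel_measurable (PiM K (\<lambda>_. borel))"
  shows "(\<integral>\<^sup>+\<omega>. \<integral>\<^sup>+\<beta>. of_bool (inj_on \<beta> K \<and> \<beta> ` K \<subseteq> index_set (\<tau> \<omega>)) * f (\<lambda>k\<in>K. X (\<beta> k) \<omega>)
        \<partial>count_space (PiE K (\<lambda>_. UNIV)) \<partial>M) = (\<integral>\<^sup>+x. f x \<partial>PiM K (\<lambda>_. \<Lambda>))"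
proof -
  interpret P: product_sigma_finite "\<lambda>_::'k. \<Lambda>"
    by (simp add: product_sigma_finite_def sigma_finite_Lambda)
  define BK where "BK = PiE K (\<lambda>_. UNIV :: nat set)"
  have BK: "countable BK" unfolding BK_def using K by (intro countable_PiE) auto
  interpret BK: sigma_finite_measure "count_space BK"
    using BK by (rule sigma_finite_measure_count_space_countable)
  have setsP: "sets (PiM K (\<lambda>_. \<Lambda>)) = sets (PiM K (\<lambda>_. borel))"
    by (rule sets_PiM_cong) (auto simp: sets_Lambda)
  define d where "d = (\<lambda>(\<omega>, \<beta>). of_bool (inj_on \<beta> K \<and> \<beta> ` K \<subseteq> index_set (\<tau> \<omega>)) :: ennreal)"
  define Y where "Y = (\<lambda>(\<omega>, \<beta>). \<lambda>k\<in>K. X (\<beta> k :: nat) \<omega>)"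
  let ?MB = "M \<Otimes>\<^sub>M count_space BK"
  have d [measurable]: "d \<in> borel_measurable ?MB"
    by (rule measurable_pair_count_space[OF BK]) (simp add: d_def,
        rule measurable_compose[OF tau, of "\<lambda>t. of_bool (inj_on _ K \<and> _ ` K \<subseteq> index_set t)" borel], simp)
  have Y: "Y \<in> measurable ?MB (PiM K (\<lambda>_. borel))"
    by (rule measurable_pair_count_space[OF BK]) (simp add: Y_def, measurable)
  then have Y' [measurable]: "Y \<in> measurable ?MB (PiM K (\<lambda>_. \<Lambda>))"
    by (simp cong: measurable_cong_sets add: setsP)
  have f' [measurable]: "f \<in> borel_measurable (PiM K (\<lambda>_. \<Lambda>))"
    using f by (simp cong: measurable_cong_sets add: setsP)
  \<comment> \<open>The density \<open>d\<close> discards tuples of indices that repeat or exceed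
    \<tau>, and \<open>Y\<close> reads off the locations.\<close>
  define Q where "Q = distr (density ?MB d) (PiM K (\<lambda>_. \<Lambda>)) Y"
  have int: "(\<integral>\<^sup>+x. g x \<partial>Q) = (\<integral>\<^sup>+\<omega>. \<integral>\<^sup>+\<beta>. d (\<omega>, \<beta>) * g (Y (\<omega>, \<beta>)) \<partial>count_space BK \<partial>M)"
    if [measurable]: "g \<in> borel_measurable (PiM K (\<lambda>_. \<Lambda>))" for g
  proof -
    have "(\<integral>\<^sup>+x. g x \<partial>Q) = (\<integral>\<^sup>+p. d p * g (Y p) \<partial>?MB)"
      unfolding Q_def by (subst nn_integral_distr) (auto simp: nn_integral_density)
    also have "\<dots> = (\<integral>\<^sup>+\<omega>. \<integral>\<^sup>+\<beta>. d (\<omega>, \<beta>) * g (Y (\<omega>, \<beta>)) \<partial>count_space BK \<partial>M)"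
      by (subst BK.nn_integral_fst[symmetric]) auto
    finally show ?thesis .
  qed
  have "Q = PiM K (\<lambda>_. \<Lambda>)"
  proof (rule P.PiM_eqI[OF K])
    show "sets Q = sets (PiM K (\<lambda>_. \<Lambda>))" by (simp add: Q_def)
    fix A assume A: "\<And>k. k \<in> K \<Longrightarrow> A k \<in> sets \<Lambda>"
    have PA: "PiE K A \<in> sets (PiM K (\<lambda>_. \<Lambda>))" using K A by (intro sets_PiM_I_finite) auto
    have "emeasure Q (PiE K A) = (\<integral>\<^sup>+x. indicator (PiE K A) x \<partial>Q)"
      using PA by (simp add: Q_def)
    also have "\<dots> = (\<integral>\<^sup>+\<omega>. \<integral>\<^sup>+\<beta>. d (\<omega>, \<beta>) * indicator (PiE K A) (Y (\<omega>, \<beta>)) \<partial>count_space BK \<partial>M)"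
      using PA by (intro int) simp
    also have "\<dots> = (\<integral>\<^sup>+\<omega>. \<integral>\<^sup>+\<beta>. of_bool (inj_on \<beta> K \<and> (\<forall>k\<in>K. \<beta> k \<in> index_set (\<tau> \<omega>) \<and> X (\<beta> k) \<omega> \<in> A k))
        \<partial>count_space BK \<partial>M)"
      by (intro nn_integral_cong) (auto simp: d_def Y_def indicator_def PiE_iff)
    also have "\<dots> = (\<Prod>k\<in>K. emeasure \<Lambda> (A k))"
      unfolding BK_def using A sets_Lambda by (intro expectation_count_rectangle[OF K]) auto
    finally show "emeasure Q (PiE K A) = (\<Prod>k\<in>K. emeasure \<Lambda> (A k))" .
  qed
  then show ?thesis using int[OF f'] by (simp add: d_def Y_def BK_def)
qed

end

section \<open>Expected number of embeddings into the random graph\<close>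

text \<open>Edges are unordered while the connection function takes two arguments, so an orientation
  is chosen; for symmetric \<psi> the choice does not affect the value.\<close>

definition edge_weight :: "('a \<Rightarrow> 'a \<Rightarrow> real) \<Rightarrow> ('v \<Rightarrow> 'a) \<Rightarrow> 'v set \<Rightarrow> real" where
  "edge_weight \<psi> z e = (let p = SOME p. e = {fst p, snd p} in \<psi> (z (fst p)) (z (snd p)))"

lemma edge_weight_doubleton:
  assumes "\<And>x z. \<psi> x z = \<psi> z x"
  shows "edge_weight \<psi> z {u, v} = \<psi> (z u) (z v)"
proof -
  define p where "p = (SOME p. {u, v} = {fst p, snd p})"
  have "{u, v} = {fst p, snd p}" unfolding p_def by (rule someI[of _ "(u, v)"]) simp
  then have "(fst p = u \<and> snd p = v) \<or> (fst p = v \<and> snd p = u)" by (auto simp: doubleton_eq_iff)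
  then show ?thesis
    using assms by (auto simp: edge_weight_def p_def[symmetric] Let_def)
qed

definition edges_over :: "'v set \<Rightarrow> 'v set set" where
  "edges_over W = {{u, v} | u v. u \<in> W \<and> v \<in> W \<and> u \<noteq> v}"

lemma edge_weight_image:
  assumes "\<And>x z. \<psi> x z = \<psi> z x" "e \<in> edges_over W"
  shows "edge_weight \<psi> z (f ` e) = edge_weight \<psi> (z \<circ> f) e"
  using assms by (auto simp: edges_over_def edge_weight_doubleton)

lemma edge_weight_cong:
  assumes "\<And>x z. \<psi> x z = \<psi> z x" "e \<in> edges_over W" "\<And>v. v \<in> W \<Longrightarrow> z v = z' v"
  shows "edge_weight \<psi> z e = edge_weight \<psi> z' e"
  using assms by (auto simp: edges_over_def edge_weight_doubleton)

lemma edge_weight_range: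
  assumes "\<And>x z. 0 \<le> \<psi> x z \<and> \<psi> x z \<le> 1"
  shows "0 \<le> edge_weight \<psi> z e" "edge_weight \<psi> z e \<le> 1"
  using assms by (auto simp: edge_weight_def Let_def)

definition vertex_label :: "('k \<Rightarrow> nat) \<Rightarrow> 'k + nat \<Rightarrow> vertex" where
  "vertex_label \<beta> = case_sum (\<lambda>k. Pt (\<beta> k)) Fixed"

lemma vertex_label_simps [simp]:
  "vertex_label \<beta> (Inl k) = Pt (\<beta> k)" "vertex_label \<beta> (Inr j) = Fixed j"
  by (simp_all add: vertex_label_def)

text \<open>Vertices of an abstract graph before labelling: \<open>Inl\<close> marks those to be
  mapped to points of the process, \<open>Inr j\<close> the endpoint fixed at
  \<open>y j\<close>.\<close>

definition abstract_vertices :: "'k set \<Rightarrow> nat \<Rightarrow> ('k + nat) set" where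
  "abstract_vertices K m = Inl ` K \<union> Inr ` {1..m}"

locale connection_function =
  fixes \<psi> :: "'a::topological_space \<Rightarrow> 'a \<Rightarrow> real"
  assumes psi_sym: "\<psi> x z = \<psi> z x"
    and psi_range: "0 \<le> \<psi> x z \<and> \<psi> x z \<le> 1"
    and psi_meas: "(\<lambda>(x, z). \<psi> x z) \<in> borel_measurable (borel \<Otimes>\<^sub>M borel)"
begin

lemma borel_measurable_edge_weight:
  assumes e: "e \<in> edges_over W" and z: "\<And>v. v \<in> W \<Longrightarrow> (\<lambda>x. z x v) \<in> borel_measurable N"
  shows "(\<lambda>x. edge_weight \<psi> (z x) e) \<in> borel_measurable N"
proof -
  obtain u v where uv: "e = {u, v}" "u \<in> W" "v \<in> W" using e by (auto simp: edges_over_def)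
  have "(\<lambda>x. (z x u, z x v)) \<in> measurable N (borel \<Otimes>\<^sub>M borel)"
    using z[OF uv(2)] z[OF uv(3)] by measurable
  from measurable_compose[OF this psi_meas] show ?thesis
    unfolding uv(1) by (simp add: edge_weight_doubleton[OF psi_sym])
qed

lemma borel_measurable_edge_weight_PiM:
  assumes "e \<in> edges_over (abstract_vertices K m)" "\<And>k. k \<in> K \<Longrightarrow> sets (N k) = sets borel"
  shows "(\<lambda>x. edge_weight \<psi> (case_sum x y) e) \<in> borel_measurable (PiM K N)"
proof (rule borel_measurable_edge_weight[OF assms(1)])
  fix v assume v: "v \<in> abstract_vertices K m"
  show "(\<lambda>x. case_sum x y v) \<in> borel_measurable (PiM K N)"
  proof (cases v)
    case (Inl k)
    then have k: "k \<in> K" using v by (auto simp: abstract_vertices_def)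
    have "(\<lambda>x. x k) \<in> measurable (PiM K N) (N k)" using k by (rule measurable_component_singleton)
    then show ?thesis using assms(2)[OF k] Inl by (simp cong: measurable_cong_sets)
  qed simp
qed

end

locale random_connection = prob_space M + connection_function \<psi>
  for M :: "'w measure" and \<psi> :: "'a::topological_space \<Rightarrow> 'a \<Rightarrow> real" +
  fixes \<tau> :: "'w \<Rightarrow> enat" and X :: "nat \<Rightarrow> 'w \<Rightarrow> 'a" and \<Gamma> :: "'w \<Rightarrow> vertex set set"
    and m :: nat and y :: "nat \<Rightarrow> 'a" and \<Lambda> :: "'a measure"
  assumes model: "random_connection_model M \<tau> X \<Gamma> m y \<Lambda> \<psi>"
    and sets_L: "sets \<Lambda> = sets borel" and sigma_finite_L: "sigma_finite_measure \<Lambda>"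

sublocale random_connection \<subseteq> poisson_points M \<tau> X \<Lambda>
  using model sets_L sigma_finite_L
  unfolding poisson_points_def poisson_points_axioms_def random_connection_model_def by auto

section \<open>Edges given the points\<close>

context random_connection
begin

lemma sets_edge: "{\<omega> \<in> space M. {u, v} \<in> \<Gamma> \<omega>} \<in> sets M"
  using model unfolding random_connection_model_def by blast

lemma measurable_tau_pred [measurable]:
  "(\<lambda>\<omega>. of_bool (Q (\<tau> \<omega>)) :: 'b::{zero_neq_one,topological_space}) \<in> borel_measurable M"
  by (rule measurable_compose[OF tau]) simp

lemma sets_tau_pred: "{\<omega> \<in> space M. Q (\<tau> \<omega>)} \<in> sets M"
  by measurable

lemma sets_all_edges:
  assumes "finite F" "F \<subseteq> edges_over W"
  shows "{\<omega> \<in> space M. \<forall>e\<in>F. f ` e \<in> \<Gamma> \<omega>} \<in> sets M"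
proof (rule sets.sets_Collect_finite_All[OF _ assms(1)])
  fix e assume "e \<in> F"
  then obtain u v where "e = {u, v}" using assms by (auto simp: edges_over_def)
  then show "{\<omega> \<in> space M. f ` e \<in> \<Gamma> \<omega>} \<in> sets M" using sets_edge[of "f u" "f v"] by simp
qed

lemma subalgebra_vertex_algebra: "subalgebra M (vertex_algebra M \<tau> X)"
  unfolding subalgebra_def
proof
  show "space (vertex_algebra M \<tau> X) = space M" by (simp add: vertex_algebra_def)
  have "(\<lambda>\<omega>. (\<tau> \<omega>, \<lambda>i. X i \<omega>)) \<in> measurable M (count_space UNIV \<Otimes>\<^sub>M Pi\<^sub>M UNIV (\<lambda>_. borel))"
    by (intro measurable_Pair measurable_PiM_single') (auto intro: tau)
  then show "sets (vertex_algebra M \<tau> X) \<subseteq> sets M"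
    unfolding vertex_algebra_def by (intro sets_image_in_sets) auto
qed

lemma tau_vertex_algebra: "\<tau> \<in> measurable (vertex_algebra M \<tau> X) (count_space UNIV)"
proof -
  have "(\<lambda>\<omega>. (\<tau> \<omega>, \<lambda>i. X i \<omega>)) \<in> measurable (vertex_algebra M \<tau> X) (count_space UNIV \<Otimes>\<^sub>M Pi\<^sub>M UNIV (\<lambda>_. borel))"
    unfolding vertex_algebra_def by (rule measurable_vimage_algebra1) (auto simp: space_pair_measure space_PiM)
  from measurable_compose[OF this measurable_fst] show ?thesis by simp
qed

text \<open>Given the vertices, the edges are independent, so the conditional probability that all
  edges in \<open>F\<close> are present is the product of their weights. The labelling must be
  injective for distinct abstract edges to become distinct pairs.\<close>

lemma expectation_embedding:
  fixes K :: "'k set"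
  assumes K: "inj_on \<beta> K" and F: "finite F" "F \<subseteq> edges_over (abstract_vertices K m)"
  shows "(\<integral>\<^sup>+\<omega>. of_bool (\<beta> ` K \<subseteq> index_set (\<tau> \<omega>) \<and> (\<forall>e\<in>F. vertex_label \<beta> ` e \<in> \<Gamma> \<omega>)) \<partial>M)
    = (\<integral>\<^sup>+\<omega>. of_bool (\<beta> ` K \<subseteq> index_set (\<tau> \<omega>)) *
        (\<Prod>e\<in>F. ennreal (edge_weight \<psi> (case_sum (\<lambda>k. X (\<beta> k) \<omega>) y) e)) \<partial>M)"
proof -
  let ?W = "abstract_vertices K m"
  let ?A = "vertex_algebra M \<tau> X"
  interpret sub: finite_measure_subalgebra M ?A
    by unfold_locales (rule subalgebra_vertex_algebra)
  have injl: "inj_on (vertex_label \<beta>) ?W"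
    by (rule inj_onI) (auto simp: abstract_vertices_def dest: inj_onD[OF K])
  \<comment> \<open>The model lists edges as ordered pairs, so \<open>F\<close> gets an orientation.
    It is the choice made in \<open>edge_weight\<close>, which lets the two products be matched by
    unfolding.\<close>
  define ori :: "('k + nat) set \<Rightarrow> ('k + nat) \<times> ('k + nat)" where "ori = (\<lambda>e. SOME p. e = {fst p, snd p})"
  have ori: "e = {fst (ori e), snd (ori e)}" if e: "e \<in> F" for e
  proof -
    obtain u v where "e = {fst (u, v), snd (u, v)}" using F e by (auto simp: edges_over_def)
    then show ?thesis unfolding ori_def by (rule someI)
  qed
  have neq: "fst (ori e) \<noteq> snd (ori e)" and inW: "fst (ori e) \<in> ?W" "snd (ori e) \<in> ?W" if e: "e \<in> F" for e
  proof -
    obtain u v where uv: "e = {u, v}" "u \<in> ?W" "v \<in> ?W" "u \<noteq> v" using F e by (auto simp: edges_over_def)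
    then show "fst (ori e) \<noteq> snd (ori e)" "fst (ori e) \<in> ?W" "snd (ori e) \<in> ?W"
      using ori[OF e] by (auto simp: doubleton_eq_iff)
  qed
  have eW: "e \<subseteq> ?W" if "e \<in> F" for e using F that by (auto simp: edges_over_def)
  define d where "d = (\<lambda>e. (vertex_label \<beta> (fst (ori e)), vertex_label \<beta> (snd (ori e))))"
  have dl: "(case d e of (u, v) \<Rightarrow> {u, v}) = vertex_label \<beta> ` e" if "e \<in> F" for e
    using ori[OF that] unfolding d_def by (metis case_prod_conv image_empty image_insert)
  have injF: "inj_on (\<lambda>e. vertex_label \<beta> ` e) F"
    using inj_on_image_eq_iff[OF injl] eW by (auto simp: inj_on_def)
  define D where "D = d ` F"
  have injd: "inj_on d F"
    using injF dl by (metis (no_types, lifting) inj_onD inj_onI)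
  have injD: "inj_on (\<lambda>(u, v). {u, v}) D"
  proof (rule inj_onI)
    fix p q assume "p \<in> D" "q \<in> D" and eq: "(case p of (u, v) \<Rightarrow> {u, v}) = (case q of (u, v) \<Rightarrow> {u, v})"
    then obtain e f where ef: "e \<in> F" "f \<in> F" "p = d e" "q = d f" by (auto simp: D_def)
    then have "vertex_label \<beta> ` e = vertex_label \<beta> ` f" using eq dl by simp
    then show "p = q" using inj_onD[OF injF, of e f] ef by blast
  qed
  have finD: "finite D" using F by (simp add: D_def)
  have neqD: "\<forall>(u, v)\<in>D. u \<noteq> v"
    using neq inW inj_onD[OF injl] by (fastforce simp: D_def d_def)
  \<comment> \<open>The event that all pairs in \<open>D\<close> are connected, written as the
    instance S = D of the joint law of the edges.\<close>
  define Ev where "Ev = {\<omega> \<in> space M. {(u, v) \<in> D. {u, v} \<in> \<Gamma> \<omega>} = D}"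
  have Ev: "\<omega> \<in> Ev \<longleftrightarrow> \<omega> \<in> space M \<and> (\<forall>e\<in>F. vertex_label \<beta> ` e \<in> \<Gamma> \<omega>)" for \<omega>
  proof -
    have "{(u, v) \<in> D. {u, v} \<in> \<Gamma> \<omega>} = D \<longleftrightarrow> (\<forall>p\<in>D. (case p of (u, v) \<Rightarrow> {u, v}) \<in> \<Gamma> \<omega>)" by auto
    also have "\<dots> \<longleftrightarrow> (\<forall>e\<in>F. vertex_label \<beta> ` e \<in> \<Gamma> \<omega>)" using dl by (simp add: D_def)
    finally show ?thesis by (auto simp: Ev_def)
  qed
  have EvM [measurable]: "Ev \<in> sets M"
  proof -
    have "Ev = {\<omega> \<in> space M. \<forall>e\<in>F. vertex_label \<beta> ` e \<in> \<Gamma> \<omega>}" using Ev by auto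
    then show ?thesis using sets_all_edges[OF F] by simp
  qed
  \<comment> \<open>This indicator vanishes wherever the model leaves the conditional probability
    unspecified, and it is measurable for the conditioning sigma-algebra, so it can be moved through
    the conditional expectation.\<close>
  define g where "g = (\<lambda>\<omega>. of_bool (\<beta> ` K \<subseteq> index_set (\<tau> \<omega>)) :: real)"
  have gA: "g \<in> borel_measurable ?A"
    unfolding g_def by (rule measurable_compose[OF tau_vertex_algebra]) simp
  have gM [measurable]: "g \<in> borel_measurable M" unfolding g_def by measurable
  define h where "h = (\<lambda>\<omega>. \<Prod>e\<in>F. edge_weight \<psi> (case_sum (\<lambda>k. X (\<beta> k) \<omega>) y) e)"
  have hM [measurable]: "h \<in> borel_measurable M"
    unfolding h_def
  proof (intro borel_measurable_prod borel_measurable_edge_weight[of _ ?W])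
    fix v assume "v \<in> ?W"
    show "(\<lambda>\<omega>. case_sum (\<lambda>k. X (\<beta> k) \<omega>) y v) \<in> borel_measurable M" by (cases v) simp_all
  qed (use F in auto)
  have h0: "0 \<le> h \<omega>" "h \<omega> \<le> 1" for \<omega>
    unfolding h_def using edge_weight_range[OF psi_range] by (auto intro!: prod_nonneg prod_le_1)
  have "AE \<omega> in M. (\<forall>(u, v)\<in>D. {u, v} \<subseteq> rcm_vertices (\<tau> \<omega>) m) \<longrightarrow>
      real_cond_exp M ?A (indicator Ev) \<omega> = (\<Prod>(u, v)\<in>D.
        let p = \<psi> (location (\<lambda>i. X i \<omega>) y u) (location (\<lambda>i. X i \<omega>) y v) in if (u, v) \<in> D then p else 1 - p)"
    using model finD neqD injD unfolding random_connection_model_def Ev_def by blast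
  then have AE: "AE \<omega> in M. g \<omega> * real_cond_exp M ?A (indicator Ev) \<omega> = g \<omega> * h \<omega>"
  proof eventually_elim
    fix \<omega>
    assume *: "(\<forall>(u, v)\<in>D. {u, v} \<subseteq> rcm_vertices (\<tau> \<omega>) m) \<longrightarrow>
      real_cond_exp M ?A (indicator Ev) \<omega> = (\<Prod>(u, v)\<in>D.
        let p = \<psi> (location (\<lambda>i. X i \<omega>) y u) (location (\<lambda>i. X i \<omega>) y v) in if (u, v) \<in> D then p else 1 - p)"
    show "g \<omega> * real_cond_exp M ?A (indicator Ev) \<omega> = g \<omega> * h \<omega>"
    proof (cases "\<beta> ` K \<subseteq> index_set (\<tau> \<omega>)")
      case True
      have lW: "vertex_label \<beta> v \<in> rcm_vertices (\<tau> \<omega>) m" if "v \<in> ?W" for v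
        using that True by (auto simp: abstract_vertices_def rcm_vertices_def)
      have inR: "\<forall>(u, v)\<in>D. {u, v} \<subseteq> rcm_vertices (\<tau> \<omega>) m"
        using lW inW by (auto simp: D_def d_def)
      have loc: "location (\<lambda>i. X i \<omega>) y (vertex_label \<beta> v) = case_sum (\<lambda>k. X (\<beta> k) \<omega>) y v" for v
        by (cases v) simp_all
      have "(\<Prod>(u, v)\<in>D. let p = \<psi> (location (\<lambda>i. X i \<omega>) y u) (location (\<lambda>i. X i \<omega>) y v)
          in if (u, v) \<in> D then p else 1 - p)
        = (\<Prod>(u, v)\<in>D. \<psi> (location (\<lambda>i. X i \<omega>) y u) (location (\<lambda>i. X i \<omega>) y v))"
        by (rule prod.cong) (auto simp: Let_def)
      also have "\<dots> = h \<omega>"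
        unfolding D_def h_def prod.reindex[OF injd]
        by (rule prod.cong) (simp_all add: d_def loc edge_weight_def ori_def Let_def)
      finally show ?thesis using * inR by simp
    qed (simp add: g_def)
  qed
  have int: "integrable M (\<lambda>\<omega>. g \<omega> * indicator Ev \<omega>)"
    by (rule integrable_const_bound[of _ 1]) (auto simp: g_def indicator_def)
  have "(\<integral>\<omega>. g \<omega> * indicator Ev \<omega> \<partial>M) = (\<integral>\<omega>. g \<omega> * real_cond_exp M ?A (indicator Ev) \<omega> \<partial>M)"
    using sub.real_cond_exp_intg(2)[OF int gA] by simp
  also have "\<dots> = (\<integral>\<omega>. g \<omega> * h \<omega> \<partial>M)"
    by (rule integral_cong_AE) (use AE in auto)
  finally have eq: "(\<integral>\<omega>. g \<omega> * indicator Ev \<omega> \<partial>M) = (\<integral>\<omega>. g \<omega> * h \<omega> \<partial>M)" .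
  have int2: "integrable M (\<lambda>\<omega>. g \<omega> * h \<omega>)"
    by (rule integrable_const_bound[of _ 1]) (auto simp: g_def h0)
  have "(\<integral>\<^sup>+\<omega>. of_bool (\<beta> ` K \<subseteq> index_set (\<tau> \<omega>) \<and> (\<forall>e\<in>F. vertex_label \<beta> ` e \<in> \<Gamma> \<omega>)) \<partial>M)
    = (\<integral>\<^sup>+\<omega>. ennreal (g \<omega> * indicator Ev \<omega>) \<partial>M)"
    by (intro nn_integral_cong) (auto simp: g_def indicator_def Ev)
  also have "\<dots> = (\<integral>\<^sup>+\<omega>. ennreal (g \<omega> * h \<omega>) \<partial>M)"
    using int int2 eq by (simp add: nn_integral_eq_integral g_def h0)
  also have "\<dots> = (\<integral>\<^sup>+\<omega>. of_bool (\<beta> ` K \<subseteq> index_set (\<tau> \<omega>)) *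
        (\<Prod>e\<in>F. ennreal (edge_weight \<psi> (case_sum (\<lambda>k. X (\<beta> k) \<omega>) y) e)) \<partial>M)"
    by (intro nn_integral_cong)
      (auto simp: g_def h_def prod_ennreal edge_weight_range[OF psi_range])
  finally show ?thesis .
qed

lemma borel_measurable_embedding:
  assumes "finite F" "F \<subseteq> edges_over W"
  shows "(\<lambda>\<omega>. of_bool (inj_on \<beta> K \<and> \<beta> ` K \<subseteq> index_set (\<tau> \<omega>) \<and> (\<forall>e\<in>F. f ` e \<in> \<Gamma> \<omega>)) :: ennreal)
    \<in> borel_measurable M"
proof -
  have "{\<omega> \<in> space M. inj_on \<beta> K \<and> \<beta> ` K \<subseteq> index_set (\<tau> \<omega>) \<and> (\<forall>e\<in>F. f ` e \<in> \<Gamma> \<omega>)} \<in> sets M"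
    by (intro sets.sets_Collect_conj sets_tau_pred sets_all_edges[OF assms] sets.sets_Collect_const)
  then show ?thesis
    by (rule borel_measurable_indicator[THEN measurable_cong[THEN iffD1, rotated]])
      (auto simp: indicator_def)
qed

lemma borel_measurable_embeddings:
  fixes K :: "'k set"
  assumes K: "finite K" and F: "finite F" "F \<subseteq> edges_over W"
  shows "(\<lambda>\<omega>. \<integral>\<^sup>+\<beta>. of_bool (inj_on \<beta> K \<and> \<beta> ` K \<subseteq> index_set (\<tau> \<omega>) \<and> (\<forall>e\<in>F. vertex_label \<beta> ` e \<in> \<Gamma> \<omega>))
        \<partial>count_space (PiE K (\<lambda>_. UNIV))) \<in> borel_measurable M"
proof -
  have BK: "countable (PiE K (\<lambda>_. UNIV :: nat set))" using K by (intro countable_PiE) auto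
  interpret B: sigma_finite_measure "count_space (PiE K (\<lambda>_. UNIV :: nat set))"
    using BK by (rule sigma_finite_measure_count_space_countable)
  have "(\<lambda>(\<omega>, \<beta>). of_bool (inj_on \<beta> K \<and> \<beta> ` K \<subseteq> index_set (\<tau> \<omega>) \<and> (\<forall>e\<in>F. vertex_label \<beta> ` e \<in> \<Gamma> \<omega>)) :: ennreal)
    \<in> borel_measurable (M \<Otimes>\<^sub>M count_space (PiE K (\<lambda>_. UNIV)))"
    using borel_measurable_embedding[OF F] by (intro measurable_pair_count_space[OF BK]) simp
  from B.borel_measurable_nn_integral[OF this] show ?thesis .
qed

text \<open>There are countably many labellings, so expectation and sum over \<beta> can be
  exchanged; each labelling is handled by conditioning on the vertices, and after exchanging back
  the factorial moment formula turns the sum over injective tuples of points into an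
  integral.\<close>

lemma expectation_embeddings:
  fixes K :: "'k set"
  assumes K: "finite K" and F: "finite F" "F \<subseteq> edges_over (abstract_vertices K m)"
  shows "(\<integral>\<^sup>+\<omega>. \<integral>\<^sup>+\<beta>. of_bool (inj_on \<beta> K \<and> \<beta> ` K \<subseteq> index_set (\<tau> \<omega>) \<and> (\<forall>e\<in>F. vertex_label \<beta> ` e \<in> \<Gamma> \<omega>))
        \<partial>count_space (PiE K (\<lambda>_. UNIV)) \<partial>M)
    = (\<integral>\<^sup>+x. (\<Prod>e\<in>F. ennreal (edge_weight \<psi> (case_sum x y) e)) \<partial>PiM K (\<lambda>_. \<Lambda>))"
proof -
  have BK: "countable (PiE K (\<lambda>_. UNIV :: nat set))" using K by (intro countable_PiE) auto
  let ?f = "\<lambda>x. \<Prod>e\<in>F. ennreal (edge_weight \<psi> (case_sum x y) e)"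
  have f: "?f \<in> borel_measurable (PiM K (\<lambda>_. borel))"
    by (intro borel_measurable_prod_ennreal measurable_compose[OF _ measurable_ennreal]
        borel_measurable_edge_weight_PiM) (use F in auto)
  \<comment> \<open>The weights depend on the coordinates in \<open>K\<close> only, so restricting
    the tuple to \<open>K\<close>, as the factorial moment formula requires, changes
    nothing.\<close>
  have fr: "?f (\<lambda>k\<in>K. X (\<beta> k) \<omega>) = ?f (\<lambda>k. X (\<beta> k) \<omega>)" for \<beta> \<omega>
  proof (intro prod.cong refl arg_cong[where f=ennreal])
    fix e assume "e \<in> F"
    then show "edge_weight \<psi> (case_sum (\<lambda>k\<in>K. X (\<beta> k) \<omega>) y) e = edge_weight \<psi> (case_sum (\<lambda>k. X (\<beta> k) \<omega>) y) e"
      using F by (intro edge_weight_cong[OF psi_sym, of _ "abstract_vertices K m"])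
        (auto simp: abstract_vertices_def)
  qed
  have m2: "(\<lambda>\<omega>. of_bool (inj_on \<beta> K \<and> \<beta> ` K \<subseteq> index_set (\<tau> \<omega>)) * ?f (\<lambda>k\<in>K. X (\<beta> k) \<omega>)) \<in> borel_measurable M" for \<beta>
    by (intro borel_measurable_times_ennreal measurable_tau_pred measurable_compose[OF _ f]) measurable
  have "(\<integral>\<^sup>+\<omega>. \<integral>\<^sup>+\<beta>. of_bool (inj_on \<beta> K \<and> \<beta> ` K \<subseteq> index_set (\<tau> \<omega>) \<and> (\<forall>e\<in>F. vertex_label \<beta> ` e \<in> \<Gamma> \<omega>))
        \<partial>count_space (PiE K (\<lambda>_. UNIV)) \<partial>M)
    = (\<integral>\<^sup>+\<beta>. \<integral>\<^sup>+\<omega>. of_bool (inj_on \<beta> K \<and> \<beta> ` K \<subseteq> index_set (\<tau> \<omega>) \<and> (\<forall>e\<in>F. vertex_label \<beta> ` e \<in> \<Gamma> \<omega>))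
        \<partial>M \<partial>count_space (PiE K (\<lambda>_. UNIV)))"
    using BK borel_measurable_embedding[OF F] by (rule nn_integral_count_space_nn_integral)
  also have "\<dots> = (\<integral>\<^sup>+\<beta>. \<integral>\<^sup>+\<omega>. of_bool (inj_on \<beta> K \<and> \<beta> ` K \<subseteq> index_set (\<tau> \<omega>)) * ?f (\<lambda>k\<in>K. X (\<beta> k) \<omega>)
        \<partial>M \<partial>count_space (PiE K (\<lambda>_. UNIV)))"
  proof (rule nn_integral_cong)
    fix \<beta> :: "'k \<Rightarrow> nat"
    show "(\<integral>\<^sup>+\<omega>. of_bool (inj_on \<beta> K \<and> \<beta> ` K \<subseteq> index_set (\<tau> \<omega>) \<and> (\<forall>e\<in>F. vertex_label \<beta> ` e \<in> \<Gamma> \<omega>)) \<partial>M)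
      = (\<integral>\<^sup>+\<omega>. of_bool (inj_on \<beta> K \<and> \<beta> ` K \<subseteq> index_set (\<tau> \<omega>)) * ?f (\<lambda>k\<in>K. X (\<beta> k) \<omega>) \<partial>M)"
      unfolding fr using expectation_embedding[OF _ F, of \<beta>] by (cases "inj_on \<beta> K") simp_all
  qed
  also have "\<dots> = (\<integral>\<^sup>+\<omega>. \<integral>\<^sup>+\<beta>. of_bool (inj_on \<beta> K \<and> \<beta> ` K \<subseteq> index_set (\<tau> \<omega>)) * ?f (\<lambda>k\<in>K. X (\<beta> k) \<omega>)
        \<partial>count_space (PiE K (\<lambda>_. UNIV)) \<partial>M)"
    using BK m2 by (rule nn_integral_count_space_nn_integral[symmetric])
  also have "\<dots> = (\<integral>\<^sup>+x. ?f x \<partial>PiM K (\<lambda>_. \<Lambda>))"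
    by (rule factorial_moment_formula[OF K f])
  finally show ?thesis .
qed

end

section \<open>Graphs with endpoints and moments of subgraph counts\<close>

definition row_label :: "nat \<Rightarrow> (nat \<Rightarrow> nat) \<Rightarrow> nat \<Rightarrow> vertex" where
  "row_label r \<alpha> v = (if v \<le> r then Pt (\<alpha> v) else Fixed (v - r))"

text \<open>Where vertex \<open>v\<close> of copy \<open>k\<close> sits in the glued graph: inner
  vertices go to their block, while the endpoints are common to all copies whatever \<rho>
  is.\<close>

definition vertex_map :: "nat \<Rightarrow> (nat \<times> nat) set set \<Rightarrow> nat \<Rightarrow> nat \<Rightarrow> (nat \<times> nat) set + nat" where
  "vertex_map r \<rho> k v = (if v \<le> r then Inl (block \<rho> (k, v)) else Inr (v - r))"

text \<open>Gluing one copy of the graph for each row in \<open>R\<close> along the blocks of \<open>\<rho>\<close>.\<close>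

definition glued_edges :: "nat \<Rightarrow> nat set set \<Rightarrow> nat set \<Rightarrow> (nat \<times> nat) set set \<Rightarrow> ((nat \<times> nat) set + nat) set set" where
  "glued_edges r E R \<rho> = (\<Union>k\<in>R. (\<lambda>e. vertex_map r \<rho> k ` e) ` E)"

locale endpoint_graph =
  fixes r m :: nat and E :: "nat set set"
  assumes r: "2 \<le> r"
    and connected: "connected_graph {1..r+m} E"
    and inner_connected: "connected_graph {1..r} (induced_edges E {1..r})"
    and endpoints: "\<forall>i\<in>{r+1..r+m}. \<forall>j\<in>{r+1..r+m}. {i, j} \<notin> E"
begin

lemma E_edges_over: "E \<subseteq> edges_over {1..r+m}"
  using connected by (auto simp: connected_graph_def simple_graph_def edges_over_def)

lemma finite_E: "finite E"
proof (rule finite_subset)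
  show "E \<subseteq> Pow {1..r+m}" using E_edges_over by (auto simp: edges_over_def)
qed simp

lemma edge_cases:
  assumes "e \<in> E"
  obtains (inner) i j where "e = {i, j}" "i \<in> {1..r}" "j \<in> {1..r}" "i \<noteq> j"
  | (outer) i j where "e = {r + j, i}" "i \<in> {1..r}" "j \<in> {1..m}"
proof -
  obtain u v where uv: "e = {u, v}" "u \<in> {1..r+m}" "v \<in> {1..r+m}" "u \<noteq> v"
    using E_edges_over assms by (auto simp: edges_over_def)
  have *: "\<not> (u > r \<and> v > r)"
  proof
    assume "u > r \<and> v > r"
    then have "u \<in> {r+1..r+m}" "v \<in> {r+1..r+m}" using uv by auto
    then show False using endpoints assms uv(1) by blast
  qed
  consider "u \<le> r" "v \<le> r" | "u > r" "v \<le> r" | "v > r" "u \<le> r" using * by linarith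
  then show thesis
  proof cases
    case 1
    then show ?thesis using uv inner[of u v] by auto
  next
    case 2
    then have "u - r \<in> {1..m}" "v \<in> {1..r}" "e = {r + (u - r), v}" using uv by auto
    then show ?thesis using outer by blast
  next
    case 3
    then have "v - r \<in> {1..m}" "u \<in> {1..r}" "e = {r + (v - r), u}" using uv by auto
    then show ?thesis using outer by blast
  qed
qed

lemma prod_of_bool: "finite A \<Longrightarrow> (\<Prod>x\<in>A. of_bool (Q x)) = (of_bool (\<forall>x\<in>A. Q x) :: 'b::comm_semiring_1)"
  by (induction A rule: finite_induct) auto

text \<open>As endpoints are pairwise non-adjacent, every edge is either inner or joins an endpoint
  to an inner vertex, so the two products of the definition together run over all of
  \<open>E\<close>.\<close>

lemma copy_indicator_eq:
  "copy_indicator r m E \<gamma> \<alpha> = of_bool (\<forall>e\<in>E. row_label r \<alpha> ` e \<in> \<gamma>)"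
proof -
  let ?O = "{(i, j). i \<in> {1..r} \<and> j \<in> {1..m} \<and> {r + j, i} \<in> E}"
  have fO: "finite ?O" by (rule finite_subset[of _ "{1..r} \<times> {1..m}"]) auto
  have fI: "finite (induced_edges E {1..r})" using finite_E by (simp add: induced_edges_def)
  have I: "(\<lambda>i. Pt (\<alpha> i)) ` e = row_label r \<alpha> ` e" if "e \<in> induced_edges E {1..r}" for e
    using that by (intro image_cong) (auto simp: induced_edges_def row_label_def)
  have O: "{Fixed j, Pt (\<alpha> i)} = row_label r \<alpha> ` {r + j, i}" if "i \<in> {1..r}" "j \<in> {1..m}" for i j
    using that by (auto simp: row_label_def)
  have "(\<forall>e\<in>E. row_label r \<alpha> ` e \<in> \<gamma>) \<longleftrightarrow>
    (\<forall>e\<in>induced_edges E {1..r}. row_label r \<alpha> ` e \<in> \<gamma>) \<and> (\<forall>(i, j)\<in>?O. row_label r \<alpha> ` {r + j, i} \<in> \<gamma>)"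
    (is "?L \<longleftrightarrow> ?R")
  proof
    assume R: ?R
    show ?L
    proof
      fix e assume e: "e \<in> E"
      then show "row_label r \<alpha> ` e \<in> \<gamma>"
      proof (cases rule: edge_cases)
        case (inner i j)
        then have "e \<in> induced_edges E {1..r}" using e by (simp add: induced_edges_def)
        then show ?thesis using R by blast
      next
        case (outer i j)
        then have "(i, j) \<in> ?O" using e by simp
        then show ?thesis using R outer(1) by blast
      qed
    qed
  qed (auto simp: induced_edges_def)
  moreover have "copy_indicator r m E \<gamma> \<alpha> = of_bool (\<forall>e\<in>induced_edges E {1..r}. row_label r \<alpha> ` e \<in> \<gamma>)
      * of_bool (\<forall>(i, j)\<in>?O. row_label r \<alpha> ` {r + j, i} \<in> \<gamma>)"
    unfolding copy_indicator_def prod_of_bool[OF fI, symmetric] prod_of_bool[OF fO, symmetric]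
    by (intro arg_cong2[where f="(*)"] prod.cong) (auto simp: I O of_bool_def)
  ultimately show ?thesis by simp
qed

lemma row_label_eq:
  "row_label r (\<lambda>i. \<beta> (block \<rho> (k, i))) v = vertex_label \<beta> (vertex_map r \<rho> k v)"
  by (simp add: row_label_def vertex_map_def)

text \<open>Non-flatness is what keeps the vertices of a single copy distinct after the gluing, so
  each copy embeds with all its edges.\<close>

lemma vertex_map_inj:
  assumes \<rho>: "\<rho> \<in> nonflat_partitions R {1..r}" and k: "k \<in> R"
  shows "inj_on (vertex_map r \<rho> k) {1..r+m}"
proof (rule inj_onI)
  fix u v assume uv: "u \<in> {1..r+m}" "v \<in> {1..r+m}" "vertex_map r \<rho> k u = vertex_map r \<rho> k v"
  have part: "partition_on (R \<times> {1..r}) \<rho>" using \<rho> by (simp add: nonflat_partitions_def)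
  show "u = v"
  proof (cases "u \<le> r")
    case True
    then have "v \<le> r" "block \<rho> (k, u) = block \<rho> (k, v)" using uv by (auto simp: vertex_map_def split: if_splits)
    then have "(k, u) \<in> block \<rho> (k, u)" "(k, v) \<in> block \<rho> (k, u)" "block \<rho> (k, u) \<in> \<rho>"
      using block_in[OF part, of "(k, u)"] block_in[OF part, of "(k, v)"] True uv k by auto
    then have "(k, u) = (k, v)"
      using \<rho> by (intro inj_onD[of fst "block \<rho> (k, u)"]) (auto simp: nonflat_partitions_def)
    then show ?thesis by simp
  next
    case False
    then show ?thesis using uv by (auto simp: vertex_map_def split: if_splits)
  qed
qed

lemma vertex_map_in:
  assumes \<rho>: "\<rho> \<in> nonflat_partitions R {1..r}" and k: "k \<in> R" and v: "v \<in> {1..r+m}"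
  shows "vertex_map r \<rho> k v \<in> abstract_vertices \<rho> m"
proof (cases "v \<le> r")
  case True
  then show ?thesis using v k block_in(1)[of "R \<times> {1..r}" \<rho> "(k, v)"] \<rho>
    by (auto simp: vertex_map_def abstract_vertices_def nonflat_partitions_def)
next
  case False
  then have "v - r \<in> {1..m}" using v by auto
  then show ?thesis using False by (simp add: vertex_map_def abstract_vertices_def)
qed

lemma glued_edges_over:
  assumes \<rho>: "\<rho> \<in> nonflat_partitions R {1..r}"
  shows "glued_edges r E R \<rho> \<subseteq> edges_over (abstract_vertices \<rho> m)"
proof
  fix f assume "f \<in> glued_edges r E R \<rho>"
  then obtain k e where ke: "k \<in> R" "e \<in> E" "f = vertex_map r \<rho> k ` e" by (auto simp: glued_edges_def)
  then obtain u v where uv: "e = {u, v}" "u \<in> {1..r+m}" "v \<in> {1..r+m}" "u \<noteq> v"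
    using E_edges_over by (auto simp: edges_over_def)
  have "vertex_map r \<rho> k u \<noteq> vertex_map r \<rho> k v"
    using inj_onD[OF vertex_map_inj[OF \<rho> ke(1)]] uv by blast
  then show "f \<in> edges_over (abstract_vertices \<rho> m)"
    unfolding edges_over_def ke(3) uv(1) using vertex_map_in[OF \<rho> ke(1)] uv by auto
qed

lemma finite_glued_edges: "finite R \<Longrightarrow> finite (glued_edges r E R \<rho>)"
  using finite_E by (simp add: glued_edges_def)

section \<open>Coincidence patterns of tuples of copies\<close>

definition kernel :: "nat set \<Rightarrow> (nat \<Rightarrow> nat \<Rightarrow> nat) \<Rightarrow> (nat \<times> nat) set set" where
  "kernel R a = (\<lambda>w. {z \<in> R \<times> {1..r}. a (fst z) (snd z) = a (fst w) (snd w)}) ` (R \<times> {1..r})"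

lemma partition_on_kernel: "partition_on (R \<times> {1..r}) (kernel R a)"
  by (rule partition_onI) (auto simp: kernel_def disjnt_def)

lemma kernel_nonflat:
  assumes "a \<in> PiE R (\<lambda>_. injective_tuples r t)"
  shows "kernel R a \<in> nonflat_partitions R {1..r}"
proof -
  have "inj_on fst b" if b: "b \<in> kernel R a" for b
  proof (rule inj_onI)
    fix p q assume pq: "p \<in> b" "q \<in> b" "fst p = fst q"
    then have *: "p \<in> R \<times> {1..r}" "q \<in> R \<times> {1..r}" "a (fst p) (snd p) = a (fst p) (snd q)"
      using b by (auto simp: kernel_def)
    then have "inj_on (a (fst p)) {1..r}" using assms by (auto simp: injective_tuples_def)
    then have "snd p = snd q" using * by (auto dest: inj_onD)
    then show "p = q" using pq by (simp add: prod_eq_iff)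
  qed
  then show ?thesis using partition_on_kernel by (simp add: nonflat_partitions_def)
qed

text \<open>A tuple of labelled copies corresponds to its coincidence pattern \<open>\<rho>\<close> together with an
  injective labelling of the blocks of \<open>\<rho>\<close>.\<close>

lemma bij_kernel:
  assumes \<rho>: "\<rho> \<in> nonflat_partitions R {1..r}"
  shows "bij_betw (\<lambda>\<beta>. \<lambda>k\<in>R. \<lambda>i\<in>{1..r}. \<beta> (block \<rho> (k, i)))
    {\<beta> \<in> PiE \<rho> (\<lambda>_. UNIV). inj_on \<beta> \<rho> \<and> \<beta> ` \<rho> \<subseteq> index_set t}
    {a \<in> PiE R (\<lambda>_. injective_tuples r t). kernel R a = \<rho>}" (is "bij_betw ?f ?S ?T")
\<comment> \<open>The inverse reads the label of a block off an arbitrary element of it;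
  \<open>aval\<close> shows that this is well defined.\<close>
proof (rule bij_betwI[where g = "\<lambda>a. \<lambda>b\<in>\<rho>. let z = (SOME z. z \<in> b) in a (fst z) (snd z)"])
  let ?g = "\<lambda>a. \<lambda>b\<in>\<rho>. let z = (SOME z. z \<in> b) in a (fst z) (snd z)"
  have part: "partition_on (R \<times> {1..r}) \<rho>" using \<rho> by (simp add: nonflat_partitions_def)
  note bin = block_in[OF part] and beq = block_eq[OF part]
  have some: "(SOME z. z \<in> b) \<in> b" if "b \<in> \<rho>" for b
    using that partition_onD3[OF part] by (metis some_in_eq)
  have bsub: "b \<subseteq> R \<times> {1..r}" if "b \<in> \<rho>" for b using that part by (auto simp: partition_on_def)
  have fval: "?f \<beta> (fst z) (snd z) = \<beta> (block \<rho> z)" if "z \<in> R \<times> {1..r}" for \<beta> z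
    using that by auto
  show "?f \<in> ?S \<rightarrow> ?T"
  proof
    fix \<beta> assume \<beta>: "\<beta> \<in> ?S"
    then have inj: "inj_on \<beta> \<rho>" by simp
    have "(\<lambda>i\<in>{1..r}. \<beta> (block \<rho> (k, i))) \<in> injective_tuples r t" if k: "k \<in> R" for k
    proof -
      have "inj_on (\<lambda>i. block \<rho> (k, i)) {1..r}"
      proof (rule inj_onI)
        fix i j assume ij: "i \<in> {1..r}" "j \<in> {1..r}" "block \<rho> (k, i) = block \<rho> (k, j)"
        then have "vertex_map r \<rho> k i = vertex_map r \<rho> k j" by (simp add: vertex_map_def)
        then show "i = j" using inj_onD[OF vertex_map_inj[OF \<rho> k]] ij by auto
      qed
      moreover have "(\<lambda>i. block \<rho> (k, i)) ` {1..r} \<subseteq> \<rho>" using bin(1) k by auto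
      ultimately have "inj_on (\<lambda>i. \<beta> (block \<rho> (k, i))) {1..r}"
        using comp_inj_on[of "\<lambda>i. block \<rho> (k, i)" "{1..r}" \<beta>] inj_on_subset[OF inj] by (simp add: comp_def)
      then have "inj_on (\<lambda>i\<in>{1..r}. \<beta> (block \<rho> (k, i))) {1..r}" by (rule inj_on_restrict_eq[THEN iffD2])
      moreover have "\<beta> (block \<rho> (k, i)) \<in> index_set t" if "i \<in> {1..r}" for i
        using \<beta> bin(1)[of "(k, i)"] k that by auto
      ultimately show ?thesis by (simp add: injective_tuples_def)
    qed
    moreover have "kernel R (?f \<beta>) = \<rho>"
    proof -
      have "{z \<in> R \<times> {1..r}. ?f \<beta> (fst z) (snd z) = ?f \<beta> (fst w) (snd w)} = block \<rho> w"
        if w: "w \<in> R \<times> {1..r}" for w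
      proof -
        have "\<beta> (block \<rho> z) = \<beta> (block \<rho> w) \<longleftrightarrow> z \<in> block \<rho> w" if z: "z \<in> R \<times> {1..r}" for z
        proof
          assume "\<beta> (block \<rho> z) = \<beta> (block \<rho> w)"
          then have "block \<rho> z = block \<rho> w" using inj_onD[OF inj] bin(1)[OF z] bin(1)[OF w] by blast
          then show "z \<in> block \<rho> w" using bin(2)[OF z] by simp
        next
          assume "z \<in> block \<rho> w"
          then show "\<beta> (block \<rho> z) = \<beta> (block \<rho> w)" using beq[OF bin(1)[OF w]] by simp
        qed
        then have "{z \<in> R \<times> {1..r}. \<beta> (block \<rho> z) = \<beta> (block \<rho> w)} = block \<rho> w"
          using bsub[OF bin(1)[OF w]] by blast
        moreover have "{z \<in> R \<times> {1..r}. ?f \<beta> (fst z) (snd z) = ?f \<beta> (fst w) (snd w)}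
          = {z \<in> R \<times> {1..r}. \<beta> (block \<rho> z) = \<beta> (block \<rho> w)}"
          using fval w by (intro Collect_cong conj_cong refl) metis
        ultimately show ?thesis by simp
      qed
      then have "kernel R (?f \<beta>) = block \<rho> ` (R \<times> {1..r})" unfolding kernel_def by (rule image_cong[OF refl])
      then show ?thesis using partition_on_eq_block_image[OF part] by simp
    qed
    ultimately show "?f \<beta> \<in> ?T" by simp
  qed
  \<comment> \<open>A tuple of copies with kernel \<rho> is constant on the blocks and takes
    different values on different blocks.\<close>
  have aval: "a (fst z) (snd z) = a (fst w) (snd w) \<longleftrightarrow> block \<rho> z = block \<rho> w"
    if a: "a \<in> ?T" and zw: "z \<in> R \<times> {1..r}" "w \<in> R \<times> {1..r}" for a z w
  proof -
    have k: "kernel R a = \<rho>" using a by simp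
    have "{x \<in> R \<times> {1..r}. a (fst x) (snd x) = a (fst w) (snd w)} \<in> kernel R a"
      unfolding kernel_def using zw by blast
    then have "block \<rho> w = {x \<in> R \<times> {1..r}. a (fst x) (snd x) = a (fst w) (snd w)}"
      unfolding k using zw by (intro beq) auto
    then have "z \<in> block \<rho> w \<longleftrightarrow> a (fst z) (snd z) = a (fst w) (snd w)" using zw by simp
    moreover have "z \<in> block \<rho> w \<longleftrightarrow> block \<rho> z = block \<rho> w"
      using beq[OF bin(1)[OF zw(2)]] bin(2)[OF zw(1)] by blast
    ultimately show ?thesis by simp
  qed
  have gval: "?g a (block \<rho> z) = a (fst z) (snd z)" if a: "a \<in> ?T" and z: "z \<in> R \<times> {1..r}" for a z
  proof -
    let ?w = "SOME w. w \<in> block \<rho> z"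
    have w: "?w \<in> block \<rho> z" by (rule some[OF bin(1)[OF z]])
    have w2: "?w \<in> R \<times> {1..r}" by (rule subsetD[OF bsub[OF bin(1)[OF z]] w])
    have "a (fst ?w) (snd ?w) = a (fst z) (snd z)"
      by (rule aval[OF a w2 z, THEN iffD2]) (rule beq[OF bin(1)[OF z] w])
    then show ?thesis using bin(1)[OF z] by (simp add: Let_def)
  qed
  show "?g \<in> ?T \<rightarrow> ?S"
  proof
    fix a assume a: "a \<in> ?T"
    have "inj_on (?g a) \<rho>"
    proof (rule inj_onI)
      fix b c assume bc: "b \<in> \<rho>" "c \<in> \<rho>" and e: "?g a b = ?g a c"
      obtain z w where zw: "z \<in> b" "w \<in> c" using some[OF bc(1)] some[OF bc(2)] by blast
      have R: "z \<in> R \<times> {1..r}" "w \<in> R \<times> {1..r}"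
        using subsetD[OF bsub[OF bc(1)] zw(1)] subsetD[OF bsub[OF bc(2)] zw(2)] by this
      have bz: "block \<rho> z = b" "block \<rho> w = c"
        using beq[OF bc(1) zw(1)] beq[OF bc(2) zw(2)] by this
      have "a (fst z) (snd z) = ?g a b" using gval[OF a R(1), symmetric] unfolding bz .
      also have "\<dots> = a (fst w) (snd w)" using gval[OF a R(2)] unfolding bz e .
      finally have "block \<rho> z = block \<rho> w" using aval[OF a R] by simp
      then show "b = c" unfolding bz .
    qed
    moreover have "?g a b \<in> index_set t" if b: "b \<in> \<rho>" for b
    proof -
      let ?z = "SOME z. z \<in> b"
      have z: "?z \<in> R \<times> {1..r}" by (rule subsetD[OF bsub[OF b] some[OF b]])
      then have "a (fst ?z) \<in> injective_tuples r t" using a by auto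
      then have "a (fst ?z) (snd ?z) \<in> index_set t" using z by (auto simp: injective_tuples_def)
      then show ?thesis using b by (simp add: Let_def)
    qed
    ultimately show "?g a \<in> ?S" by auto
  qed
  show "?g (?f \<beta>) = \<beta>" if \<beta>: "\<beta> \<in> ?S" for \<beta>
  proof
    fix b show "?g (?f \<beta>) b = \<beta> b"
    proof (cases "b \<in> \<rho>")
      case True
      let ?z = "SOME z. z \<in> b"
      have z: "?z \<in> b" "?z \<in> R \<times> {1..r}"
        using some[OF True] subsetD[OF bsub[OF True] some[OF True]] by this
      have "?g (?f \<beta>) b = ?f \<beta> (fst ?z) (snd ?z)" using True by (simp only: restrict_apply if_True Let_def)
      also have "\<dots> = \<beta> (block \<rho> ?z)" by (rule fval[OF z(2)])
      also have "block \<rho> ?z = b" by (rule beq[OF True z(1)])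
      finally show ?thesis .
    next
      case False
      then show ?thesis using \<beta> by (auto simp: PiE_def extensional_def)
    qed
  qed
  show "?f (?g a) = a" if a: "a \<in> ?T" for a
  proof
    fix k show "?f (?g a) k = a k"
    proof (cases "k \<in> R")
      case True
      have "(\<lambda>i\<in>{1..r}. ?g a (block \<rho> (k, i))) = (\<lambda>i\<in>{1..r}. a k i)"
      proof (rule restrict_ext)
        fix i assume "i \<in> {1..r}"
        then have "(k, i) \<in> R \<times> {1..r}" using True by simp
        from gval[OF a this] show "?g a (block \<rho> (k, i)) = a k i" unfolding fst_conv snd_conv .
      qed
      also have "\<dots> = a k" using a True by (intro extensional_restrict) (auto simp: injective_tuples_def PiE_def)
      finally show ?thesis using True by simp
    next
      case False
      then show ?thesis using a by (auto simp: PiE_def extensional_def)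
    qed
  qed
qed

text \<open>The count as an element of [0, \<infinity>]. An infinite sum of reals defaults to 0 when
  it diverges, whereas this version can be expanded and integrated before finiteness is
  known.\<close>

definition ennreal_count :: "enat \<Rightarrow> vertex set set \<Rightarrow> ennreal" where
  "ennreal_count t \<gamma> = (\<integral>\<^sup>+\<alpha>. ennreal (copy_indicator r m E \<gamma> \<alpha>) \<partial>count_space (injective_tuples r t))"

text \<open>The power is a sum over families of copies indexed by \<open>R\<close>, split by their
  kernel. An arbitrary row set is allowed because the cumulant involves the moments attached to the
  members \<open>B\<close> of partitions of \<open>{1..n}\<close>, with patterns living on
  \<open>B\<close> itself.\<close>

lemma ennreal_count_power:
  assumes R: "finite R"
  shows "ennreal_count t \<gamma> ^ card R = (\<Sum>\<rho>\<in>nonflat_partitions R {1..r}.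
    \<integral>\<^sup>+\<beta>. of_bool (inj_on \<beta> \<rho> \<and> \<beta> ` \<rho> \<subseteq> index_set t \<and> (\<forall>e\<in>glued_edges r E R \<rho>. vertex_label \<beta> ` e \<in> \<gamma>))
      \<partial>count_space (PiE \<rho> (\<lambda>_. UNIV)))"
proof -
  let ?A = "PiE R (\<lambda>_. injective_tuples r t)"
  let ?N = "nonflat_partitions R {1..r}"
  have fN: "finite ?N" using R by (intro finite_nonflat_partitions) auto
  define H where "H = (\<lambda>a. of_bool (\<forall>k\<in>R. \<forall>e\<in>E. row_label r (a k) ` e \<in> \<gamma>) :: ennreal)"
  have "ennreal_count t \<gamma> ^ card R = (\<Prod>k\<in>R. ennreal_count t \<gamma>)" by simp
  also have "\<dots> = (\<integral>\<^sup>+a. (\<Prod>k\<in>R. ennreal (copy_indicator r m E \<gamma> (a k))) \<partial>count_space ?A)"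
    unfolding ennreal_count_def by (rule nn_integral_count_space_PiE_prod[OF R, symmetric])
  also have "\<dots> = (\<integral>\<^sup>+a. H a \<partial>count_space ?A)"
  proof (rule nn_integral_cong)
    fix a
    have "(\<Prod>k\<in>R. ennreal (copy_indicator r m E \<gamma> (a k))) = (\<Prod>k\<in>R. of_bool (\<forall>e\<in>E. row_label r (a k) ` e \<in> \<gamma>))"
      unfolding copy_indicator_eq by (rule prod.cong) (auto simp: of_bool_def)
    then show "(\<Prod>k\<in>R. ennreal (copy_indicator r m E \<gamma> (a k))) = H a"
      by (simp add: H_def prod_of_bool[OF R])
  qed
  also have "\<dots> = (\<integral>\<^sup>+a. (\<Sum>\<rho>\<in>?N. H a * indicator {a \<in> ?A. kernel R a = \<rho>} a) \<partial>count_space ?A)"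
  proof (rule nn_integral_cong)
    fix a assume "a \<in> space (count_space ?A)"
    then have a: "a \<in> ?A" by simp
    have "(\<Sum>\<rho>\<in>?N. H a * indicator {a \<in> ?A. kernel R a = \<rho>} a) = (\<Sum>\<rho>\<in>?N. if kernel R a = \<rho> then H a else 0)"
      using a by (intro sum.cong) (auto simp: indicator_def)
    also have "\<dots> = H a" using fN kernel_nonflat[OF a] by simp
    finally show "H a = (\<Sum>\<rho>\<in>?N. H a * indicator {a \<in> ?A. kernel R a = \<rho>} a)" by simp
  qed
  also have "\<dots> = (\<Sum>\<rho>\<in>?N. \<integral>\<^sup>+a. H a * indicator {a \<in> ?A. kernel R a = \<rho>} a \<partial>count_space ?A)"
    by (rule nn_integral_sum) simp
  also have "\<dots> = (\<Sum>\<rho>\<in>?N. \<integral>\<^sup>+a. H a \<partial>count_space {a \<in> ?A. kernel R a = \<rho>})"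
  proof (rule sum.cong[OF refl])
    fix \<rho>
    have "(\<integral>\<^sup>+a. H a * indicator {a \<in> ?A. kernel R a = \<rho>} a \<partial>count_space ?A)
      = (\<integral>\<^sup>+a. H a * indicator {a \<in> ?A. kernel R a = \<rho>} a * indicator ?A a \<partial>count_space UNIV)"
      by (simp add: nn_integral_count_space_indicator)
    also have "\<dots> = (\<integral>\<^sup>+a. H a * indicator {a \<in> ?A. kernel R a = \<rho>} a \<partial>count_space UNIV)"
      by (intro nn_integral_cong) (auto simp: indicator_def)
    also have "\<dots> = (\<integral>\<^sup>+a. H a \<partial>count_space {a \<in> ?A. kernel R a = \<rho>})"
      by (simp add: nn_integral_count_space_indicator)
    finally show "(\<integral>\<^sup>+a. H a * indicator {a \<in> ?A. kernel R a = \<rho>} a \<partial>count_space ?A)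
      = (\<integral>\<^sup>+a. H a \<partial>count_space {a \<in> ?A. kernel R a = \<rho>})" .
  qed
  also have "\<dots> = (\<Sum>\<rho>\<in>?N. \<integral>\<^sup>+\<beta>. of_bool (inj_on \<beta> \<rho> \<and> \<beta> ` \<rho> \<subseteq> index_set t \<and>
      (\<forall>e\<in>glued_edges r E R \<rho>. vertex_label \<beta> ` e \<in> \<gamma>)) \<partial>count_space (PiE \<rho> (\<lambda>_. UNIV)))"
  proof (rule sum.cong[OF refl])
    fix \<rho> assume \<rho>: "\<rho> \<in> ?N"
    let ?f = "\<lambda>\<beta>. \<lambda>k\<in>R. \<lambda>i\<in>{1..r}. \<beta> (block \<rho> (k, i)) :: nat"
    let ?S = "{\<beta> \<in> PiE \<rho> (\<lambda>_. UNIV). inj_on \<beta> \<rho> \<and> \<beta> ` \<rho> \<subseteq> index_set t}"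
    \<comment> \<open>Once a tuple is written through the labels of its blocks, the edge conditions
      of all rows together are the conditions on the glued edges; edges shared by several copies are
      required once.\<close>
    have Hf: "H (?f \<beta>) = of_bool (\<forall>e\<in>glued_edges r E R \<rho>. vertex_label \<beta> ` e \<in> \<gamma>)" for \<beta>
    proof -
      have "row_label r (?f \<beta> k) ` e = vertex_label \<beta> ` vertex_map r \<rho> k ` e" if "k \<in> R" "e \<in> E" for k e
      proof -
        have "e \<subseteq> {1..r+m}" using E_edges_over that by (auto simp: edges_over_def)
        then have "row_label r (?f \<beta> k) ` e = row_label r (\<lambda>i. \<beta> (block \<rho> (k, i))) ` e"
          using that by (intro image_cong) (auto simp: row_label_def)
        then show ?thesis by (simp add: row_label_eq image_image)
      qed
      then show ?thesis by (simp add: H_def glued_edges_def)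
    qed
    have "(\<integral>\<^sup>+a. H a \<partial>count_space {a \<in> ?A. kernel R a = \<rho>}) = (\<integral>\<^sup>+\<beta>. H (?f \<beta>) \<partial>count_space ?S)"
      by (rule nn_integral_bij_count_space[OF bij_kernel[OF \<rho>], symmetric])
    also have "\<dots> = (\<integral>\<^sup>+\<beta>. H (?f \<beta>) * indicator ?S \<beta> \<partial>count_space UNIV)"
      by (rule nn_integral_count_space_indicator) (simp add: NO_MATCH_def)
    also have "\<dots> = (\<integral>\<^sup>+\<beta>. of_bool (inj_on \<beta> \<rho> \<and> \<beta> ` \<rho> \<subseteq> index_set t \<and>
      (\<forall>e\<in>glued_edges r E R \<rho>. vertex_label \<beta> ` e \<in> \<gamma>)) * indicator (PiE \<rho> (\<lambda>_. UNIV)) \<beta> \<partial>count_space UNIV)"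
      unfolding Hf by (intro nn_integral_cong) (auto simp: indicator_def)
    also have "\<dots> = (\<integral>\<^sup>+\<beta>. of_bool (inj_on \<beta> \<rho> \<and> \<beta> ` \<rho> \<subseteq> index_set t \<and>
      (\<forall>e\<in>glued_edges r E R \<rho>. vertex_label \<beta> ` e \<in> \<gamma>)) \<partial>count_space (PiE \<rho> (\<lambda>_. UNIV)))"
      by (rule nn_integral_count_space_indicator[symmetric]) (simp add: NO_MATCH_def)
    finally show "(\<integral>\<^sup>+a. H a \<partial>count_space {a \<in> ?A. kernel R a = \<rho>}) = \<dots>" .
  qed
  finally show ?thesis .
qed

lemma copy_indicator_nonneg: "0 \<le> copy_indicator r m E \<gamma> \<alpha>"
  by (simp add: copy_indicator_eq)

lemma copy_indicator_summable_iff: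
  "copy_indicator r m E \<gamma> summable_on injective_tuples r t \<longleftrightarrow> ennreal_count t \<gamma> < \<infinity>"
proof -
  have "copy_indicator r m E \<gamma> summable_on injective_tuples r t
    \<longleftrightarrow> integrable (count_space (injective_tuples r t)) (copy_indicator r m E \<gamma>)"
    by (subst summable_on_iff_abs_summable_on_real, subst abs_summable_equivalent)
      (rule Infinite_Set_Sum.abs_summable_on_def)
  also have "\<dots> \<longleftrightarrow> ennreal_count t \<gamma> < \<infinity>"
    by (simp add: integrable_iff_bounded ennreal_count_def copy_indicator_nonneg)
  finally show ?thesis .
qed

text \<open>In the divergent case both sides take their default value 0.\<close>

lemma subgraph_count_eq: "subgraph_count r m E t \<gamma> = enn2real (ennreal_count t \<gamma>)"
proof (cases "ennreal_count t \<gamma> < \<infinity>")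
  case True
  then have "copy_indicator r m E \<gamma> summable_on injective_tuples r t" by (simp add: copy_indicator_summable_iff)
  then have "Infinite_Set_Sum.abs_summable_on (copy_indicator r m E \<gamma>) (injective_tuples r t)"
    by (subst (asm) summable_on_iff_abs_summable_on_real, subst (asm) abs_summable_equivalent)
  from infsetsum_infsum[OF this] have "subgraph_count r m E t \<gamma>
    = (\<integral>\<alpha>. copy_indicator r m E \<gamma> \<alpha> \<partial>count_space (injective_tuples r t))"
    by (simp add: subgraph_count_def infsetsum_def)
  then show ?thesis
    by (simp add: integral_eq_nn_integral copy_indicator_nonneg ennreal_count_def)
next
  case False
  then have "\<not> copy_indicator r m E \<gamma> summable_on injective_tuples r t" by (simp add: copy_indicator_summable_iff)
  then have "subgraph_count r m E t \<gamma> = 0" by (simp add: subgraph_count_def infsum_not_exists)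
  then show ?thesis using False by (simp add: not_less top_unique)
qed

end

section \<open>Moments of the count\<close>

locale random_connection_count = random_connection M \<psi> \<tau> X \<Gamma> m y \<Lambda> + endpoint_graph r m E
  for M :: "'w measure" and \<psi> :: "'a::topological_space \<Rightarrow> 'a \<Rightarrow> real"
    and \<tau> X \<Gamma> m y \<Lambda> r E
begin

lemma nonflat_finite:
  assumes "finite R" "\<rho> \<in> nonflat_partitions R {1..r}"
  shows "finite \<rho>"
  using assms finite_elements[of "R \<times> {1..r}" \<rho>] by (simp add: nonflat_partitions_def)

lemma measurable_ennreal_count [measurable]:
  "(\<lambda>\<omega>. ennreal_count (\<tau> \<omega>) (\<Gamma> \<omega>)) \<in> borel_measurable M"
proof -
  \<comment> \<open>Written as a first power, the count is a finite sum of numbers of embeddings,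
    which are known to be measurable.\<close>
  have "(\<lambda>\<omega>. ennreal_count (\<tau> \<omega>) (\<Gamma> \<omega>) ^ card {1::nat}) \<in> borel_measurable M"
    unfolding ennreal_count_power[OF finite.insertI[OF finite.emptyI]]
  proof (rule borel_measurable_sum)
    fix \<rho> assume \<rho>: "\<rho> \<in> nonflat_partitions {1::nat} {1..r}"
    show "(\<lambda>\<omega>. \<integral>\<^sup>+\<beta>. of_bool (inj_on \<beta> \<rho> \<and> \<beta> ` \<rho> \<subseteq> index_set (\<tau> \<omega>) \<and>
        (\<forall>e\<in>glued_edges r E {1} \<rho>. vertex_label \<beta> ` e \<in> \<Gamma> \<omega>)) \<partial>count_space (PiE \<rho> (\<lambda>_. UNIV))) \<in> borel_measurable M"
      by (rule borel_measurable_embeddings[OF nonflat_finite[OF _ \<rho>] finite_glued_edges glued_edges_over[OF \<rho>]]) auto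
  qed
  then show ?thesis by simp
qed

lemma moment_ennreal_count:
  assumes R: "finite R"
  shows "(\<integral>\<^sup>+\<omega>. ennreal_count (\<tau> \<omega>) (\<Gamma> \<omega>) ^ card R \<partial>M)
    = (\<Sum>\<rho>\<in>nonflat_partitions R {1..r}.
        \<integral>\<^sup>+x. (\<Prod>e\<in>glued_edges r E R \<rho>. ennreal (edge_weight \<psi> (case_sum x y) e)) \<partial>PiM \<rho> (\<lambda>_. \<Lambda>))"
  unfolding ennreal_count_power[OF R]
proof (subst nn_integral_sum)
  fix \<rho> assume \<rho>: "\<rho> \<in> nonflat_partitions R {1..r}"
  show "(\<lambda>\<omega>. \<integral>\<^sup>+\<beta>. of_bool (inj_on \<beta> \<rho> \<and> \<beta> ` \<rho> \<subseteq> index_set (\<tau> \<omega>) \<and>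
        (\<forall>e\<in>glued_edges r E R \<rho>. vertex_label \<beta> ` e \<in> \<Gamma> \<omega>)) \<partial>count_space (PiE \<rho> (\<lambda>_. UNIV))) \<in> borel_measurable M"
    by (rule borel_measurable_embeddings[OF nonflat_finite[OF R \<rho>] finite_glued_edges[OF R] glued_edges_over[OF \<rho>]])
next
  show "(\<Sum>\<rho>\<in>nonflat_partitions R {1..r}. \<integral>\<^sup>+\<omega>. \<integral>\<^sup>+\<beta>. of_bool (inj_on \<beta> \<rho> \<and> \<beta> ` \<rho> \<subseteq> index_set (\<tau> \<omega>) \<and>
        (\<forall>e\<in>glued_edges r E R \<rho>. vertex_label \<beta> ` e \<in> \<Gamma> \<omega>)) \<partial>count_space (PiE \<rho> (\<lambda>_. UNIV)) \<partial>M)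
    = (\<Sum>\<rho>\<in>nonflat_partitions R {1..r}.
        \<integral>\<^sup>+x. (\<Prod>e\<in>glued_edges r E R \<rho>. ennreal (edge_weight \<psi> (case_sum x y) e)) \<partial>PiM \<rho> (\<lambda>_. \<Lambda>))"
    by (intro sum.cong refl expectation_embeddings nonflat_finite[OF R] finite_glued_edges[OF R] glued_edges_over)
qed

end

section \<open>Integrals attached to glued graphs\<close>

text \<open>Fubini, splitting off one coordinate block \<open>K j\<close> at a time; the last
  hypothesis says that \<open>f i\<close> depends only on the coordinates in
  \<open>K i\<close>.\<close>

lemma (in product_sigma_finite) product_nn_integral_disjoint_family:
  fixes f :: "'j \<Rightarrow> ('i \<Rightarrow> 'a) \<Rightarrow> ennreal"
  assumes "finite I" "\<And>i. i \<in> I \<Longrightarrow> finite (K i)" "disjoint_family_on K I"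
    and "\<And>i. i \<in> I \<Longrightarrow> f i \<in> borel_measurable (PiM (K i) M)"
    and "\<And>i x x'. i \<in> I \<Longrightarrow> (\<And>k. k \<in> K i \<Longrightarrow> x k = x' k) \<Longrightarrow> f i x = f i x'"
  shows "(\<integral>\<^sup>+x. (\<Prod>i\<in>I. f i x) \<partial>PiM (\<Union>i\<in>I. K i) M) = (\<Prod>i\<in>I. \<integral>\<^sup>+x. f i x \<partial>PiM (K i) M)"
  using assms
proof (induction I rule: finite_induct)
  case empty
  show ?case using nn_integral_empty[of "\<lambda>_. 1"] by simp
next
  case (insert j I)
  let ?U = "\<Union>i\<in>I. K i"
  have U: "finite ?U" "K j \<inter> ?U = {}" "finite (K j)"
    using insert(1,2) insert.prems(1,2) by (auto simp: disjoint_family_on_def)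
  have sub: "f i \<in> borel_measurable (PiM L M)" if "i \<in> insert j I" "K i \<subseteq> L" for i L
  proof -
    have "(\<lambda>x. f i (restrict x (K i))) \<in> borel_measurable (PiM L M)"
      using measurable_compose[OF measurable_restrict_subset[OF that(2)] insert.prems(3)[OF that(1)]] .
    moreover have "f i (restrict x (K i)) = f i x" for x
      using that by (intro insert.prems(4)) auto
    ultimately show ?thesis by simp
  qed
  have fj: "f j (merge (K j) ?U (x, x')) = f j x" for x x'
    by (intro insert.prems(4)) (auto simp: merge_def)
  have fi: "(\<Prod>i\<in>I. f i (merge (K j) ?U (x, x'))) = (\<Prod>i\<in>I. f i x')" for x x'
  proof (rule prod.cong[OF refl])
    fix i assume i: "i \<in> I"
    have "merge (K j) ?U (x, x') k = x' k" if "k \<in> K i" for k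
      using that U(2) i by (auto simp: merge_def)
    then show "f i (merge (K j) ?U (x, x')) = f i x'" using i by (intro insert.prems(4)) auto
  qed
  have m1: "(\<lambda>x. \<Prod>i\<in>I. f i x) \<in> borel_measurable (PiM ?U M)"
    by (intro borel_measurable_prod_ennreal sub) auto
  have IH: "(\<integral>\<^sup>+x. (\<Prod>i\<in>I. f i x) \<partial>PiM ?U M) = (\<Prod>i\<in>I. \<integral>\<^sup>+x. f i x \<partial>PiM (K i) M)"
  proof (rule insert.IH)
    show "finite (K i)" if "i \<in> I" for i using insert.prems(1) that by simp
    show "disjoint_family_on K I" using insert.prems(2) by (auto simp: disjoint_family_on_def)
    show "f i \<in> borel_measurable (PiM (K i) M)" if "i \<in> I" for i using insert.prems(3) that by simp
    show "f i x = f i x'" if "i \<in> I" "\<And>k. k \<in> K i \<Longrightarrow> x k = x' k" for i x x'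
      using that by (intro insert.prems(4)) auto
  qed
  have "(\<integral>\<^sup>+x. (\<Prod>i\<in>insert j I. f i x) \<partial>PiM (\<Union>i\<in>insert j I. K i) M)
    = (\<integral>\<^sup>+x. f j x * (\<Prod>i\<in>I. f i x) \<partial>PiM (K j \<union> ?U) M)"
    using insert(1,2) by simp
  also have "\<dots> = (\<integral>\<^sup>+x. \<integral>\<^sup>+x'. f j (merge (K j) ?U (x, x')) * (\<Prod>i\<in>I. f i (merge (K j) ?U (x, x')))
      \<partial>PiM ?U M \<partial>PiM (K j) M)"
    by (rule product_nn_integral_fold[OF U(2,3,1)])
      (intro borel_measurable_times_ennreal borel_measurable_prod_ennreal sub, auto)
  also have "\<dots> = (\<integral>\<^sup>+x. f j x * (\<integral>\<^sup>+x'. (\<Prod>i\<in>I. f i x') \<partial>PiM ?U M) \<partial>PiM (K j) M)"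
    unfolding fj fi by (intro nn_integral_cong nn_integral_cmult m1)
  also have "\<dots> = (\<integral>\<^sup>+x. f j x \<partial>PiM (K j) M) * (\<integral>\<^sup>+x'. (\<Prod>i\<in>I. f i x') \<partial>PiM ?U M)"
    by (intro nn_integral_multc insert.prems(3)) simp
  finally show ?case unfolding IH using insert(1,2) by simp
qed

lemma PiM_scale_measure:
  assumes K: "finite K" and l: "0 < l" and \<mu>: "sigma_finite_measure \<mu>"
    and s: "sigma_finite_measure (scale_measure (ennreal l) \<mu>)"
  shows "PiM K (\<lambda>_. scale_measure (ennreal l) \<mu>) = scale_measure (ennreal (l ^ card K)) (PiM K (\<lambda>_. \<mu>))"
proof -
  interpret S: product_sigma_finite "\<lambda>_. scale_measure (ennreal l) \<mu>"
    using s by (simp add: product_sigma_finite_def)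
  interpret P: product_sigma_finite "\<lambda>_. \<mu>"
    using \<mu> by (simp add: product_sigma_finite_def)
  show ?thesis
  proof (rule S.PiM_eqI[OF K, symmetric])
    show "sets (scale_measure (ennreal (l ^ card K)) (PiM K (\<lambda>_. \<mu>))) = sets (PiM K (\<lambda>_. scale_measure (ennreal l) \<mu>))"
      by (simp cong: sets_PiM_cong)
    fix A assume A: "\<And>k. k \<in> K \<Longrightarrow> A k \<in> sets (scale_measure (ennreal l) \<mu>)"
    then have "emeasure (PiM K (\<lambda>_. \<mu>)) (PiE K A) = (\<Prod>k\<in>K. emeasure \<mu> (A k))"
      using K by (intro P.emeasure_PiM) auto
    then show "emeasure (scale_measure (ennreal (l ^ card K)) (PiM K (\<lambda>_. \<mu>))) (PiE K A)
      = (\<Prod>k\<in>K. emeasure (scale_measure (ennreal l) \<mu>) (A k))"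
      using l by (simp add: prod.distrib ennreal_power)
  qed
qed

lemma sigma_finite_scale_measure:
  assumes "sigma_finite_measure \<mu>" "0 \<le> l"
  shows "sigma_finite_measure (scale_measure (ennreal l) \<mu>)"
proof
  from sigma_finite_measure.sigma_finite_countable[OF assms(1)] obtain A
    where A: "countable A" "A \<subseteq> sets \<mu>" "\<Union>A = space \<mu>" "\<forall>a\<in>A. emeasure \<mu> a \<noteq> \<infinity>" by auto
  then show "\<exists>A. countable A \<and> A \<subseteq> sets (scale_measure (ennreal l) \<mu>) \<and>
      \<Union> A = space (scale_measure (ennreal l) \<mu>) \<and> (\<forall>a\<in>A. emeasure (scale_measure (ennreal l) \<mu>) a \<noteq> \<infinity>)"
    by (intro exI[of _ A]) (auto simp: ennreal_mult_eq_top_iff space_scale_measure)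
qed

text \<open>A path from inside \<open>S\<close> to a vertex outside has to leave \<open>S\<close>
  along some edge.\<close>

lemma connected_graph_cut:
  assumes G: "connected_graph V E" and S: "S \<subseteq> V" "S \<noteq> {}" "S \<noteq> V"
  shows "\<exists>i\<in>S. \<exists>j\<in>V - S. {i, j} \<in> E"
proof -
  obtain u v where uv: "u \<in> S" "v \<in> V" "v \<notin> S" using S by blast
  then have "(u, v) \<in> {(a, b). {a, b} \<in> E}\<^sup>*" using G S by (auto simp: connected_graph_def)
  then have "v \<in> S \<or> (\<exists>i\<in>S. \<exists>j. j \<notin> S \<and> {i, j} \<in> E)"
    by (induction rule: rtrancl_induct) (use uv in auto)
  then obtain i j where ij: "i \<in> S" "j \<notin> S" "{i, j} \<in> E" using uv by blast
  moreover have "j \<in> V"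
    using ij(3) G by (auto simp: connected_graph_def simple_graph_def doubleton_eq_iff)
  ultimately show ?thesis by blast
qed

context endpoint_graph
begin

text \<open>The set of endpoints is a proper nonempty vertex set, so connectedness of the whole
  graph provides an edge leaving it.\<close>

lemma outer_edge_exists:
  assumes "1 \<le> m"
  obtains i j where "i \<in> {1..r}" "j \<in> {1..m}" "{r + j, i} \<in> E"
proof -
  obtain u v where uv: "u \<in> {r+1..r+m}" "v \<in> {1..r+m} - {r+1..r+m}" "{u, v} \<in> E"
    using connected_graph_cut[OF connected, of "{r+1..r+m}"] r assms by fastforce
  then have "u - r \<in> {1..m}" "v \<in> {1..r}" "{r + (u - r), v} \<in> E" by auto
  then show thesis using that by blast
qed

lemma inner_cut_edge:
  assumes "S \<subseteq> {1..r}" "S \<noteq> {}" "S \<noteq> {1..r}"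
  obtains i j where "i \<in> S" "j \<in> {1..r} - S" "{i, j} \<in> E"
  using connected_graph_cut[OF inner_connected assms] by (auto simp: induced_edges_def)

lemma block_restrict:
  assumes \<rho>: "\<rho> \<in> nonflat_partitions R {1..r}" and \<pi>: "partition_on R \<pi>" "B \<in> \<pi>"
    and comp: "\<forall>b\<in>\<rho>. \<exists>B\<in>\<pi>. fst ` b \<subseteq> B" and z: "z \<in> B \<times> {1..r}"
  shows "block {b\<in>\<rho>. fst ` b \<subseteq> B} z = block \<rho> z"
proof -
  have "{b\<in>\<rho>. fst ` b \<subseteq> B} \<in> nonflat_partitions B {1..r}"
    by (rule nonflat_partitions_restrict[OF \<rho> \<pi> comp])
  then have part: "partition_on (B \<times> {1..r}) {b\<in>\<rho>. fst ` b \<subseteq> B}" by (simp add: nonflat_partitions_def)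
  note b = block_in[OF part z]
  have "partition_on (R \<times> {1..r}) \<rho>" using \<rho> by (simp add: nonflat_partitions_def)
  from block_eq[OF this _ b(2)] show ?thesis using b(1) by simp
qed

lemma glued_edges_decompose:
  assumes \<rho>: "\<rho> \<in> nonflat_partitions R {1..r}" and \<pi>: "partition_on R \<pi>"
    and comp: "\<forall>b\<in>\<rho>. \<exists>B\<in>\<pi>. fst ` b \<subseteq> B"
  shows "glued_edges r E R \<rho> = (\<Union>B\<in>\<pi>. glued_edges r E B {b\<in>\<rho>. fst ` b \<subseteq> B})"
proof -
  have "vertex_map r {b\<in>\<rho>. fst ` b \<subseteq> B} k ` e = vertex_map r \<rho> k ` e"
    if "B \<in> \<pi>" "k \<in> B" "e \<in> E" for B k e
  proof (rule image_cong[OF refl])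
    fix v assume "v \<in> e"
    then have v: "v \<in> {1..r+m}" using E_edges_over that by (auto simp: edges_over_def)
    show "vertex_map r {b\<in>\<rho>. fst ` b \<subseteq> B} k v = vertex_map r \<rho> k v"
      using block_restrict[OF \<rho> \<pi> that(1) comp, of "(k, v)"] that(2) v by (auto simp: vertex_map_def)
  qed
  note vm = this
  have "glued_edges r E B {b\<in>\<rho>. fst ` b \<subseteq> B} = (\<Union>k\<in>B. (\<lambda>e. vertex_map r \<rho> k ` e) ` E)"
    if "B \<in> \<pi>" for B
    unfolding glued_edges_def
    by (rule SUP_cong[OF refl], rule image_cong[OF refl]) (use vm that in simp)
  moreover have "R = \<Union>\<pi>" using \<pi> by (simp add: partition_on_def)
  ultimately show ?thesis by (simp add: glued_edges_def)
qed

text \<open>Every edge has an inner vertex because endpoints are not adjacent. This keeps the edge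
  sets of different groups of copies disjoint, although all copies share the endpoints.\<close>

lemma glued_edges_Inl:
  assumes \<rho>: "\<rho> \<in> nonflat_partitions R {1..r}" and f: "f \<in> glued_edges r E R \<rho>"
  obtains b where "b \<in> \<rho>" "Inl b \<in> f"
proof -
  obtain k e where ke: "k \<in> R" "e \<in> E" "f = vertex_map r \<rho> k ` e" using f by (auto simp: glued_edges_def)
  obtain i where i: "i \<in> e" "i \<in> {1..r}" using ke(2) by (cases rule: edge_cases) auto
  have "block \<rho> (k, i) \<in> \<rho>"
    using \<rho> ke i by (intro block_in(1)) (auto simp: nonflat_partitions_def)
  moreover have "Inl (block \<rho> (k, i)) \<in> f"
    unfolding ke(3) using i by (force simp: vertex_map_def)
  ultimately show thesis using that by blast
qed

end

section \<open>Multiplicativity and finiteness of the integrals\<close>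

locale glued_integrals = endpoint_graph r m E + connection_function \<psi>
  for r m E and \<psi> :: "'a::topological_space \<Rightarrow> 'a \<Rightarrow> real" +
  fixes y :: "nat \<Rightarrow> 'a" and \<Lambda> :: "'a measure"
  assumes sets_Lam: "sets \<Lambda> = sets borel" and sigma_finite_Lam: "sigma_finite_measure \<Lambda>"
begin

definition edge_integral :: "'k set \<Rightarrow> ('k + nat) set set \<Rightarrow> ennreal" where
  "edge_integral K F = (\<integral>\<^sup>+x. (\<Prod>e\<in>F. ennreal (edge_weight \<psi> (case_sum x y) e)) \<partial>PiM K (\<lambda>_. \<Lambda>))"

lemma product_sigma_finite_Lam: "product_sigma_finite (\<lambda>_. \<Lambda>)"
  by (simp add: product_sigma_finite_def sigma_finite_Lam)

lemma measurable_edge_prod: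
  assumes "F \<subseteq> edges_over (abstract_vertices K m)"
  shows "(\<lambda>x. \<Prod>e\<in>F. ennreal (edge_weight \<psi> (case_sum x y) e)) \<in> borel_measurable (PiM K (\<lambda>_. \<Lambda>))"
  by (intro borel_measurable_prod_ennreal measurable_compose[OF _ measurable_ennreal]
        borel_measurable_edge_weight_PiM) (use assms sets_Lam in auto)

lemma edge_prod_cong:
  assumes F: "F \<subseteq> edges_over (abstract_vertices K m)" and x: "\<And>k. k \<in> K \<Longrightarrow> x k = x' k"
  shows "(\<Prod>e\<in>F. ennreal (edge_weight \<psi> (case_sum x y) e)) = (\<Prod>e\<in>F. ennreal (edge_weight \<psi> (case_sum x' y) e))"
proof (intro prod.cong refl arg_cong[where f=ennreal])
  fix e assume "e \<in> F"
  then show "edge_weight \<psi> (case_sum x y) e = edge_weight \<psi> (case_sum x' y) e"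
    using F x by (intro edge_weight_cong[OF psi_sym, of _ "abstract_vertices K m"])
      (auto simp: abstract_vertices_def)
qed

lemma edge_prod_antimono:
  assumes "finite F" "F' \<subseteq> F"
  shows "(\<Prod>e\<in>F. ennreal (edge_weight \<psi> z e)) \<le> (\<Prod>e\<in>F'. ennreal (edge_weight \<psi> z e))"
proof -
  have "(\<Prod>e\<in>F. ennreal (edge_weight \<psi> z e))
    = (\<Prod>e\<in>F'. ennreal (edge_weight \<psi> z e)) * (\<Prod>e\<in>F - F'. ennreal (edge_weight \<psi> z e))"
    using assms by (subst prod.subset_diff[OF assms(2,1)]) (simp add: mult.commute)
  also have "\<dots> \<le> (\<Prod>e\<in>F'. ennreal (edge_weight \<psi> z e)) * 1"
    using edge_weight_range[OF psi_range] by (intro mult_left_mono prod_le_1) auto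
  finally show ?thesis by simp
qed

text \<open>Different members of \<pi> use disjoint sets of blocks, hence different integration
  variables, and disjoint sets of edges. The shared endpoints do not couple the factors, their
  positions being constants.\<close>

lemma edge_integral_multiplicative:
  assumes R: "finite R" and \<rho>: "\<rho> \<in> nonflat_partitions R {1..r}" and \<pi>: "partition_on R \<pi>"
    and comp: "\<forall>b\<in>\<rho>. \<exists>B\<in>\<pi>. fst ` b \<subseteq> B"
  shows "(\<Prod>B\<in>\<pi>. edge_integral {b\<in>\<rho>. fst ` b \<subseteq> B} (glued_edges r E B {b\<in>\<rho>. fst ` b \<subseteq> B}))
    = edge_integral \<rho> (glued_edges r E R \<rho>)"
proof -
  interpret P: product_sigma_finite "\<lambda>_::(nat \<times> nat) set. \<Lambda>" by (rule product_sigma_finite_Lam)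
  let ?K = "\<lambda>B. {b\<in>\<rho>. fst ` b \<subseteq> B}"
  let ?F = "\<lambda>B. glued_edges r E B (?K B)"
  have f\<pi>: "finite \<pi>" using R \<pi> finite_elements by blast
  have f\<rho>: "finite \<rho>" using R \<rho> finite_elements[of "R \<times> {1..r}" \<rho>] by (simp add: nonflat_partitions_def)
  have NF: "?K B \<in> nonflat_partitions B {1..r}" if "B \<in> \<pi>" for B
    by (rule nonflat_partitions_restrict[OF \<rho> \<pi> that comp])
  have over: "?F B \<subseteq> edges_over (abstract_vertices (?K B) m)" if "B \<in> \<pi>" for B
    by (rule glued_edges_over[OF NF[OF that]])
  have fB: "finite B" if "B \<in> \<pi>" for B
    by (rule finite_subset[OF _ R]) (use that \<pi> in \<open>auto simp: partition_on_def\<close>)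
  have Kdis: "disjoint_family_on ?K \<pi>"
  proof -
    have "?K B \<inter> ?K C = {}" if BC: "B \<in> \<pi>" "C \<in> \<pi>" "B \<noteq> C" for B C
    proof -
      have "B \<inter> C = {}" using BC \<pi> by (meson disjointD partition_onD2)
      moreover have "fst ` b \<noteq> {}" if "b \<in> \<rho>" for b using nonflat_partitions_rows(3)[OF \<rho> that] by simp
      ultimately show ?thesis by blast
    qed
    then show ?thesis by (simp add: disjoint_family_on_def)
  qed
  have Fdis: "?F B \<inter> ?F C = {}" if BC: "B \<in> \<pi>" "C \<in> \<pi>" "B \<noteq> C" for B C
  proof -
    have False if f: "f \<in> ?F B" "f \<in> ?F C" for f
    proof -
      obtain b where b: "b \<in> ?K B" "Inl b \<in> f" by (rule glued_edges_Inl[OF NF[OF BC(1)] f(1)])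
      have "f \<in> edges_over (abstract_vertices (?K C) m)" using over[OF BC(2)] f(2) by blast
      then have "b \<in> ?K C" using b(2) by (auto simp: edges_over_def abstract_vertices_def)
      then show False using b(1) Kdis BC unfolding disjoint_family_on_def by blast
    qed
    then show ?thesis by blast
  qed
  have U: "(\<Union>B\<in>\<pi>. ?K B) = \<rho>" using comp by blast
  have "(\<Prod>B\<in>\<pi>. edge_integral (?K B) (?F B))
    = (\<integral>\<^sup>+x. (\<Prod>B\<in>\<pi>. \<Prod>e\<in>?F B. ennreal (edge_weight \<psi> (case_sum x y) e)) \<partial>PiM (\<Union>B\<in>\<pi>. ?K B) (\<lambda>_. \<Lambda>))"
    unfolding edge_integral_def
  proof (rule P.product_nn_integral_disjoint_family[symmetric, OF f\<pi> _ Kdis])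
    show "finite (?K B)" for B using f\<rho> by simp
    show "(\<lambda>x. \<Prod>e\<in>?F B. ennreal (edge_weight \<psi> (case_sum x y) e)) \<in> borel_measurable (PiM (?K B) (\<lambda>_. \<Lambda>))"
      if "B \<in> \<pi>" for B by (rule measurable_edge_prod[OF over[OF that]])
    show "(\<Prod>e\<in>?F B. ennreal (edge_weight \<psi> (case_sum x y) e)) = (\<Prod>e\<in>?F B. ennreal (edge_weight \<psi> (case_sum x' y) e))"
      if "B \<in> \<pi>" "\<And>k. k \<in> ?K B \<Longrightarrow> x k = x' k" for B x x'
      by (rule edge_prod_cong[OF over[OF that(1)] that(2)])
  qed
  also have "\<dots> = edge_integral \<rho> (glued_edges r E R \<rho>)"
  proof -
    have "(\<Prod>e\<in>(\<Union>B\<in>\<pi>. ?F B). ennreal (edge_weight \<psi> (case_sum x y) e))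
      = (\<Prod>B\<in>\<pi>. \<Prod>e\<in>?F B. ennreal (edge_weight \<psi> (case_sum x y) e))" for x
      using f\<pi> Fdis finite_glued_edges[OF fB] by (intro prod.UNION_disjoint) auto
    then show ?thesis unfolding edge_integral_def glued_edges_decompose[OF \<rho> \<pi> comp] U by simp
  qed
  finally show ?thesis .
qed

lemma edge_integral_finite_measure:
  assumes "finite K" "finite F"
  shows "edge_integral K F \<le> emeasure \<Lambda> (space \<Lambda>) ^ card K"
proof -
  interpret P: product_sigma_finite "\<lambda>_. \<Lambda>" by (rule product_sigma_finite_Lam)
  have "edge_integral K F \<le> (\<integral>\<^sup>+x. 1 \<partial>PiM K (\<lambda>_. \<Lambda>))"
    unfolding edge_integral_def
    using edge_weight_range[OF psi_range] by (intro nn_integral_mono prod_le_1) auto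
  also have "\<dots> = emeasure (PiM K (\<lambda>_. \<Lambda>)) (PiE K (\<lambda>_. space \<Lambda>))" by (simp add: space_PiM)
  also have "\<dots> = emeasure \<Lambda> (space \<Lambda>) ^ card K"
    using assms by (subst P.emeasure_PiM) auto
  finally show ?thesis .
qed

text \<open>Vertices are integrated out one after the other, each new vertex being joined to one of its
  predecessors or to an endpoint.\<close>

lemma edge_integral_grow:
  fixes K :: "'k set"
  assumes K: "finite K" and F: "finite F" "F \<subseteq> edges_over (abstract_vertices K m)"
    and C: "\<And>x. (\<integral>\<^sup>+z. ennreal (\<psi> x z) \<partial>\<Lambda>) \<le> C"
    and grow: "\<And>Q. Q \<subseteq> K \<Longrightarrow> Q \<noteq> K \<Longrightarrow> \<exists>b\<in>K - Q. \<exists>v\<in>abstract_vertices Q m. {Inl b, v} \<in> F"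
  shows "edge_integral K F \<le> C ^ card K"
proof -
  interpret P: product_sigma_finite "\<lambda>_::'k. \<Lambda>" by (rule product_sigma_finite_Lam)
  \<comment> \<open>The claim for the subgraph over \<open>n\<close> suitably chosen vertices and
    the endpoints; each step enlarges \<open>Q\<close> by a vertex that \<open>grow\<close>
    supplies.\<close>
  have "\<exists>Q\<subseteq>K. card Q = n \<and> edge_integral Q (F \<inter> edges_over (abstract_vertices Q m)) \<le> C ^ n"
    if "n \<le> card K" for n
    using that
  proof (induction n)
    case 0
    have "edge_integral {} (F \<inter> edges_over (abstract_vertices {} m)) \<le> 1"
      using edge_integral_finite_measure[of "{}::'k set" "F \<inter> edges_over (abstract_vertices {} m)"] F by simp
    then show ?case by (intro exI[of _ "{}"]) simp
  next
    case (Suc n)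
    then obtain Q where Q: "Q \<subseteq> K" "card Q = n"
      and IH: "edge_integral Q (F \<inter> edges_over (abstract_vertices Q m)) \<le> C ^ n" by auto
    have fQ: "finite Q" using Q K finite_subset by blast
    have "Q \<noteq> K" using Q Suc.prems by auto
    then obtain b v where bv: "b \<in> K - Q" "v \<in> abstract_vertices Q m" "{Inl b, v} \<in> F"
      using grow[OF Q(1)] by blast
    let ?F = "\<lambda>Q. F \<inter> edges_over (abstract_vertices Q m)"
    have vb: "v \<noteq> Inl b" using bv by (auto simp: abstract_vertices_def)
    have e0: "{Inl b, v} \<notin> ?F Q" using bv by (auto simp: edges_over_def abstract_vertices_def doubleton_eq_iff)
    have mono: "abstract_vertices Q m \<subseteq> abstract_vertices (insert b Q) m" by (auto simp: abstract_vertices_def)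
    have sub: "insert {Inl b, v} (?F Q) \<subseteq> ?F (insert b Q)"
    proof -
      have "{Inl b, v} \<in> edges_over (abstract_vertices (insert b Q) m)"
        using bv(2) mono vb by (auto simp: edges_over_def abstract_vertices_def)
      moreover have "edges_over (abstract_vertices Q m) \<subseteq> edges_over (abstract_vertices (insert b Q) m)"
        using mono by (auto simp: edges_over_def)
      ultimately show ?thesis using bv(3) by blast
    qed
    let ?p = "\<lambda>S x. \<Prod>e\<in>S. ennreal (edge_weight \<psi> (case_sum x y) e)"
    have meas: "(\<lambda>x. ?p (insert {Inl b, v} (?F Q)) x) \<in> borel_measurable (PiM (insert b Q) (\<lambda>_. \<Lambda>))"
      using sub by (intro measurable_edge_prod) auto
    have upd: "?p (insert {Inl b, v} (?F Q)) (x(b := z)) = ?p (?F Q) x * ennreal (\<psi> (case_sum x y v) z)" for x z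
    proof -
      have "?p (?F Q) (x(b := z)) = ?p (?F Q) x"
        using bv by (intro edge_prod_cong[of _ Q]) auto
      moreover have "edge_weight \<psi> (case_sum (x(b := z)) y) {Inl b, v} = \<psi> (case_sum x y v) z"
      proof -
        have "case_sum (x(b := z)) y v = case_sum x y v" using vb by (cases v) auto
        then show ?thesis
          unfolding edge_weight_doubleton[OF psi_sym] by (simp add: psi_sym[of z])
      qed
      ultimately show ?thesis using F e0 by (simp add: mult.commute)
    qed
    have psi1: "(\<lambda>z. ennreal (\<psi> x z)) \<in> borel_measurable \<Lambda>" for x
    proof -
      have "(\<lambda>z. (x, z)) \<in> measurable borel (borel \<Otimes>\<^sub>M borel)" by measurable
      from measurable_compose[OF this psi_meas] show ?thesis
        by (simp cong: measurable_cong_sets add: sets_Lam)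
    qed
    \<comment> \<open>Of the edges that the new vertex \<open>b\<close> brings in, only the one to
      \<open>v\<close> is kept; the others have weight at most 1. Integrating over the position of
      \<open>b\<close> then costs at most \<open>C\<close>.\<close>
    have "edge_integral (insert b Q) (?F (insert b Q)) \<le> (\<integral>\<^sup>+x. ?p (insert {Inl b, v} (?F Q)) x \<partial>PiM (insert b Q) (\<lambda>_. \<Lambda>))"
      unfolding edge_integral_def using F sub by (intro nn_integral_mono edge_prod_antimono) auto
    also have "\<dots> = (\<integral>\<^sup>+x. \<integral>\<^sup>+z. ?p (insert {Inl b, v} (?F Q)) (x(b := z)) \<partial>\<Lambda> \<partial>PiM Q (\<lambda>_. \<Lambda>))"
      using bv by (intro P.product_nn_integral_insert[OF fQ _ meas]) auto
    also have "\<dots> = (\<integral>\<^sup>+x. ?p (?F Q) x * (\<integral>\<^sup>+z. ennreal (\<psi> (case_sum x y v) z) \<partial>\<Lambda>) \<partial>PiM Q (\<lambda>_. \<Lambda>))"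
      unfolding upd by (intro nn_integral_cong nn_integral_cmult psi1)
    also have "\<dots> \<le> (\<integral>\<^sup>+x. ?p (?F Q) x * C \<partial>PiM Q (\<lambda>_. \<Lambda>))"
      using C by (intro nn_integral_mono mult_left_mono) auto
    also have "\<dots> = edge_integral Q (?F Q) * C"
      unfolding edge_integral_def by (intro nn_integral_multc measurable_edge_prod) auto
    also have "\<dots> \<le> C ^ n * C" using IH by (rule mult_right_mono) simp
    finally have "edge_integral (insert b Q) (?F (insert b Q)) \<le> C ^ Suc n" by (simp add: mult.commute)
    moreover have "insert b Q \<subseteq> K" "card (insert b Q) = Suc n" using Q bv fQ by auto
    ultimately show ?case by blast
  qed
  from this[OF order_refl] obtain Q where Q: "Q \<subseteq> K" "card Q = card K"
      "edge_integral Q (F \<inter> edges_over (abstract_vertices Q m)) \<le> C ^ card K" by auto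
  have "Q = K" using K Q by (simp add: card_subset_eq)
  moreover have "F \<inter> edges_over (abstract_vertices K m) = F" using F by auto
  ultimately show ?thesis using Q by simp
qed

text \<open>Consider a copy with a vertex outside \<open>Q\<close>. If no vertex of this copy is in
  \<open>Q\<close>, an edge to an endpoint is used, which exists as m >= 1; otherwise connectedness
  of the inner graph gives an edge from the part in \<open>Q\<close> to the rest.\<close>

lemma glued_edges_grow:
  assumes m: "1 \<le> m" and \<rho>: "\<rho> \<in> nonflat_partitions R {1..r}" and Q: "Q \<subseteq> \<rho>" "Q \<noteq> \<rho>"
  shows "\<exists>b\<in>\<rho> - Q. \<exists>v\<in>abstract_vertices Q m. {Inl b, v} \<in> glued_edges r E R \<rho>"
proof -
  have part: "partition_on (R \<times> {1..r}) \<rho>" using \<rho> by (simp add: nonflat_partitions_def)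
  obtain b where b: "b \<in> \<rho>" "b \<notin> Q" using Q by blast
  have "b \<in> block \<rho> ` (R \<times> {1..r})"
    by (rule subsetD[OF equalityD1[OF partition_on_eq_block_image[OF part]] b(1)])
  then obtain k i where ki: "k \<in> R" "i \<in> {1..r}" "b = block \<rho> (k, i)" by auto
  define S where "S = {i\<in>{1..r}. block \<rho> (k, i) \<in> Q}"
  have in\<rho>: "block \<rho> (k, i) \<in> \<rho>" if "i \<in> {1..r}" for i
    using block_in(1)[OF part] ki that by auto
  have glued: "vertex_map r \<rho> k ` e \<in> glued_edges r E R \<rho>" if "k \<in> R" "e \<in> E" for k e
    unfolding glued_edges_def using that by blast
  show ?thesis
  proof (cases "S = {}")
    case True
    obtain i j where ij: "i \<in> {1..r}" "j \<in> {1..m}" "{r + j, i} \<in> E" using outer_edge_exists[OF m] .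
    have vi: "vertex_map r \<rho> k ` {r + j, i} = {Inl (block \<rho> (k, i)), Inr j}"
      using ij by (auto simp: vertex_map_def)
    have "i \<notin> S" using True by simp
    then have nQ: "block \<rho> (k, i) \<notin> Q" using ij(1) unfolding S_def by blast
    show ?thesis
    proof (rule bexI[of _ "block \<rho> (k, i)"], rule bexI[of _ "Inr j"])
      show "{Inl (block \<rho> (k, i)), Inr j} \<in> glued_edges r E R \<rho>"
        using glued[OF ki(1) ij(3)] unfolding vi .
      show "Inr j \<in> abstract_vertices Q m" using ij(2) by (simp add: abstract_vertices_def)
      show "block \<rho> (k, i) \<in> \<rho> - Q" using in\<rho>[OF ij(1)] nQ by simp
    qed
  next
    case False
    have "i \<notin> S" using b(2) unfolding S_def ki(3) by blast
    then have S: "S \<subseteq> {1..r}" "S \<noteq> {1..r}" using ki(2) unfolding S_def by blast+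
    obtain i j where ij: "i \<in> S" "j \<in> {1..r} - S" "{i, j} \<in> E" using inner_cut_edge[OF S(1) False S(2)] .
    have ir: "i \<in> {1..r}" "block \<rho> (k, i) \<in> Q" "j \<in> {1..r}" "block \<rho> (k, j) \<notin> Q"
      using ij(1,2) unfolding S_def by simp_all
    have vi: "vertex_map r \<rho> k ` {i, j} = {Inl (block \<rho> (k, j)), Inl (block \<rho> (k, i))}"
      using ir by (auto simp: vertex_map_def)
    show ?thesis
    proof (rule bexI[of _ "block \<rho> (k, j)"], rule bexI[of _ "Inl (block \<rho> (k, i))"])
      show "{Inl (block \<rho> (k, j)), Inl (block \<rho> (k, i))} \<in> glued_edges r E R \<rho>"
        using glued[OF ki(1) ij(3)] unfolding vi .
      show "Inl (block \<rho> (k, i)) \<in> abstract_vertices Q m" using ir by (simp add: abstract_vertices_def)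
      show "block \<rho> (k, j) \<in> \<rho> - Q" using in\<rho>[OF ir(3)] ir by simp
    qed
  qed
qed

end

section \<open>Vertices and edges of glued graphs\<close>

context endpoint_graph
begin

abbreviation "a \<equiv> max_endpoint_degree r m E"

lemma endpoint_degree_le: "i \<in> {1..r} \<Longrightarrow> card {j \<in> {r+1..r+m}. {i, j} \<in> E} \<le> a"
  unfolding max_endpoint_degree_def by (rule Max_ge) auto

lemma max_endpoint_degree_attained:
  obtains i where "i \<in> {1..r}" "card {j \<in> {r+1..r+m}. {i, j} \<in> E} = a"
proof -
  have "a \<in> (\<lambda>i. card {j \<in> {r+1..r+m}. {i, j} \<in> E}) ` {1..r}"
    unfolding max_endpoint_degree_def using r by (intro Max_in) auto
  then show thesis using that by auto
qed

lemma inj_on_endpoint_edge: "i \<in> {1..r} \<Longrightarrow> inj_on (\<lambda>j. {i, j}) {r+1..r+m}"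
  by (auto simp: inj_on_def doubleton_eq_iff)

text \<open>The \<open>a\<close> edges from one vertex to endpoints are not all of \<open>E\<close>:
  the inner graph is connected on at least two vertices and so has an edge. Hence the denominator
  e(G) - a of the threshold exponent is positive.\<close>

lemma max_endpoint_degree_less: "a < card E"
proof -
  obtain i where i: "i \<in> {1..r}" "card {j \<in> {r+1..r+m}. {i, j} \<in> E} = a"
    by (rule max_endpoint_degree_attained)
  have "(2::nat) \<in> {1..r}" using r by simp
  then have "{1::nat} \<subseteq> {1..r}" "{1::nat} \<noteq> {1..r}" by (force, metis One_nat_def numeral_2_eq_2 singletonD n_not_Suc_n)
  from connected_graph_cut[OF inner_connected this(1) _ this(2)]
  obtain u v where uv: "u \<in> {1}" "v \<in> {1..r} - {1}" "{u, v} \<in> E"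
    unfolding induced_edges_def by blast
  let ?D = "{j \<in> {r+1..r+m}. {i, j} \<in> E}"
  have "card ?D = card ((\<lambda>j. {i, j}) ` ?D)"
    by (rule card_image[symmetric], rule inj_on_subset[OF inj_on_endpoint_edge[OF i(1)]]) auto
  also have "\<dots> < card E"
  proof (rule psubset_card_mono[OF finite_E])
    have "{i, j} \<noteq> {u, v}" if "j \<in> ?D" for j
    proof
      assume "{i, j} = {u, v}"
      then have "j \<in> {u, v}" by blast
      then have "j \<le> r" using uv(1,2) r by auto
      then show False using that by simp
    qed
    then have "{u, v} \<notin> (\<lambda>j. {i, j}) ` ?D" by blast
    then show "(\<lambda>j. {i, j}) ` ?D \<subset> E" using uv(3) by blast
  qed
  finally show ?thesis using i by simp
qed

text \<open>The balance condition bounds the number of edges that a new copy of the graph shares with the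
  previous ones along the vertices in \<open>S\<close>; for a single vertex this is the definition of \<open>a\<close>.\<close>

lemma balanced_shared_edges:
  assumes bal: "balanced r m E" and S: "S \<subseteq> {1..r}" "S \<noteq> {}"
    and F: "F \<subseteq> E" "\<And>e. e \<in> F \<Longrightarrow> e \<subseteq> S \<union> {r+1..r+m}"
  shows "(real (card F) - real a) * (real r - 1) \<le> (real (card S) - 1) * (real (card E) - real a)"
proof -
  have fS: "finite S" using S finite_subset by blast
  then have "card S \<noteq> 0" using S by simp
  then consider "card S = 1" | "card S \<ge> 2" by linarith
  then show ?thesis
  proof cases
    case 1
    then obtain i where i: "S = {i}" by (auto simp: card_1_singleton_iff)
    \<comment> \<open>For a single shared vertex the right-hand side is 0, and the claim amounts to
      \<open>card F\<close> being at most \<open>a\<close>: all edges of \<open>F\<close> join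
      \<open>i\<close> to an endpoint.\<close>
    let ?D = "{j \<in> {r+1..r+m}. {i, j} \<in> E}"
    have "F \<subseteq> (\<lambda>j. {i, j}) ` ?D"
    proof
      fix e assume e: "e \<in> F"
      then have eE: "e \<in> E" using F by blast
      have es: "e \<subseteq> {i} \<union> {r+1..r+m}" using F(2)[OF e] i by simp
      show "e \<in> (\<lambda>j. {i, j}) ` ?D"
      proof (cases rule: edge_cases[OF eE])
        case (1 u v)
        then show ?thesis using es by auto
      next
        case (2 u v)
        then have ui: "u = i" using es by auto
        have "e = {i, r + v}" using 2 ui by (simp add: insert_commute)
        moreover have "r + v \<in> {r+1..r+m}" using 2 by simp
        ultimately show ?thesis using eE by blast
      qed
    qed
    then have "card F \<le> card ((\<lambda>j. {i, j}) ` ?D)" by (intro card_mono) auto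
    also have "\<dots> \<le> card ?D" by (rule card_image_le) simp
    also have "\<dots> \<le> a" using S i by (intro endpoint_degree_le) auto
    finally have "(real (card F) - real a) * (real r - 1) \<le> 0"
      using r by (intro mult_nonpos_nonneg) auto
    then show ?thesis using 1 by simp
  next
    case 2
    \<comment> \<open>All endpoints are put into the subgraph, adjacent to \<open>S\<close> or not,
      so that v(H) - m - 1 becomes exactly \<open>card S - 1\<close> and v(H) is at least m +
      2.\<close>
    let ?W = "S \<union> {r+1..r+m}"
    have "simple_graph ?W F"
      unfolding simple_graph_def
    proof
      show "finite ?W" using fS by simp
      show "F \<subseteq> {{u, v} |u v. u \<in> ?W \<and> v \<in> ?W \<and> u \<noteq> v}"
      proof
        fix e assume e: "e \<in> F"
        then obtain u v where uv: "e = {u, v}" "u \<noteq> v" using F E_edges_over by (auto simp: edges_over_def)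
        then show "e \<in> {{u, v} |u v. u \<in> ?W \<and> v \<in> ?W \<and> u \<noteq> v}" using F(2)[OF e] by blast
      qed
    qed
    moreover have "?W \<subseteq> {1..r+m}" using S by auto
    ultimately have sub: "subgraph_of ?W F {1..r+m} E" using F by (simp add: subgraph_of_def)
    have "S \<inter> {r+1..r+m} = {}" using S by auto
    then have cW: "card ?W = card S + m" using fS by (simp add: card_Un_disjoint)
    have "(real (card F) - real a) / (real (card ?W) - real m - 1) \<le> (real (card E) - real a) / (real r - 1)"
      using bal[unfolded balanced_def, rule_format, OF sub] cW 2 by linarith
    then have "(real (card F) - real a) / (real (card S) - 1) \<le> (real (card E) - real a) / (real r - 1)"
      unfolding cW by simp
    then show ?thesis using 2 r by (simp add: field_simps)
  qed
qed

text \<open>The contribution of a new copy sharing \<open>t\<close> vertices and \<open>f\<close>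
  edges is compared with \<open>B\<close> to the power q = (r - t)/(r - 1). The powers of
  \<open>l\<close> agree exactly; the balance inequality says that the exponent of \<open>c\<close>
  is at least that in \<open>B\<close> to the power q, and \<open>c\<close> is below 1. As q lies in
  [0, 1], the result is at most \<open>max 1 B\<close>.\<close>

lemma shared_edges_weight:
  fixes l c :: real
  assumes l: "0 < l" and c: "0 < c" "c < 1"
    and t: "1 \<le> t" "t \<le> r" and f: "f \<le> card E"
    and ineq: "(real f - real a) * (real r - 1) \<le> (real t - 1) * (real (card E) - real a)"
  shows "l ^ (r - t) * c ^ (card E - f) \<le> max 1 (l ^ (r - 1) * c ^ (card E - a))"
proof -
  let ?B = "l ^ (r - 1) * c ^ (card E - a)"
  define q where "q = (real r - real t) / (real r - 1)"
  have q: "0 \<le> q" "q \<le> 1" using t r by (auto simp: q_def field_simps)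
  have r1: "real r - 1 > 0" using r by simp
  have ae: "a \<le> card E" using max_endpoint_degree_less by simp
  have B0: "0 < ?B" using l c by simp
  have eq1: "(real (card E) - real a) * q \<le> real (card E) - real f"
  proof -
    have "q * (real r - 1) = real r - real t" using r1 by (simp add: q_def)
    then have "(real (card E) - real a) * q * (real r - 1) = (real (card E) - real a) * (real r - real t)"
      by (simp only: mult.assoc)
    also have "\<dots> \<le> (real (card E) - real f) * (real r - 1)"
      using ineq by (simp add: algebra_simps)
    finally have "(real (card E) - real a) * q * (real r - 1) \<le> (real (card E) - real f) * (real r - 1)" .
    then show ?thesis using r1 by simp
  qed
  have "l ^ (r - t) = l powr (real (r - 1) * q)"
    using l t r by (simp add: powr_realpow[symmetric] q_def of_nat_diff)
  moreover have "c ^ (card E - f) \<le> c powr (real (card E - a) * q)"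
    using c f ae eq1 by (subst powr_realpow[symmetric]) (auto simp: of_nat_diff intro: powr_mono')
  ultimately have "l ^ (r - t) * c ^ (card E - f) \<le> l powr (real (r - 1) * q) * c powr (real (card E - a) * q)"
    using l c by (intro mult_mono) auto
  also have "\<dots> = ?B powr q"
    using l c by (simp add: powr_mult powr_powr flip: powr_realpow)
  also have "\<dots> \<le> max 1 ?B"
  proof (cases "1 \<le> ?B")
    case True
    then have "?B powr q \<le> ?B powr 1" using q by (intro powr_mono) auto
    then have "?B powr q \<le> ?B" using B0 by simp
    then show ?thesis by (rule max.coboundedI2)
  next
    case False
    then show ?thesis using q B0 by (intro max.coboundedI1 powr_le1) auto
  qed
  finally show ?thesis .
qed

lemma glued_edges_insert: "glued_edges r E (insert k T) \<rho> = glued_edges r E T \<rho> \<union> (\<lambda>e. vertex_map r \<rho> k ` e) ` E"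
  by (auto simp: glued_edges_def)

lemma inj_on_vertex_map_image:
  assumes "\<rho> \<in> nonflat_partitions R {1..r}" "k \<in> R"
  shows "inj_on (\<lambda>e. vertex_map r \<rho> k ` e) E"
proof (rule inj_onI)
  fix e f assume "e \<in> E" "f \<in> E" and eq: "vertex_map r \<rho> k ` e = vertex_map r \<rho> k ` f"
  then have "e \<subseteq> {1..r+m}" "f \<subseteq> {1..r+m}" using E_edges_over by (auto simp: edges_over_def)
  then show "e = f" using eq by (simp add: inj_on_image_eq_iff[OF vertex_map_inj[OF assms]])
qed

lemma inj_on_block:
  assumes "\<rho> \<in> nonflat_partitions R {1..r}" "k \<in> R"
  shows "inj_on (\<lambda>i. block \<rho> (k, i)) {1..r}"
proof (rule inj_onI)
  fix i j assume ij: "i \<in> {1..r}" "j \<in> {1..r}" "block \<rho> (k, i) = block \<rho> (k, j)"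
  then have "vertex_map r \<rho> k i = vertex_map r \<rho> k j" by (simp add: vertex_map_def)
  then show "i = j" using inj_onD[OF vertex_map_inj[OF assms]] ij by auto
qed

text \<open>Rows are added one after the other, each of them sharing a block with the previous ones.\<close>

lemma glued_weight_bound:
  fixes l c :: real
  assumes bal: "balanced r m E" and l: "0 < l" and c: "0 < c" "c < 1"
    and R: "finite R" "R \<noteq> {}" and \<rho>: "\<rho> \<in> nonflat_partitions R {1..r}" and conn: "row_connected R \<rho>"
  shows "l ^ card \<rho> * c ^ card (glued_edges r E R \<rho>)
    \<le> l ^ r * c ^ card E * max 1 (l ^ (r - 1) * c ^ (card E - a)) ^ (card R - 1)"
proof -
  have part: "partition_on (R \<times> {1..r}) \<rho>" using \<rho> by (simp add: nonflat_partitions_def)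
  define VV where "VV = (\<lambda>T. block \<rho> ` (T \<times> {1..r}))"
  let ?M = "max 1 (l ^ (r - 1) * c ^ (card E - a))"
  have VVR: "VV R = \<rho>" unfolding VV_def using partition_on_eq_block_image[OF part] by (rule sym)
  have VVins: "VV (insert k T) = VV T \<union> (\<lambda>i. block \<rho> (k, i)) ` {1..r}" for k T
    by (auto simp: VV_def)
  \<comment> \<open>\<open>VV T\<close> is the set of blocks met by the rows in \<open>T\<close>.
    The first row contributes the full weight of a graph, and each of the \<open>n\<close> others at
    most the factor \<open>?M\<close>.\<close>
  have "\<exists>T\<subseteq>R. card T = Suc n \<and> l ^ card (VV T) * c ^ card (glued_edges r E T \<rho>) \<le> l ^ r * c ^ card E * ?M ^ n"
    if "Suc n \<le> card R" for n
    using that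
  proof (induction n)
    case 0
    obtain k where k: "k \<in> R" using R by blast
    have "VV {k} = (\<lambda>i. block \<rho> (k, i)) ` {1..r}" using VVins[of k "{}"] by (simp add: VV_def)
    then have "card (VV {k}) = r" using card_image[OF inj_on_block[OF \<rho> k]] by simp
    moreover have "card (glued_edges r E {k} \<rho>) = card E"
      using card_image[OF inj_on_vertex_map_image[OF \<rho> k]] by (simp add: glued_edges_def)
    ultimately show ?case using k by (intro exI[of _ "{k}"]) simp
  next
    case (Suc n)
    then obtain T where T: "T \<subseteq> R" "card T = Suc n"
      and IH: "l ^ card (VV T) * c ^ card (glued_edges r E T \<rho>) \<le> l ^ r * c ^ card E * ?M ^ n" by auto
    have fT: "finite T" using T R finite_subset by blast
    have T0: "T \<noteq> {}" using T(2) by (metis card.empty nat.distinct(1))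
    have TR: "T \<noteq> R" using T(2) Suc.prems by (metis Suc_n_not_le_n)
    \<comment> \<open>A block crossing from \<open>T\<close> to its complement yields the next row
      \<open>k\<close>, which thus has a vertex already present.\<close>
    from conn[unfolded row_connected_def, rule_format, OF T(1) T0 TR]
    obtain b where b: "b \<in> \<rho>" "fst ` b \<inter> T \<noteq> {}" "fst ` b - T \<noteq> {}" by (elim bexE conjE)
    from b(2,3) obtain z w where zw: "z \<in> b" "fst z \<in> T" "w \<in> b" "fst w \<notin> T" by blast
    have bR: "b \<subseteq> R \<times> {1..r}" by (rule nonflat_partitions_rows(1)[OF \<rho> b(1)])
    define k where "k = fst w"
    have k: "k \<in> R" "k \<notin> T" using zw bR by (auto simp: k_def)
    define S where "S = {i\<in>{1..r}. block \<rho> (k, i) \<in> VV T}"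
    have bzw: "block \<rho> z = b" "block \<rho> w = b"
      using block_eq[OF part b(1) zw(1)] block_eq[OF part b(1) zw(3)] by this
    have w: "z \<in> T \<times> {1..r}" "snd w \<in> {1..r}" "w = (k, snd w)"
      using subsetD[OF bR zw(1)] subsetD[OF bR zw(3)] zw(2) by (auto simp: k_def mem_Times_iff)
    have "block \<rho> z \<in> VV T" unfolding VV_def using w(1) by (rule imageI)
    then have "block \<rho> (k, snd w) \<in> VV T" unfolding w(3)[symmetric] bzw .
    then have "snd w \<in> S" unfolding S_def using w(2) by blast
    then have S: "S \<subseteq> {1..r}" "S \<noteq> {}" by (auto simp: S_def)
    have fS: "finite S" using S finite_subset by blast
    have cS: "1 \<le> card S" "card S \<le> r"
    proof -
      show "1 \<le> card S" using S fS by (simp add: Suc_le_eq card_gt_0_iff)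
      show "card S \<le> r" using card_mono[OF _ S(1)] by simp
    qed
    \<comment> \<open>The edges of the new copy that are already present. Their vertices are in
      \<open>S\<close> or are endpoints, so the balance condition applies, and the copy adds exactly
      r - |S| blocks and e(G) - |F| edges.\<close>
    define F where "F = {e\<in>E. vertex_map r \<rho> k ` e \<in> glued_edges r E T \<rho>}"
    have FS: "e \<subseteq> S \<union> {r+1..r+m}" if e: "e \<in> F" for e
    proof
      fix v assume v: "v \<in> e"
      have eE: "e \<in> E" using e by (simp add: F_def)
      then have vr: "v \<in> {1..r+m}" using v E_edges_over by (auto simp: edges_over_def)
      show "v \<in> S \<union> {r+1..r+m}"
      proof (cases "v \<le> r")
        case True
        have "vertex_map r \<rho> k ` e \<in> glued_edges r E T \<rho>" using e by (simp add: F_def)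
        then obtain k' e' where ke: "k' \<in> T" "e' \<in> E" "vertex_map r \<rho> k ` e = vertex_map r \<rho> k' ` e'"
          unfolding glued_edges_def by blast
        have "vertex_map r \<rho> k v \<in> vertex_map r \<rho> k' ` e'" using ke(3) v by blast
        then obtain v' where v': "v' \<in> e'" "vertex_map r \<rho> k v = vertex_map r \<rho> k' v'" by blast
        then have "v' \<le> r" "block \<rho> (k, v) = block \<rho> (k', v')"
          using True by (auto simp: vertex_map_def split: if_splits)
        moreover have "v' \<in> {1..r+m}" using v' ke(2) E_edges_over by (auto simp: edges_over_def)
        ultimately have "block \<rho> (k, v) \<in> VV T" using ke(1) by (auto simp: VV_def)
        then show ?thesis using True vr by (simp add: S_def)
      next
        case False
        then show ?thesis using vr by simp
      qed
    qed
    have FE: "F \<subseteq> E" by (auto simp: F_def)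
    have fF: "finite F" "card F \<le> card E" using finite_subset[OF FE finite_E] card_mono[OF finite_E FE] by auto
    have "VV (insert k T) = VV T \<union> (\<lambda>i. block \<rho> (k, i)) ` ({1..r} - S)"
      unfolding VVins by (auto simp: S_def)
    moreover have "VV T \<inter> (\<lambda>i. block \<rho> (k, i)) ` ({1..r} - S) = {}" by (auto simp: S_def)
    moreover have "finite (VV T)" using fT by (simp add: VV_def)
    moreover have "card ((\<lambda>i. block \<rho> (k, i)) ` ({1..r} - S)) = r - card S"
      using inj_on_subset[OF inj_on_block[OF \<rho> k(1)], of "{1..r} - S"] S fS
      by (simp add: card_image card_Diff_subset)
    ultimately have c1: "card (VV (insert k T)) = card (VV T) + (r - card S)"
      by (simp add: card_Un_disjoint)
    let ?g = "\<lambda>e. vertex_map r \<rho> k ` e"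
    have "glued_edges r E (insert k T) \<rho> = glued_edges r E T \<rho> \<union> ?g ` (E - F)"
      unfolding glued_edges_insert by (auto simp: F_def)
    moreover have "glued_edges r E T \<rho> \<inter> ?g ` (E - F) = {}" by (auto simp: F_def)
    moreover have "card (?g ` (E - F)) = card E - card F"
      using inj_on_subset[OF inj_on_vertex_map_image[OF \<rho> k(1)], of "E - F"] FE fF
      by (simp add: card_image card_Diff_subset)
    ultimately have c2: "card (glued_edges r E (insert k T) \<rho>) = card (glued_edges r E T \<rho>) + (card E - card F)"
      using finite_glued_edges[OF fT] finite_E by (simp add: card_Un_disjoint)
    have "l ^ card (VV (insert k T)) * c ^ card (glued_edges r E (insert k T) \<rho>)
      = (l ^ card (VV T) * c ^ card (glued_edges r E T \<rho>)) * (l ^ (r - card S) * c ^ (card E - card F))"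
      unfolding c1 c2 by (simp add: power_add mult_ac)
    also have "\<dots> \<le> (l ^ r * c ^ card E * ?M ^ n) * ?M"
    proof (rule mult_mono[OF IH])
      show "l ^ (r - card S) * c ^ (card E - card F) \<le> ?M"
        by (rule shared_edges_weight[OF l c cS fF(2) balanced_shared_edges[OF bal S FE FS]])
    qed (use l c in auto)
    finally have "l ^ card (VV (insert k T)) * c ^ card (glued_edges r E (insert k T) \<rho>)
      \<le> l ^ r * c ^ card E * ?M ^ Suc n" by (simp add: mult_ac)
    moreover have "insert k T \<subseteq> R" "card (insert k T) = Suc (Suc n)" using T k fT by auto
    ultimately show ?case by blast
  qed
  note growth = this
  have "Suc (card R - 1) = card R" using R by (simp add: card_gt_0_iff)
  with growth[of "card R - 1"] obtain T where T: "T \<subseteq> R" "card T = card R"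
    "l ^ card (VV T) * c ^ card (glued_edges r E T \<rho>) \<le> l ^ r * c ^ card E * ?M ^ (card R - 1)"
    by auto
  have "T = R" using R T by (simp add: card_subset_eq)
  then show ?thesis using T(3) unfolding VVR by (simp only: VVR)
qed

end

section \<open>Two copies sharing a set of vertices\<close>

text \<open>Renaming coordinates along an injection transports one product measure to the other, as
  is seen on rectangles.\<close>

lemma nn_integral_PiM_reindex:
  fixes f :: "'k \<Rightarrow> 'j"
  assumes \<Lambda>: "sigma_finite_measure \<Lambda>" and K: "finite K" "inj_on f K"
    and G: "G \<in> borel_measurable (PiM K (\<lambda>_. \<Lambda>))"
  shows "(\<integral>\<^sup>+x. G (\<lambda>k\<in>K. x (f k)) \<partial>PiM (f ` K) (\<lambda>_. \<Lambda>)) = (\<integral>\<^sup>+z. G z \<partial>PiM K (\<lambda>_. \<Lambda>))"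
proof -
  interpret P: product_sigma_finite "\<lambda>_::'k. \<Lambda>" using \<Lambda> by (simp add: product_sigma_finite_def)
  interpret Q: product_sigma_finite "\<lambda>_::'j. \<Lambda>" using \<Lambda> by (simp add: product_sigma_finite_def)
  let ?T = "\<lambda>x. \<lambda>k\<in>K. x (f k)"
  have T: "?T \<in> measurable (PiM (f ` K) (\<lambda>_. \<Lambda>)) (PiM K (\<lambda>_. \<Lambda>))"
    by (intro measurable_restrict measurable_component_singleton) auto
  have "distr (PiM (f ` K) (\<lambda>_. \<Lambda>)) (PiM K (\<lambda>_. \<Lambda>)) ?T = PiM K (\<lambda>_. \<Lambda>)"
  proof (rule P.PiM_eqI[OF K(1)])
    fix A assume A: "\<And>k. k \<in> K \<Longrightarrow> A k \<in> sets \<Lambda>"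
    have sp: "A k \<subseteq> space \<Lambda>" if "k \<in> K" for k using A[OF that] by (rule sets.sets_into_space)
    have inv: "inv_into K f (f k) = k" if "k \<in> K" for k using K(2) that by (rule inv_into_f_f)
    have pre: "?T -` PiE K A \<inter> space (PiM (f ` K) (\<lambda>_. \<Lambda>)) = PiE (f ` K) (\<lambda>j. A (inv_into K f j))"
    proof
      show "?T -` PiE K A \<inter> space (PiM (f ` K) (\<lambda>_. \<Lambda>)) \<subseteq> PiE (f ` K) (\<lambda>j. A (inv_into K f j))"
        by (auto simp: space_PiM PiE_iff inv)
      show "PiE (f ` K) (\<lambda>j. A (inv_into K f j)) \<subseteq> ?T -` PiE K A \<inter> space (PiM (f ` K) (\<lambda>_. \<Lambda>))"
        using subsetD[OF sp] by (auto simp: space_PiM PiE_iff inv)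
    qed
    have "emeasure (distr (PiM (f ` K) (\<lambda>_. \<Lambda>)) (PiM K (\<lambda>_. \<Lambda>)) ?T) (PiE K A)
      = emeasure (PiM (f ` K) (\<lambda>_. \<Lambda>)) (PiE (f ` K) (\<lambda>j. A (inv_into K f j)))"
      using A K by (subst emeasure_distr[OF T]) (auto simp: pre intro: sets_PiM_I_finite)
    also have "\<dots> = (\<Prod>j\<in>f ` K. emeasure \<Lambda> (A (inv_into K f j)))"
      using A K by (intro Q.emeasure_PiM) (auto simp: inv)
    also have "\<dots> = (\<Prod>k\<in>K. emeasure \<Lambda> (A k))"
      by (simp add: prod.reindex[OF K(2)] inv)
    finally show "emeasure (distr (PiM (f ` K) (\<lambda>_. \<Lambda>)) (PiM K (\<lambda>_. \<Lambda>)) ?T) (PiE K A) = (\<Prod>k\<in>K. emeasure \<Lambda> (A k))" .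
  qed simp
  then show ?thesis using nn_integral_distr[OF T, of G] G by simp
qed

context endpoint_graph
begin

text \<open>Two copies glued along the vertices in \<open>S\<close>. The cases
  \<open>S = {1..r}\<close>, where the copies coincide, and \<open>S = {i}\<close> give the two
  competing lower bounds for the variance.\<close>

definition two_row :: "nat set \<Rightarrow> (nat \<times> nat) set set" where
  "two_row S = (\<lambda>i. {1..2} \<times> {i}) ` S \<union> (\<Union>k\<in>{1..2}. (\<lambda>i. {(k, i)}) ` ({1..r} - S))"

lemma rows_eq: "{1..2::nat} = {1, 2}" by auto

lemma two_row_disjoint:
  "{1..2::nat} \<times> {i::nat} \<noteq> {(k, j)}"
proof
  assume "{1..2::nat} \<times> {i} = {(k, j)}"
  then have "(1, i) = (k, j)" "(2, i) = (k, j)" by (auto simp: rows_eq)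
  then show False by simp
qed

lemma two_row_inj:
  assumes "{1..2::nat} \<times> {i::nat} = {1..2} \<times> {j}"
  shows "i = j"
proof -
  have "(1, i) \<in> {1..2::nat} \<times> {i}" by simp
  then have "(1, i) \<in> {1..2::nat} \<times> {j}" by (simp only: assms)
  then show ?thesis by simp
qed

lemma two_row_partition:
  assumes "S \<subseteq> {1..r}"
  shows "partition_on ({1..2} \<times> {1..r}) (two_row S)"
proof (rule partition_onI)
  show "\<Union> (two_row S) = {1..2} \<times> {1..r}" using assms unfolding two_row_def by fastforce
  have "b \<noteq> {}" if "b \<in> two_row S" for b
  proof -
    from that consider i where "b = {1..2} \<times> {i}" | k i where "b = {(k, i)}"
      unfolding two_row_def by blast
    then show ?thesis by cases auto
  qed
  then show "{} \<notin> two_row S" by blast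
  show "disjnt p q" if "p \<in> two_row S" "q \<in> two_row S" "p \<noteq> q" for p q
  proof -
    have block: "b = (if snd z \<in> S then {1..2} \<times> {snd z} else {z})" if b: "b \<in> two_row S" "z \<in> b" for b z
    proof -
      from b(1) consider i where "i \<in> S" "b = {1..2} \<times> {i}" | k i where "i \<in> {1..r} - S" "b = {(k, i)}"
        unfolding two_row_def by blast
      then show ?thesis using b(2) by cases auto
    qed
    have False if "z \<in> p" "z \<in> q" for z
      using block[OF \<open>p \<in> two_row S\<close> that(1)] block[OF \<open>q \<in> two_row S\<close> that(2)] \<open>p \<noteq> q\<close> by (simp only: simp_thms)
    then show ?thesis by (auto simp: disjnt_def)
  qed
qed

lemma two_row_nonflat:
  assumes "S \<subseteq> {1..r}"
  shows "two_row S \<in> nonflat_partitions {1..2} {1..r}"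
  using two_row_partition[OF assms]
  by (auto simp: nonflat_partitions_def two_row_def inj_on_def)

lemma two_row_block:
  assumes S: "S \<subseteq> {1..r}" and k: "k \<in> {1..2}" and i: "i \<in> {1..r}"
  shows "block (two_row S) (k, i) = (if i \<in> S then {1..2} \<times> {i} else {(k, i)})"
proof (rule block_eq[OF two_row_partition[OF S]])
  show "(if i \<in> S then {1..2} \<times> {i} else {(k, i)}) \<in> two_row S"
    using k i unfolding two_row_def by (cases "i \<in> S") (simp_all only: if_True if_False, blast+)
  show "(k, i) \<in> (if i \<in> S then {1..2} \<times> {i} else {(k, i)})" using k by auto
qed

lemma two_row_card:
  assumes S: "S \<subseteq> {1..r}"
  shows "card (two_row S) = 2 * r - card S"
proof -
  have fS: "finite S" using S finite_subset by blast
  let ?T = "{1..r} - S"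
  have T: "card ?T = r - card S" using S fS by (simp add: card_Diff_subset)
  have U: "(\<Union>k\<in>{1..2}. (\<lambda>i. {(k, i)}) ` ?T) = (\<lambda>z. {z}) ` ({1..2::nat} \<times> ?T)" by auto
  have "card (\<Union>k\<in>{1..2::nat}. (\<lambda>i. {(k, i)}) ` ?T) = card ({1..2::nat} \<times> ?T)"
    unfolding U by (rule card_image) simp
  also have "\<dots> = 2 * (r - card S)" by (simp only: card_cartesian_product T) simp
  finally have c2: "card (\<Union>k\<in>{1..2::nat}. (\<lambda>i. {(k, i)}) ` ?T) = 2 * (r - card S)" .
  have c1: "card ((\<lambda>i. {1..2::nat} \<times> {i}) ` S) = card S"
    by (rule card_image, rule inj_onI) (rule two_row_inj)
  have "(\<lambda>i. {1..2::nat} \<times> {i}) ` S \<inter> (\<Union>k\<in>{1..2}. (\<lambda>i. {(k, i)}) ` ?T) = {}"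
    using two_row_disjoint by blast
  note disj = this
  have "finite (\<Union>k\<in>{1..2::nat}. (\<lambda>i. {(k, i)}) ` ?T)" by blast
  from card_Un_disjoint[OF finite_imageI[OF fS] this disj]
  have "card (two_row S) = card S + 2 * (r - card S)"
    unfolding two_row_def c1 c2 .
  moreover have "card S \<le> r" using card_mono[OF _ S] by simp
  ultimately show ?thesis by simp
qed

lemma two_row_connected:
  assumes "S \<noteq> {}"
  shows "row_connected {1..2} (two_row S)"
  unfolding row_connected_def
proof (intro allI impI)
  fix T :: "nat set" assume T: "T \<subseteq> {1..2}" "T \<noteq> {}" "T \<noteq> {1..2}"
  obtain i where "i \<in> S" using assms by blast
  then have "{1..2} \<times> {i} \<in> two_row S" by (auto simp: two_row_def)
  moreover have "fst ` ({1..2::nat} \<times> {i}) = {1..2}" by simp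
  ultimately show "\<exists>b\<in>two_row S. fst ` b \<inter> T \<noteq> {} \<and> fst ` b - T \<noteq> {}"
    using T by (intro bexI[of _ "{1..2} \<times> {i}"]) auto
qed

text \<open>Both copies send an edge spanned by \<open>S\<close> and the endpoints to the same glued
  edge. An upper bound on the number of edges is the direction needed to bound the weight from
  below, because \<open>c\<close> is below 1.\<close>

lemma two_row_card_glued:
  assumes S: "S \<subseteq> {1..r}"
  shows "card (glued_edges r E {1..2} (two_row S)) \<le> 2 * card E - card {e\<in>E. e \<subseteq> S \<union> {r+1..r+m}}"
proof -
  let ?F = "{e\<in>E. e \<subseteq> S \<union> {r+1..r+m}}" and ?g = "\<lambda>k e. vertex_map r (two_row S) k ` e"
  have eq: "?g 1 e = ?g 2 e" if "e \<in> ?F" for e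
  proof (rule image_cong[OF refl])
    fix v assume "v \<in> e"
    then have v: "v \<in> S \<or> v > r" using that by auto
    show "vertex_map r (two_row S) 1 v = vertex_map r (two_row S) 2 v"
    proof (cases "v \<le> r")
      case True
      then have "v \<in> S" "v \<in> {1..r}" using v S by auto
      then show ?thesis by (simp add: vertex_map_def two_row_block[OF S])
    qed (simp add: vertex_map_def)
  qed
  have "glued_edges r E {1..2} (two_row S) = ?g 1 ` E \<union> ?g 2 ` E"
    unfolding glued_edges_def rows_eq by simp
  also have "\<dots> \<subseteq> ?g 1 ` E \<union> ?g 2 ` (E - ?F)"
  proof (rule Un_least[OF Un_upper1 image_subsetI])
    fix e assume e: "e \<in> E"
    show "?g 2 e \<in> ?g 1 ` E \<union> ?g 2 ` (E - ?F)"
    proof (cases "e \<in> ?F")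
      case True
      show ?thesis unfolding eq[OF True, symmetric] using e by (intro UnI1 imageI)
    next
      case False
      then show ?thesis using e by (intro UnI2 imageI) simp
    qed
  qed
  finally have "card (glued_edges r E {1..2} (two_row S)) \<le> card (?g 1 ` E \<union> ?g 2 ` (E - ?F))"
    using finite_E by (intro card_mono) auto
  also have "\<dots> \<le> card (?g 1 ` E) + card (?g 2 ` (E - ?F))" by (rule card_Un_le)
  also have "\<dots> \<le> card E + card (E - ?F)"
    using finite_E by (intro add_mono card_image_le) auto
  also have "\<dots> = 2 * card E - card ?F"
    using finite_E card_mono[OF finite_E, of ?F] by (simp add: card_Diff_subset)
  finally show ?thesis .
qed

end

section \<open>Positivity of the integrals for two copies\<close>

context glued_integrals
begin

definition row_weight :: "(nat \<Rightarrow> 'a) \<Rightarrow> ennreal" where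
  "row_weight z = (\<Prod>e\<in>E. ennreal (edge_weight \<psi> (\<lambda>v. if v \<le> r then z v else y (v - r)) e))"

text \<open>The expected count without its factor \<open>l ^ r * c ^ card E\<close>. Whether it
  vanishes separates the degenerate case from the general one.\<close>

definition row_integral :: ennreal where
  "row_integral = (\<integral>\<^sup>+z. row_weight z \<partial>PiM {1..r} (\<lambda>_. \<Lambda>))"

lemma row_weight_cong:
  assumes "\<And>i. i \<in> {1..r} \<Longrightarrow> z i = z' i"
  shows "row_weight z = row_weight z'"
  unfolding row_weight_def
proof (intro prod.cong refl arg_cong[where f=ennreal])
  fix e assume "e \<in> E"
  then have "e \<in> edges_over {1..r+m}" using E_edges_over by blast
  then show "edge_weight \<psi> (\<lambda>v. if v \<le> r then z v else y (v - r)) e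
    = edge_weight \<psi> (\<lambda>v. if v \<le> r then z' v else y (v - r)) e"
    by (rule edge_weight_cong[OF psi_sym]) (use assms in simp)
qed

lemma measurable_row_weight:
  assumes "\<And>i. i \<in> {1..r} \<Longrightarrow> (\<lambda>x. z x i) \<in> borel_measurable N"
  shows "(\<lambda>x. row_weight (z x)) \<in> borel_measurable N"
  unfolding row_weight_def
proof (intro borel_measurable_prod_ennreal measurable_compose[OF _ measurable_ennreal])
  fix e assume "e \<in> E"
  then have e: "e \<in> edges_over {1..r+m}" using E_edges_over by blast
  show "(\<lambda>x. edge_weight \<psi> (\<lambda>v. if v \<le> r then z x v else y (v - r)) e) \<in> borel_measurable N"
  proof (rule borel_measurable_edge_weight[OF e])
    fix v assume "v \<in> {1..r+m}"
    then show "(\<lambda>x. if v \<le> r then z x v else y (v - r)) \<in> borel_measurable N"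
      using assms[of v] by (cases "v \<le> r") auto
  qed
qed

lemma component_measurable:
  assumes "k \<in> K"
  shows "(\<lambda>x. x k) \<in> borel_measurable (PiM K (\<lambda>_. \<Lambda>))"
  using measurable_component_singleton[OF assms, of "\<lambda>_. \<Lambda>"] sets_Lam
  by (simp cong: measurable_cong_sets)

lemma glued_row_weight:
  assumes "\<rho> \<in> nonflat_partitions R {1..r}" "k \<in> R"
  shows "(\<Prod>e\<in>(\<lambda>e. vertex_map r \<rho> k ` e) ` E. ennreal (edge_weight \<psi> (case_sum x y) e))
    = row_weight (\<lambda>i. x (block \<rho> (k, i)))"
proof -
  have z: "case_sum x y \<circ> vertex_map r \<rho> k = (\<lambda>v. if v \<le> r then x (block \<rho> (k, v)) else y (v - r))"
    by (auto simp: vertex_map_def)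
  have "edge_weight \<psi> (case_sum x y) (vertex_map r \<rho> k ` e)
    = edge_weight \<psi> (\<lambda>v. if v \<le> r then x (block \<rho> (k, v)) else y (v - r)) e" if "e \<in> E" for e
    using edge_weight_image[OF psi_sym subsetD[OF E_edges_over that], where z = "case_sum x y" and f = "vertex_map r \<rho> k"]
    unfolding z .
  then show ?thesis
    unfolding row_weight_def by (subst prod.reindex[OF inj_on_vertex_map_image[OF assms]]) simp
qed

text \<open>With one row nothing is glued, and the blocks are a renaming of the vertices
  \<open>1..r\<close>.\<close>

lemma edge_integral_single_row:
  assumes \<rho>: "\<rho> \<in> nonflat_partitions {k} {1..r}"
  shows "edge_integral \<rho> (glued_edges r E {k} \<rho>) = row_integral"
proof -
  have part: "partition_on ({k} \<times> {1..r}) \<rho>" using \<rho> by (simp add: nonflat_partitions_def)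
  let ?b = "\<lambda>i. block \<rho> (k, i)"
  have "block \<rho> ` ({k} \<times> {1..r}) = ?b ` {1..r}" by auto
  then have im: "\<rho> = ?b ` {1..r}" using partition_on_eq_block_image[OF part] by (rule trans[rotated])
  have "edge_integral \<rho> (glued_edges r E {k} \<rho>) = (\<integral>\<^sup>+x. row_weight (\<lambda>i. x (?b i)) \<partial>PiM \<rho> (\<lambda>_. \<Lambda>))"
    unfolding edge_integral_def glued_edges_def using glued_row_weight[OF \<rho>, of k] by simp
  also have "\<dots> = (\<integral>\<^sup>+x. row_weight (\<lambda>i\<in>{1..r}. x (?b i)) \<partial>PiM (?b ` {1..r}) (\<lambda>_. \<Lambda>))"
    unfolding im[symmetric] by (intro nn_integral_cong row_weight_cong) simp
  also have "\<dots> = row_integral"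
    unfolding row_integral_def
    by (rule nn_integral_PiM_reindex[OF sigma_finite_Lam _ inj_on_block[OF \<rho>]])
      (rule finite_atLeastAtMost, rule singletonI, rule measurable_row_weight[where z="\<lambda>x. x"], rule component_measurable)
  finally show ?thesis .
qed

text \<open>Counting the common edges twice only decreases the integrand, so the integral is at
  least that of the product of two row weights. Given the positions \<open>u\<close> of the shared
  vertices the two remaining integrals are equal, whence the lower bound is the integral of
  \<open>H u ^ 2\<close>. It cannot vanish, since the integral of \<open>H\<close> is
  \<open>row_integral\<close>.\<close>

lemma edge_integral_two_row_pos:
  assumes S: "S \<subseteq> {1..r}" and pos: "row_integral > 0"
  shows "edge_integral (two_row S) (glued_edges r E {1..2} (two_row S)) > 0"
proof -
  interpret P: product_sigma_finite "\<lambda>_::(nat \<times> nat) set. \<Lambda>" by (rule product_sigma_finite_Lam)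
  interpret N: product_sigma_finite "\<lambda>_::nat. \<Lambda>" by (rule product_sigma_finite_Lam)
  have fS: "finite S" using S finite_subset by blast
  let ?\<rho> = "two_row S"
  define T where "T = {1..r} - S"
  have ST: "S \<union> T = {1..r}" "S \<inter> T = {}" "finite T" using S by (auto simp: T_def)
  define s :: "nat \<Rightarrow> (nat \<times> nat) set" where "s = (\<lambda>i. {1..2} \<times> {i})"
  define t :: "nat \<Rightarrow> nat \<Rightarrow> (nat \<times> nat) set" where "t = (\<lambda>k i. {(k, i)})"
  define U where "U = (\<Union>k\<in>{1..2}. t k ` T)"
  have \<rho>: "?\<rho> = s ` S \<union> U" by (simp add: two_row_def s_def t_def U_def T_def)
  have st: "s i \<noteq> t k j" for i k j unfolding s_def t_def by (rule two_row_disjoint)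
  have sU: "s ` S \<inter> U = {}" using st by (auto simp: U_def)
  have injs: "inj_on s S"
    unfolding s_def by (rule inj_onI) (rule two_row_inj)
  have injt: "inj_on (t k) T" for k by (auto simp: inj_on_def t_def)
  have fin: "finite (s ` S)" "finite U" "\<And>k. finite (t k ` T)" using fS ST by (auto simp: U_def)
  have bl: "block ?\<rho> (k, i) = (if i \<in> S then s i else t k i)" if "k \<in> {1..2}" "i \<in> {1..r}" for k i
    using two_row_block[OF S that] by (simp add: s_def t_def)
  define rw where "rw = (\<lambda>k (x :: (nat \<times> nat) set \<Rightarrow> 'a). row_weight (\<lambda>i. if i \<in> S then x (s i) else x (t k i)))"
  have NF: "?\<rho> \<in> nonflat_partitions {1..2} {1..r}" by (rule two_row_nonflat[OF S])
  have rwb: "rw k x = (\<Prod>e\<in>(\<lambda>e. vertex_map r ?\<rho> k ` e) ` E. ennreal (edge_weight \<psi> (case_sum x y) e))"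
    if "k \<in> {1..2}" for k x
    unfolding glued_row_weight[OF NF that] rw_def by (rule row_weight_cong) (simp add: bl[OF that])
  have le: "(\<Prod>k\<in>{1..2}. rw k x) \<le> (\<Prod>e\<in>glued_edges r E {1..2} ?\<rho>. ennreal (edge_weight \<psi> (case_sum x y) e))" for x
  proof -
    let ?A = "\<lambda>k. (\<lambda>e. vertex_map r ?\<rho> k ` e) ` E" and ?w = "\<lambda>e. ennreal (edge_weight \<psi> (case_sum x y) e)"
    have "(\<Prod>k\<in>{1..2}. rw k x) = rw 1 x * rw 2 x" unfolding rows_eq by simp
    also have "\<dots> = (\<Prod>e\<in>?A 1. ?w e) * (\<Prod>e\<in>?A 2. ?w e)" by (simp add: rwb)
    \<comment> \<open>Splitting the two products into union and intersection isolates the edges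
      counted twice, whose weights are at most 1.\<close>
    also have "\<dots> = (\<Prod>e\<in>?A 1 \<union> ?A 2. ?w e) * (\<Prod>e\<in>?A 1 \<inter> ?A 2. ?w e)"
      using finite_E by (intro prod.union_inter[symmetric]) auto
    also have "\<dots> \<le> (\<Prod>e\<in>?A 1 \<union> ?A 2. ?w e) * 1"
      using edge_weight_range[OF psi_range] by (intro mult_left_mono prod_le_1) auto
    also have "?A 1 \<union> ?A 2 = glued_edges r E {1..2} ?\<rho>" unfolding glued_edges_def rows_eq by simp
    finally show ?thesis by simp
  qed
  \<comment> \<open>The weight of one copy with its shared vertices held at \<open>u\<close> and all
    others integrated out.\<close>
  define H where "H = (\<lambda>u. \<integral>\<^sup>+v. row_weight (\<lambda>i. if i \<in> S then u i else v i) \<partial>PiM T (\<lambda>_. \<Lambda>))"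
  have H_restrict: "H (restrict u S) = H u" for u
    unfolding H_def by (intro nn_integral_cong row_weight_cong) simp
  have mH: "H \<in> borel_measurable (PiM S (\<lambda>_. \<Lambda>))"
  proof -
    interpret T: sigma_finite_measure "PiM T (\<lambda>_. \<Lambda>)" by (rule N.sigma_finite[OF ST(3)])
    have "(\<lambda>p. row_weight (\<lambda>i. if i \<in> S then fst p i else snd p i)) \<in> borel_measurable (PiM S (\<lambda>_. \<Lambda>) \<Otimes>\<^sub>M PiM T (\<lambda>_. \<Lambda>))"
    proof (rule measurable_row_weight)
      fix i assume i: "i \<in> {1..r}"
      show "(\<lambda>p. if i \<in> S then fst p i else snd p i) \<in> borel_measurable (PiM S (\<lambda>_. \<Lambda>) \<Otimes>\<^sub>M PiM T (\<lambda>_. \<Lambda>))"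
      proof (cases "i \<in> S")
        case True
        then show ?thesis
          using measurable_compose[OF measurable_fst component_measurable[OF True]] by simp
      next
        case False
        then have "i \<in> T" using i ST by blast
        then show ?thesis
          using False measurable_compose[OF measurable_snd component_measurable[of i T]] by simp
      qed
    qed
    then have "(\<lambda>(u, v). row_weight (\<lambda>i. if i \<in> S then u i else v i)) \<in> borel_measurable (PiM S (\<lambda>_. \<Lambda>) \<Otimes>\<^sub>M PiM T (\<lambda>_. \<Lambda>))"
      by (simp add: case_prod_beta)
    from T.borel_measurable_nn_integral[OF this] show ?thesis unfolding H_def .
  qed
  have "row_integral = (\<integral>\<^sup>+u. \<integral>\<^sup>+v. row_weight (merge S T (u, v)) \<partial>PiM T (\<lambda>_. \<Lambda>) \<partial>PiM S (\<lambda>_. \<Lambda>))"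
    unfolding row_integral_def ST(1)[symmetric]
    by (rule N.product_nn_integral_fold[OF ST(2) fS ST(3)])
      (use ST in \<open>auto intro!: measurable_row_weight component_measurable\<close>)
  also have "\<dots> = (\<integral>\<^sup>+u. H u \<partial>PiM S (\<lambda>_. \<Lambda>))"
    unfolding H_def by (intro nn_integral_cong row_weight_cong) (use ST in \<open>auto simp: merge_def\<close>)
  finally have rH: "row_integral = (\<integral>\<^sup>+u. H u \<partial>PiM S (\<lambda>_. \<Lambda>))" .
  have mrw: "rw k \<in> borel_measurable (PiM (s ` S \<union> U) (\<lambda>_. \<Lambda>))" if k: "k \<in> {1..2}" for k
    unfolding rw_def
  proof (rule measurable_row_weight)
    fix i assume i: "i \<in> {1..r}"
    show "(\<lambda>x. if i \<in> S then x (s i) else x (t k i)) \<in> borel_measurable (PiM (s ` S \<union> U) (\<lambda>_. \<Lambda>))"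
    proof (cases "i \<in> S")
      case True
      then show ?thesis using component_measurable[of "s i" "s ` S \<union> U"] by simp
    next
      case False
      then have "t k i \<in> s ` S \<union> U" using i ST k unfolding U_def by blast
      from component_measurable[OF this] show ?thesis using False by simp
    qed
  qed
  define f where "f = (\<lambda>x k w. row_weight (\<lambda>i. if i \<in> S then x (s i) else w (t k i)))"
  have mf: "f x k \<in> borel_measurable (PiM (t k ` T) (\<lambda>_. \<Lambda>))" for x k
    unfolding f_def
  proof (rule measurable_row_weight)
    fix i assume i: "i \<in> {1..r}"
    show "(\<lambda>w. if i \<in> S then x (s i) else w (t k i)) \<in> borel_measurable (PiM (t k ` T) (\<lambda>_. \<Lambda>))"
    proof (cases "i \<in> S")
      case False
      then have "t k i \<in> t k ` T" using i ST by blast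
      from component_measurable[OF this] show ?thesis using False by simp
    qed simp
  qed
  have fcong: "f x k w = f x k w'" if "\<And>j. j \<in> t k ` T \<Longrightarrow> w j = w' j" for x k w w'
    unfolding f_def
  proof (rule row_weight_cong)
    fix i assume "i \<in> {1..r}"
    then have "i \<notin> S \<Longrightarrow> i \<in> T" using ST by blast
    then show "(if i \<in> S then x (s i) else w (t k i)) = (if i \<in> S then x (s i) else w' (t k i))"
      using that by simp
  qed
  \<comment> \<open>The private vertices of row \<open>k\<close> are renamed to \<open>T\<close>;
    the result does not depend on \<open>k\<close>, which is where the square comes from.\<close>
  have intf: "(\<integral>\<^sup>+w. f x k w \<partial>PiM (t k ` T) (\<lambda>_. \<Lambda>)) = H (\<lambda>i\<in>S. x (s i))" for x k
  proof -
    let ?G = "\<lambda>v. row_weight (\<lambda>i. if i \<in> S then x (s i) else v i)"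
    have "(\<integral>\<^sup>+w. f x k w \<partial>PiM (t k ` T) (\<lambda>_. \<Lambda>)) = (\<integral>\<^sup>+w. ?G (\<lambda>i\<in>T. w (t k i)) \<partial>PiM (t k ` T) (\<lambda>_. \<Lambda>))"
      unfolding f_def by (intro nn_integral_cong row_weight_cong) (use ST in auto)
    also have "\<dots> = (\<integral>\<^sup>+v. ?G v \<partial>PiM T (\<lambda>_. \<Lambda>))"
    proof (rule nn_integral_PiM_reindex[OF sigma_finite_Lam ST(3) injt], rule measurable_row_weight)
      fix i assume i: "i \<in> {1..r}"
      show "(\<lambda>v. if i \<in> S then x (s i) else v i) \<in> borel_measurable (PiM T (\<lambda>_. \<Lambda>))"
      proof (cases "i \<in> S")
        case False
        then have "i \<in> T" using i ST by blast
        from component_measurable[OF this] show ?thesis using False by simp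
      qed simp
    qed
    also have "\<dots> = H (\<lambda>i. x (s i))" by (simp add: H_def)
    finally show ?thesis using H_restrict[of "\<lambda>i. x (s i)"] by simp
  qed
  have tdis: "disjoint_family_on (\<lambda>k. t k ` T) {1..2}"
    by (auto simp: disjoint_family_on_def t_def)
  have "(\<integral>\<^sup>+x. (\<Prod>k\<in>{1..2}. rw k x) \<partial>PiM (s ` S \<union> U) (\<lambda>_. \<Lambda>))
    = (\<integral>\<^sup>+x. \<integral>\<^sup>+w. (\<Prod>k\<in>{1..2}. rw k (merge (s ` S) U (x, w))) \<partial>PiM U (\<lambda>_. \<Lambda>) \<partial>PiM (s ` S) (\<lambda>_. \<Lambda>))"
    by (rule P.product_nn_integral_fold[OF sU fin(1,2)])
      (rule borel_measurable_prod_ennreal, rule mrw)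
  also have "\<dots> = (\<integral>\<^sup>+x. \<integral>\<^sup>+w. (\<Prod>k\<in>{1..2}. f x k w) \<partial>PiM U (\<lambda>_. \<Lambda>) \<partial>PiM (s ` S) (\<lambda>_. \<Lambda>))"
  proof (intro nn_integral_cong prod.cong refl)
    fix x w k assume k: "k \<in> {1..2::nat}"
    show "rw k (merge (s ` S) U (x, w)) = f x k w"
      unfolding rw_def f_def
    proof (rule row_weight_cong)
      fix i assume i: "i \<in> {1..r}"
      show "(if i \<in> S then merge (s ` S) U (x, w) (s i) else merge (s ` S) U (x, w) (t k i))
        = (if i \<in> S then x (s i) else w (t k i))"
      proof (cases "i \<in> S")
        case True
        then show ?thesis by (simp add: merge_def)
      next
        case False
        then have "t k i \<in> U" using i k ST unfolding U_def by blast
        then show ?thesis using False sU by (auto simp: merge_def)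
      qed
    qed
  qed
  also have "\<dots> = (\<integral>\<^sup>+x. (\<Prod>k\<in>{1..2::nat}. H (\<lambda>i\<in>S. x (s i))) \<partial>PiM (s ` S) (\<lambda>_. \<Lambda>))"
  proof (rule nn_integral_cong)
    fix x
    have "(\<integral>\<^sup>+w. (\<Prod>k\<in>{1..2}. f x k w) \<partial>PiM U (\<lambda>_. \<Lambda>)) = (\<Prod>k\<in>{1..2}. \<integral>\<^sup>+w. f x k w \<partial>PiM (t k ` T) (\<lambda>_. \<Lambda>))"
      unfolding U_def
      by (rule P.product_nn_integral_disjoint_family[OF _ fin(3) tdis mf fcong]) simp_all
    then show "(\<integral>\<^sup>+w. (\<Prod>k\<in>{1..2}. f x k w) \<partial>PiM U (\<lambda>_. \<Lambda>)) = (\<Prod>k\<in>{1..2::nat}. H (\<lambda>i\<in>S. x (s i)))"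
      unfolding intf .
  qed
  also have "\<dots> = (\<integral>\<^sup>+u. H u ^ 2 \<partial>PiM S (\<lambda>_. \<Lambda>))"
    using nn_integral_PiM_reindex[OF sigma_finite_Lam fS injs, of "\<lambda>u. H u ^ 2"] mH by simp
  finally have eq: "(\<integral>\<^sup>+x. (\<Prod>k\<in>{1..2}. rw k x) \<partial>PiM (s ` S \<union> U) (\<lambda>_. \<Lambda>)) = (\<integral>\<^sup>+u. H u ^ 2 \<partial>PiM S (\<lambda>_. \<Lambda>))" .
  have "(\<integral>\<^sup>+u. H u ^ 2 \<partial>PiM S (\<lambda>_. \<Lambda>)) \<noteq> 0"
  proof
    assume "(\<integral>\<^sup>+u. H u ^ 2 \<partial>PiM S (\<lambda>_. \<Lambda>)) = 0"
    then have "AE u in PiM S (\<lambda>_. \<Lambda>). H u ^ 2 = 0"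
      using mH by (subst (asm) nn_integral_0_iff_AE) auto
    then have "AE u in PiM S (\<lambda>_. \<Lambda>). H u = 0" by eventually_elim simp
    then have "(\<integral>\<^sup>+u. H u \<partial>PiM S (\<lambda>_. \<Lambda>)) = 0"
      using mH by (subst nn_integral_0_iff_AE) auto
    then show False using pos rH by simp
  qed
  then have "0 < (\<integral>\<^sup>+x. (\<Prod>k\<in>{1..2}. rw k x) \<partial>PiM (s ` S \<union> U) (\<lambda>_. \<Lambda>))"
    unfolding eq by (simp add: zero_less_iff_neq_zero)
  also have "\<dots> \<le> edge_integral ?\<rho> (glued_edges r E {1..2} ?\<rho>)"
    unfolding edge_integral_def \<rho>[symmetric] by (intro nn_integral_mono le)
  finally show ?thesis .
qed

end

section \<open>Cumulants of the subgraph count\<close>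

context glued_integrals
begin

text \<open>Each block costs at most one factor: the total mass if there are no endpoints, and
  otherwise the uniform bound on the integrals of \<psi> in its second argument. The constant is
  raised to at least 1 so that its powers increase with the number of blocks.\<close>

lemma edge_integral_bounded:
  assumes "m = 0 \<Longrightarrow> emeasure \<Lambda> (space \<Lambda>) < \<infinity>"
    and "1 \<le> m \<Longrightarrow> \<exists>B<\<infinity>. \<forall>x. (\<integral>\<^sup>+z. ennreal (\<psi> x z) \<partial>\<Lambda>) \<le> B"
  obtains C :: real where "1 \<le> C"
    "\<And>R \<rho>. finite R \<Longrightarrow> \<rho> \<in> nonflat_partitions R {1..r} \<Longrightarrow>
       edge_integral \<rho> (glued_edges r E R \<rho>) \<le> ennreal (C ^ card \<rho>)"
proof -
  have "\<exists>B<\<infinity>. \<forall>R \<rho>. finite R \<longrightarrow> \<rho> \<in> nonflat_partitions R {1..r} \<longrightarrow>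
    edge_integral \<rho> (glued_edges r E R \<rho>) \<le> B ^ card \<rho>"
  proof (cases "m = 0")
    case True
    have "edge_integral \<rho> (glued_edges r E R \<rho>) \<le> emeasure \<Lambda> (space \<Lambda>) ^ card \<rho>"
      if "finite R" "\<rho> \<in> nonflat_partitions R {1..r}" for R \<rho>
      by (rule edge_integral_finite_measure[OF _ finite_glued_edges[OF that(1)]])
        (use that finite_elements[of "R \<times> {1..r}" \<rho>] in \<open>simp add: nonflat_partitions_def\<close>)
    then show ?thesis using assms(1)[OF True] by blast
  next
    case False
    then have m: "1 \<le> m" by simp
    obtain B where B: "B < \<infinity>" "\<And>x. (\<integral>\<^sup>+z. ennreal (\<psi> x z) \<partial>\<Lambda>) \<le> B" using assms(2)[OF m] by blast
    have "edge_integral \<rho> (glued_edges r E R \<rho>) \<le> B ^ card \<rho>"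
      if "finite R" "\<rho> \<in> nonflat_partitions R {1..r}" for R \<rho>
      by (rule edge_integral_grow[OF _ finite_glued_edges[OF that(1)] glued_edges_over[OF that(2)] B(2)
            glued_edges_grow[OF m that(2)]])
        (use that finite_elements[of "R \<times> {1..r}" \<rho>] in \<open>simp add: nonflat_partitions_def\<close>)
    then show ?thesis using B(1) by blast
  qed
  then obtain B where B: "B < \<infinity>" "\<And>R \<rho>. finite R \<Longrightarrow> \<rho> \<in> nonflat_partitions R {1..r} \<Longrightarrow>
    edge_integral \<rho> (glued_edges r E R \<rho>) \<le> B ^ card \<rho>" by blast
  have BC: "B \<le> ennreal (max 1 (enn2real B))"
    using B(1) by (metis ennreal_enn2real ennreal_leI infinity_ennreal_def max.cobounded2)
  show thesis
  proof (rule that[of "max 1 (enn2real B)"])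
    fix R \<rho> assume "finite R" "\<rho> \<in> nonflat_partitions R {1..r}"
    then have "edge_integral \<rho> (glued_edges r E R \<rho>) \<le> B ^ card \<rho>" by (rule B(2))
    also have "\<dots> \<le> ennreal (max 1 (enn2real B)) ^ card \<rho>" using BC by (rule power_mono) simp
    also have "\<dots> = ennreal (max 1 (enn2real B) ^ card \<rho>)" by (rule ennreal_power) simp
    finally show "edge_integral \<rho> (glued_edges r E R \<rho>) \<le> ennreal (max 1 (enn2real B) ^ card \<rho>)" .
  qed simp
qed

end

section \<open>Scaling of the intensity and of the connection function\<close>

lemma edge_weight_scale: "edge_weight (\<lambda>x z. c * \<psi> x z) z e = c * edge_weight \<psi> z e"
  by (simp add: edge_weight_def Let_def)

lemma connection_function_scale:
  assumes "connection_function \<psi>" "0 < c" "c < 1"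
  shows "connection_function (\<lambda>x z. c * \<psi> x z)"
proof -
  interpret connection_function \<psi> by fact
  show ?thesis
  proof
    show "c * \<psi> x z = c * \<psi> z x" for x z using psi_sym by simp
    show "0 \<le> c * \<psi> x z \<and> c * \<psi> x z \<le> 1" for x z
      using psi_range[of x z] assms(2,3) by (simp add: mult_le_one)
    show "(\<lambda>(x, z). c * \<psi> x z) \<in> borel_measurable (borel \<Otimes>\<^sub>M borel)"
      using borel_measurable_times[OF borel_measurable_const psi_meas, of c] by (simp add: case_prod_beta)
  qed
qed

text \<open>The model at one intensity \<open>l\<close>. The measure, the function \<psi> and the
  constant \<open>C\<close> are the unscaled data, so bounds in terms of them are uniform in
  \<open>l\<close> and \<open>c\<close>. After the following two interpretations, names with prefix
  \<open>S\<close> refer to the scaled data.\<close>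

locale scaled_count = glued_integrals r m E \<psi> y \<Lambda>
  for r m E and \<psi> :: "'a::topological_space \<Rightarrow> 'a \<Rightarrow> real" and y \<Lambda> +
  fixes C :: real and M :: "'w measure" and \<tau> X \<Gamma> and l c :: real
  assumes C1: "1 \<le> C"
    and C_bound: "\<And>R \<rho>. finite R \<Longrightarrow> \<rho> \<in> nonflat_partitions R {1..r} \<Longrightarrow>
       edge_integral \<rho> (glued_edges r E R \<rho>) \<le> ennreal (C ^ card \<rho>)"
    and l: "0 < l" and c: "0 < c" "c < 1"
    and model': "random_connection_model M \<tau> X \<Gamma> m y (scale_measure (ennreal l) \<Lambda>) (\<lambda>x z. c * \<psi> x z)"

sublocale scaled_count \<subseteq> S: random_connection_count M "\<lambda>x z. c * \<psi> x z" \<tau> X \<Gamma> m y "scale_measure (ennreal l) \<Lambda>" r E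
proof -
  have "prob_space M" using model' by (simp add: random_connection_model_def)
  then show "random_connection_count M (\<lambda>x z. c * \<psi> x z) \<tau> X \<Gamma> m y (scale_measure (ennreal l) \<Lambda>) r E"
    unfolding random_connection_count_def random_connection_def random_connection_axioms_def
    using connection_function_scale[OF connection_function_axioms c] model' sets_Lam
      sigma_finite_scale_measure[OF sigma_finite_Lam, of l] l endpoint_graph_axioms
    by simp
qed

sublocale scaled_count \<subseteq> S: glued_integrals r m E "\<lambda>x z. c * \<psi> x z" y "scale_measure (ennreal l) \<Lambda>"
proof (rule glued_integrals.intro[OF _ _ glued_integrals_axioms.intro])
  show "endpoint_graph r m E" by (rule endpoint_graph_axioms)
  show "connection_function (\<lambda>x z. c * \<psi> x z)"
    by (rule connection_function_scale[OF connection_function_axioms c])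
  show "sets (scale_measure (ennreal l) \<Lambda>) = sets borel" by (simp add: sets_Lam)
  show "sigma_finite_measure (scale_measure (ennreal l) \<Lambda>)"
    by (rule sigma_finite_scale_measure[OF sigma_finite_Lam less_imp_le[OF l]])
qed

context scaled_count
begin

abbreviation N :: "'w \<Rightarrow> real" where "N \<equiv> \<lambda>\<omega>. subgraph_count r m E (\<tau> \<omega>) (\<Gamma> \<omega>)"

definition weight :: "nat set \<Rightarrow> (nat \<times> nat) set set \<Rightarrow> real" where
  "weight R \<rho> = enn2real (S.edge_integral \<rho> (glued_edges r E R \<rho>))"

text \<open>Every integration variable contributes a factor \<open>l\<close> and every edge a factor
  \<open>c\<close>.\<close>

lemma scaled_edge_integral:
  assumes "finite K" "finite F" "F \<subseteq> edges_over (abstract_vertices K m)"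
  shows "S.edge_integral K F = ennreal (l ^ card K * c ^ card F) * edge_integral K F"
proof -
  let ?p = "\<lambda>x. \<Prod>e\<in>F. ennreal (edge_weight \<psi> (case_sum x y) e)"
  have p: "(\<Prod>e\<in>F. ennreal (edge_weight (\<lambda>x z. c * \<psi> x z) (case_sum x y) e)) = ennreal (c ^ card F) * ?p x" for x
  proof -
    have "(\<Prod>e\<in>F. ennreal (edge_weight (\<lambda>x z. c * \<psi> x z) (case_sum x y) e))
      = (\<Prod>e\<in>F. ennreal c * ennreal (edge_weight \<psi> (case_sum x y) e))"
      unfolding edge_weight_scale
      by (intro prod.cong refl ennreal_mult less_imp_le[OF c(1)] edge_weight_range(1) psi_range)
    then show ?thesis using c by (simp add: prod.distrib ennreal_power)
  qed
  have m: "?p \<in> borel_measurable (PiM K (\<lambda>_. \<Lambda>))" by (rule measurable_edge_prod[OF assms(3)])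
  have "S.edge_integral K F = (\<integral>\<^sup>+x. ennreal (c ^ card F) * ?p x \<partial>scale_measure (ennreal (l ^ card K)) (PiM K (\<lambda>_. \<Lambda>)))"
    unfolding S.edge_integral_def p
    using PiM_scale_measure[OF assms(1) l sigma_finite_Lam S.sigma_finite_Lam] by simp
  also have "\<dots> = ennreal (l ^ card K) * (ennreal (c ^ card F) * edge_integral K F)"
    using m by (simp add: nn_integral_scale_measure nn_integral_cmult edge_integral_def mult.left_commute)
  finally show ?thesis using l c by (simp add: ennreal_mult mult.assoc)
qed

lemma scaled_edge_integral_glued:
  assumes "finite R" "\<rho> \<in> nonflat_partitions R {1..r}"
  shows "S.edge_integral \<rho> (glued_edges r E R \<rho>)
    = ennreal (l ^ card \<rho> * c ^ card (glued_edges r E R \<rho>)) * edge_integral \<rho> (glued_edges r E R \<rho>)"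
  by (rule scaled_edge_integral[OF S.nonflat_finite[OF assms] finite_glued_edges[OF assms(1)] glued_edges_over[OF assms(2)]])

lemma edge_integral_lt_top:
  assumes "finite R" "\<rho> \<in> nonflat_partitions R {1..r}"
  shows "edge_integral \<rho> (glued_edges r E R \<rho>) < top" "S.edge_integral \<rho> (glued_edges r E R \<rho>) < top"
proof -
  show *: "edge_integral \<rho> (glued_edges r E R \<rho>) < top"
    using C_bound[OF assms] by (rule order.strict_trans1) simp
  show "S.edge_integral \<rho> (glued_edges r E R \<rho>) < top"
    unfolding scaled_edge_integral_glued[OF assms] using * by (simp add: ennreal_mult_less_top)
qed

lemma weight_eq:
  assumes "finite R" "\<rho> \<in> nonflat_partitions R {1..r}"
  shows "weight R \<rho> = l ^ card \<rho> * c ^ card (glued_edges r E R \<rho>) * enn2real (edge_integral \<rho> (glued_edges r E R \<rho>))"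
  unfolding weight_def scaled_edge_integral_glued[OF assms] using l c by (simp add: enn2real_mult)

lemma weight_nonneg: "0 \<le> weight R \<rho>"
  by (simp add: weight_def)

lemma moment_nn_integral:
  assumes "finite R"
  shows "(\<integral>\<^sup>+\<omega>. ennreal_count (\<tau> \<omega>) (\<Gamma> \<omega>) ^ card R \<partial>M) = ennreal (\<Sum>\<rho>\<in>nonflat_partitions R {1..r}. weight R \<rho>)"
proof -
  have "(\<integral>\<^sup>+\<omega>. ennreal_count (\<tau> \<omega>) (\<Gamma> \<omega>) ^ card R \<partial>M)
    = (\<Sum>\<rho>\<in>nonflat_partitions R {1..r}. ennreal (weight R \<rho>))"
    unfolding S.moment_ennreal_count[OF assms] S.edge_integral_def[symmetric]
  proof (rule sum.cong[OF refl])
    fix \<rho> assume \<rho>: "\<rho> \<in> nonflat_partitions R {1..r}"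
    show "S.edge_integral \<rho> (glued_edges r E R \<rho>) = ennreal (weight R \<rho>)"
      using edge_integral_lt_top(2)[OF assms \<rho>] by (simp add: weight_def)
  qed
  then show ?thesis by (simp add: weight_nonneg)
qed

lemma AE_ennreal_count_finite: "AE \<omega> in M. ennreal_count (\<tau> \<omega>) (\<Gamma> \<omega>) \<noteq> \<infinity>"
proof (rule nn_integral_PInf_AE)
  show "(\<lambda>\<omega>. ennreal_count (\<tau> \<omega>) (\<Gamma> \<omega>)) \<in> borel_measurable M" by (rule S.measurable_ennreal_count)
  show "(\<integral>\<^sup>+\<omega>. ennreal_count (\<tau> \<omega>) (\<Gamma> \<omega>) \<partial>M) \<noteq> \<infinity>"
    using moment_nn_integral[of "{1::nat}"] by simp
qed

lemma AE_summable:
  "AE \<omega> in M. copy_indicator r m E (\<Gamma> \<omega>) summable_on injective_tuples r (\<tau> \<omega>)"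
  using AE_ennreal_count_finite by eventually_elim (simp add: copy_indicator_summable_iff less_top)

lemma nn_moment: "(\<integral>\<^sup>+\<omega>. ennreal (N \<omega> ^ n) \<partial>M) = (\<integral>\<^sup>+\<omega>. ennreal_count (\<tau> \<omega>) (\<Gamma> \<omega>) ^ n \<partial>M)"
proof (rule nn_integral_cong_AE)
  show "AE \<omega> in M. ennreal (N \<omega> ^ n) = ennreal_count (\<tau> \<omega>) (\<Gamma> \<omega>) ^ n"
    using AE_ennreal_count_finite
    by eventually_elim (simp add: subgraph_count_eq less_top flip: ennreal_power)
qed

lemma measurable_N: "N \<in> borel_measurable M"
  unfolding subgraph_count_eq using S.measurable_ennreal_count by measurable

lemma N_nonneg: "0 \<le> N \<omega>"
  by (simp add: subgraph_count_eq)

lemma integrable_moment: "integrable M (\<lambda>\<omega>. N \<omega> ^ n)"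
proof (rule integrableI_nonneg)
  show "(\<lambda>\<omega>. N \<omega> ^ n) \<in> borel_measurable M" using measurable_N by measurable
  show "AE \<omega> in M. 0 \<le> N \<omega> ^ n" by (simp add: N_nonneg)
  have "(\<integral>\<^sup>+\<omega>. ennreal (N \<omega> ^ n) \<partial>M) = (\<integral>\<^sup>+\<omega>. ennreal_count (\<tau> \<omega>) (\<Gamma> \<omega>) ^ card {1..n} \<partial>M)"
    by (simp add: nn_moment)
  then show "(\<integral>\<^sup>+\<omega>. ennreal (N \<omega> ^ n) \<partial>M) < \<infinity>" using moment_nn_integral[of "{1..n}"] by simp
qed

lemma moment:
  assumes "finite R"
  shows "(\<integral>\<omega>. N \<omega> ^ card R \<partial>M) = (\<Sum>\<rho>\<in>nonflat_partitions R {1..r}. weight R \<rho>)"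
proof -
  have "ennreal (\<integral>\<omega>. N \<omega> ^ card R \<partial>M) = (\<integral>\<^sup>+\<omega>. ennreal (N \<omega> ^ card R) \<partial>M)"
    by (rule nn_integral_eq_integral[symmetric]) (simp_all add: integrable_moment N_nonneg)
  also have "\<dots> = ennreal (\<Sum>\<rho>\<in>nonflat_partitions R {1..r}. weight R \<rho>)"
    unfolding nn_moment by (rule moment_nn_integral[OF assms])
  finally show ?thesis
    by (subst (asm) ennreal_inj) (auto simp: N_nonneg weight_nonneg intro!: sum_nonneg)
qed

text \<open>A pattern determines its set of rows. This allows \<open>weight\<close> to be viewed as
  a function of \<rho> alone, the form that \<open>joint_cumulant_nonflat_partitions\<close>
  expects.\<close>

lemma nonflat_rows_eq:
  assumes "\<rho> \<in> nonflat_partitions R {1..r}"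
  shows "fst ` \<Union>\<rho> = R"
proof -
  have "\<Union>\<rho> = R \<times> {1..r}" using assms by (auto simp: nonflat_partitions_def partition_on_def)
  moreover have "{1..r} \<noteq> {}" using r by simp
  ultimately show ?thesis by simp
qed

lemma enn2real_prod: "enn2real (\<Prod>i\<in>I. f i) = (\<Prod>i\<in>I. enn2real (f i))"
  by (induction I rule: infinite_finite_induct) (simp_all add: enn2real_mult)

lemma cumulant_formula:
  assumes "1 \<le> n"
  shows "cumulant M N n = (\<Sum>\<rho> | \<rho> \<in> nonflat_partitions {1..n} {1..r} \<and> row_connected {1..n} \<rho>. weight {1..n} \<rho>)"
proof -
  let ?I = "\<lambda>\<rho>. weight (fst ` \<Union>\<rho>) \<rho>"
  have I: "?I \<rho> = weight R \<rho>" if "\<rho> \<in> nonflat_partitions R {1..r}" for R \<rho>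
    by (simp only: nonflat_rows_eq[OF that])
  have "cumulant M N n = joint_cumulant {1..n} (\<lambda>B. \<Sum>\<rho>\<in>nonflat_partitions B {1..r}. ?I \<rho>)"
    unfolding cumulant_joint_cumulant
  proof (rule joint_cumulant_cong)
    fix B :: "nat set" assume "B \<subseteq> {1..n}"
    then have "finite B" using finite_subset by blast
    from moment[OF this] show "(\<integral>\<omega>. N \<omega> ^ card B \<partial>M) = (\<Sum>\<rho>\<in>nonflat_partitions B {1..r}. ?I \<rho>)"
      by (simp only: I cong: sum.cong)
  qed
  also have "\<dots> = (\<Sum>\<rho> | \<rho> \<in> nonflat_partitions {1..n} {1..r} \<and> row_connected {1..n} \<rho>. ?I \<rho>)"
  proof (rule joint_cumulant_nonflat_partitions)
    show "{1..n} \<noteq> {}" using assms by simp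
    show "{1..r} \<noteq> {}" using r by simp
    fix \<rho> \<pi> assume \<rho>: "\<rho> \<in> nonflat_partitions {1..n} {1..r}" and \<pi>: "partition_on {1..n} \<pi>"
      and comp: "\<forall>b\<in>\<rho>. \<exists>B\<in>\<pi>. fst ` b \<subseteq> B"
    have "(\<Prod>B\<in>\<pi>. ?I {b\<in>\<rho>. fst ` b \<subseteq> B}) = (\<Prod>B\<in>\<pi>. weight B {b\<in>\<rho>. fst ` b \<subseteq> B})"
      by (intro prod.cong refl I nonflat_partitions_restrict[OF \<rho> \<pi> _ comp])
    also have "\<dots> = weight {1..n} \<rho>"
      unfolding weight_def enn2real_prod[symmetric]
      by (rule arg_cong[where f=enn2real], rule S.edge_integral_multiplicative[OF _ \<rho> \<pi> comp]) simp
    finally show "(\<Prod>B\<in>\<pi>. ?I {b\<in>\<rho>. fst ` b \<subseteq> B}) = ?I \<rho>" using I[OF \<rho>] by simp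
  qed simp_all
  also have "\<dots> = (\<Sum>\<rho> | \<rho> \<in> nonflat_partitions {1..n} {1..r} \<and> row_connected {1..n} \<rho>. weight {1..n} \<rho>)"
    by (rule sum.cong[OF refl], rule I) simp
  finally show ?thesis .
qed

section \<open>Upper bound on the cumulants and lower bound on the variance\<close>

definition "A = l ^ r * c ^ card E"
definition "B = l ^ (r - 1) * c ^ (card E - a)"

lemma A_pos: "0 < A" and B_pos: "0 < B"
  using l c by (simp_all add: A_def B_def)

text \<open>The number of patterns brings in \<open>fact n ^ r\<close> and r^(n r), and the
  integrals bring in \<open>C ^ (n * r)\<close>, as a pattern has at most n * r blocks; together the
  last two form \<open>((real r * C) ^ r) ^ n\<close>.\<close>

lemma cumulant_upper_bound:
  assumes bal: "balanced r m E" and n: "1 \<le> n"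
  shows "\<bar>cumulant M N n\<bar> \<le> fact n ^ r * ((real r * C) ^ r) ^ n * A * max 1 B ^ (n - 1)"
proof -
  let ?S = "{\<rho>. \<rho> \<in> nonflat_partitions {1..n} {1..r} \<and> row_connected {1..n} \<rho>}"
  have fS: "finite (nonflat_partitions {1..n} {1..r})" by (rule finite_nonflat_partitions) auto
  have W: "weight {1..n} \<rho> \<le> A * max 1 B ^ (n - 1) * C ^ (n * r)" if \<rho>S: "\<rho> \<in> ?S" for \<rho>
  proof -
    have \<rho>: "\<rho> \<in> nonflat_partitions {1..n} {1..r}" "row_connected {1..n} \<rho>" using \<rho>S by auto
    have part: "partition_on ({1..n} \<times> {1..r}) \<rho>" using \<rho> by (simp add: nonflat_partitions_def)
    have "card \<rho> \<le> card ({1..n} \<times> {1..r})"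
      using card_image_le[of "{1..n} \<times> {1..r}" "block \<rho>"]
      unfolding partition_on_eq_block_image[OF part, symmetric] by simp
    then have c\<rho>: "card \<rho> \<le> n * r" by simp
    have "enn2real (edge_integral \<rho> (glued_edges r E {1..n} \<rho>)) \<le> C ^ card \<rho>"
      using C1 C_bound[OF _ \<rho>(1)] by (intro enn2real_leI) auto
    also have "\<dots> \<le> C ^ (n * r)" using C1 c\<rho> by (rule power_increasing[rotated])
    finally have J: "enn2real (edge_integral \<rho> (glued_edges r E {1..n} \<rho>)) \<le> C ^ (n * r)" .
    have "l ^ card \<rho> * c ^ card (glued_edges r E {1..n} \<rho>) \<le> A * max 1 B ^ (n - 1)"
      using glued_weight_bound[OF bal l c _ _ \<rho>] n unfolding A_def B_def by simp
    from mult_mono[OF this J] show ?thesis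
      unfolding weight_eq[OF finite_atLeastAtMost \<rho>(1)] using A_pos by simp
  qed
  have "\<bar>cumulant M N n\<bar> = (\<Sum>\<rho>\<in>?S. weight {1..n} \<rho>)"
    unfolding cumulant_formula[OF n] by (simp add: sum_nonneg weight_nonneg)
  also have "\<dots> \<le> of_nat (card ?S) * (A * max 1 B ^ (n - 1) * C ^ (n * r))"
    by (rule sum_bounded_above) (rule W)
  also have "\<dots> \<le> of_nat ((fact n * r ^ n) ^ r) * (A * max 1 B ^ (n - 1) * C ^ (n * r))"
  proof (rule mult_right_mono)
    have "card ?S \<le> card (nonflat_partitions {1..n} {1..r})" using fS by (rule card_mono) auto
    then show "of_nat (card ?S) \<le> (of_nat ((fact n * r ^ n) ^ r) :: real)"
      using card_nonflat_partitions[of n r] by (intro of_nat_mono) simp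
    show "0 \<le> A * max 1 B ^ (n - 1) * C ^ (n * r)" using A_pos C1 by simp
  qed
  also have "\<dots> = fact n ^ r * ((real r * C) ^ r) ^ n * A * max 1 B ^ (n - 1)"
    by (simp add: power_mult_distrib mult_ac flip: power_mult)
  finally show ?thesis .
qed

text \<open>All terms of the cumulant formula are nonnegative, so any single connected pattern
  bounds the variance from below. Replacing the number of glued edges by an upper bound
  \<open>k\<close> decreases the power of \<open>c\<close>.\<close>

lemma variance_lower_bound_two_row:
  assumes S: "S \<subseteq> {1..r}" "S \<noteq> {}" and k: "k \<le> 2 * card E" "2 * card E - card {e\<in>E. e \<subseteq> S \<union> {r+1..r+m}} \<le> k"
  shows "l ^ (2 * r - card S) * c ^ k * enn2real (edge_integral (two_row S) (glued_edges r E {1..2} (two_row S)))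
    \<le> cumulant M N 2"
proof -
  let ?S = "{\<rho>. \<rho> \<in> nonflat_partitions {1..2} {1..r} \<and> row_connected {1..2} \<rho>}"
  note NF = two_row_nonflat[OF S(1)]
  have fS: "finite ?S"
    by (rule finite_subset[OF _ finite_nonflat_partitions[of "{1..2}" "{1..r}"]]) auto
  have "c ^ k \<le> c ^ card (glued_edges r E {1..2} (two_row S))"
    using two_row_card_glued[OF S(1)] k(2) c by (intro power_decreasing) auto
  then have "l ^ (2 * r - card S) * c ^ k * enn2real (edge_integral (two_row S) (glued_edges r E {1..2} (two_row S)))
    \<le> weight {1..2} (two_row S)"
    unfolding weight_eq[OF finite_atLeastAtMost NF] two_row_card[OF S(1)]
    using l by (intro mult_right_mono mult_left_mono) auto
  also have "\<dots> \<le> (\<Sum>\<rho>\<in>?S. weight {1..2} \<rho>)"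
    using fS NF two_row_connected[OF S(2)] weight_nonneg by (intro member_le_sum) auto
  also have "\<dots> = cumulant M N 2" using cumulant_formula[of 2] by simp
  finally show ?thesis .
qed

text \<open>Completely identified copies have r blocks and e(G) edges, which gives \<open>A\<close>.
  Copies sharing only \<open>i\<close> have 2r - 1 blocks and at most 2e(G) - a edges, which gives
  \<open>A * B\<close>. The larger of the two is of order \<open>A * max 1 B\<close>.\<close>

lemma variance_lower_bound:
  assumes i: "i \<in> {1..r}" "card {j \<in> {r+1..r+m}. {i, j} \<in> E} = a"
    and k0: "0 < k0" "k0 \<le> enn2real (edge_integral (two_row {1..r}) (glued_edges r E {1..2} (two_row {1..r})))"
      "k0 \<le> enn2real (edge_integral (two_row {i}) (glued_edges r E {1..2} (two_row {i})))"
  shows "k0 * A * max 1 B \<le> cumulant M N 2"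
proof -
  have ae: "a \<le> card E" using max_endpoint_degree_less by simp
  have "{e\<in>E. e \<subseteq> {1..r} \<union> {r+1..r+m}} = E"
  proof -
    have "e \<subseteq> {1..r} \<union> {r+1..r+m}" if "e \<in> E" for e
      using subsetD[OF E_edges_over that] by (auto simp: edges_over_def)
    then show ?thesis by blast
  qed
  then have "l ^ (2 * r - card {1..r}) * c ^ card E
      * enn2real (edge_integral (two_row {1..r}) (glued_edges r E {1..2} (two_row {1..r}))) \<le> cumulant M N 2"
    using r by (intro variance_lower_bound_two_row) auto
  moreover have "2 * r - card {1..r} = r" by simp
  ultimately have "A * enn2real (edge_integral (two_row {1..r}) (glued_edges r E {1..2} (two_row {1..r}))) \<le> cumulant M N 2"
    unfolding A_def by (simp only:)
  moreover have "k0 * A \<le> A * enn2real (edge_integral (two_row {1..r}) (glued_edges r E {1..2} (two_row {1..r})))"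
    using k0(2) A_pos by (subst mult.commute) (rule mult_left_mono, auto)
  ultimately have 1: "k0 * A \<le> cumulant M N 2" by linarith
  let ?D = "{j \<in> {r+1..r+m}. {i, j} \<in> E}"
  have "a = card ((\<lambda>j. {i, j}) ` ?D)"
    unfolding i(2)[symmetric]
    by (rule card_image[symmetric], rule inj_on_subset[OF inj_on_endpoint_edge[OF i(1)]]) auto
  also have "\<dots> \<le> card {e\<in>E. e \<subseteq> {i} \<union> {r+1..r+m}}"
    using finite_E by (intro card_mono) auto
  finally have "2 * card E - card {e\<in>E. e \<subseteq> {i} \<union> {r+1..r+m}} \<le> 2 * card E - a" by simp
  then have "l ^ (2 * r - card {i}) * c ^ (2 * card E - a)
      * enn2real (edge_integral (two_row {i}) (glued_edges r E {1..2} (two_row {i}))) \<le> cumulant M N 2"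
    using i(1) by (intro variance_lower_bound_two_row) auto
  moreover have "l ^ (2 * r - card {i}) * c ^ (2 * card E - a) = A * B"
  proof -
    have "2 * r - card {i} = r + (r - 1)" "2 * card E - a = card E + (card E - a)" using r ae by auto
    then show ?thesis unfolding A_def B_def by (simp only: power_add mult_ac)
  qed
  ultimately have "A * B * enn2real (edge_integral (two_row {i}) (glued_edges r E {1..2} (two_row {i}))) \<le> cumulant M N 2"
    by (simp only:)
  moreover have "k0 * (A * B) \<le> A * B * enn2real (edge_integral (two_row {i}) (glued_edges r E {1..2} (two_row {i})))"
    using k0(3) A_pos B_pos by (subst mult.commute) (rule mult_left_mono, auto)
  ultimately have 2: "k0 * A * B \<le> cumulant M N 2" unfolding mult.assoc by (rule order_trans[rotated])
  show ?thesis using 1 2 by (cases "1 \<le> B") (simp_all add: max_def)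
qed

text \<open>A nonnegative count of mean zero vanishes almost surely.\<close>

lemma variance_zero:
  assumes "row_integral = 0"
  shows "cumulant M N 2 = 0"
proof -
  have w0: "weight {1} \<rho> = 0" if "\<rho> \<in> nonflat_partitions {1} {1..r}" for \<rho>
    using weight_eq[OF _ that] edge_integral_single_row[OF that] assms by simp
  have "(\<integral>\<^sup>+\<omega>. ennreal_count (\<tau> \<omega>) (\<Gamma> \<omega>) ^ card {1::nat} \<partial>M) = ennreal 0"
    unfolding moment_nn_integral[OF finite.insertI[OF finite.emptyI]]
    by (rule arg_cong[where f=ennreal], rule sum.neutral) (use w0 in blast)
  then have "(\<integral>\<^sup>+\<omega>. ennreal_count (\<tau> \<omega>) (\<Gamma> \<omega>) \<partial>M) = 0" by simp
  then have "AE \<omega> in M. ennreal_count (\<tau> \<omega>) (\<Gamma> \<omega>) = 0"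
    using S.measurable_ennreal_count by (subst (asm) nn_integral_0_iff_AE) auto
  then have N0: "AE \<omega> in M. N \<omega> = 0" by eventually_elim (simp add: subgraph_count_eq)
  have N0k: "(\<integral>\<omega>. N \<omega> ^ k \<partial>M) = 0" if "k > 0" for k
  proof -
    have "(\<integral>\<omega>. N \<omega> ^ k \<partial>M) = (\<integral>\<omega>. 0 \<partial>M)"
      using N0 that measurable_N by (intro integral_cong_AE) (auto elim!: eventually_mono)
    then show ?thesis by simp
  qed
  have "cumulant M N 2 = cumulant M (\<lambda>_. 0) 2"
    unfolding cumulant_joint_cumulant joint_cumulant_def
  proof (intro sum.cong prod.cong refl arg_cong2[where f="(*)"])
    fix \<pi> B assume "\<pi> \<in> {\<pi>. partition_on {1..2::nat} \<pi>}" "B \<in> \<pi>"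
    then have "B \<subseteq> {1..2}" "B \<noteq> {}" by (auto simp: partition_on_def)
    then have "card B > 0" using finite_subset by (auto simp: card_gt_0_iff)
    then show "(\<integral>\<omega>. N \<omega> ^ card B \<partial>M) = (\<integral>\<omega>. 0 ^ card B \<partial>M)" by (simp add: N0k)
  qed
  then show ?thesis by (simp add: cumulant_zero)
qed

end

section \<open>Normalized cumulants and asymptotics\<close>

text \<open>The normalization is a shift followed by a scaling; for n >= 2 cumulants ignore the
  shift and are homogeneous of degree n.\<close>

lemma normalized_cumulant:
  assumes M: "prob_space M" and int: "\<And>k. integrable M (\<lambda>\<omega>. Z \<omega> ^ k)" and n: "2 \<le> n"
  shows "cumulant M (normalized M Z) n = cumulant M Z n / sqrt (cumulant M Z 2) ^ n"
proof -
  have "normalized M Z = (\<lambda>\<omega>. (Z \<omega> + (- cumulant M Z 1)) * (1 / sqrt (cumulant M Z 2)))"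
    by (simp add: normalized_def fun_eq_iff)
  then have "cumulant M (normalized M Z) n
    = cumulant M (\<lambda>\<omega>. Z \<omega> + (- cumulant M Z 1)) n * (1 / sqrt (cumulant M Z 2)) ^ n"
    by (simp only: cumulant_mult_const)
  then show ?thesis
    unfolding cumulant_add_const[OF M int n] by (simp add: power_divide)
qed

lemma normalized_cumulant_1:
  assumes M: "prob_space M" and int: "integrable M Z"
  shows "cumulant M (normalized M Z) 1 = 0"
proof -
  interpret prob_space M by (rule M)
  show ?thesis
    unfolding cumulant_1 normalized_def using int by (simp add: prob_space)
qed

text \<open>Here \<open>B\<close> stands for \<open>max 1 B\<close> and the order is n = j + 2. With
  x and z the square roots of \<open>A\<close> and \<open>B\<close>, the power A * B^(j+1) equals
  x^2 z^(2j+2), so division by (x z)^(j+2) leaves (z/x)^j. The constant D/k carries the exponent j +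
  2, which is at most 3j for j >= 1; this is the origin of \<open>q ^ 3\<close>.\<close>

lemma normalized_cumulant_bound:
  fixes \<kappa> v F D A B k0 q :: real
  assumes \<kappa>: "\<bar>\<kappa>\<bar> \<le> F * D ^ (j + 2) * A * B ^ (j + 1)" and v: "k0 * A * B \<le> v"
    and pos: "0 < A" "1 \<le> B" "0 < k0" "0 \<le> D" "0 \<le> F" and q: "D / sqrt k0 \<le> q" "1 \<le> q" and j: "1 \<le> j"
  shows "\<bar>\<kappa> / sqrt v ^ (j + 2)\<bar> \<le> F / (sqrt (A / B) / q ^ 3) ^ j"
proof -
  define x where "x = sqrt A"
  define z where "z = sqrt B"
  define k where "k = sqrt k0"
  have x: "x > 0" "x ^ 2 = A" and z: "z > 0" "z ^ 2 = B" and k: "k > 0"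
    using pos by (auto simp: x_def z_def k_def)
  have t: "0 < k * x * z" using x z k by simp
  have "k * x * z = sqrt (k0 * A * B)" by (simp add: k_def x_def z_def real_sqrt_mult)
  then have ts: "k * x * z \<le> sqrt v" using v by simp
  have "\<bar>\<kappa> / sqrt v ^ (j + 2)\<bar> = \<bar>\<kappa>\<bar> / sqrt v ^ (j + 2)"
    unfolding abs_divide using order_trans[OF less_imp_le[OF t] ts] by (simp only: abs_of_nonneg zero_le_power)
  also have "\<dots> \<le> (F * D ^ (j + 2) * A * B ^ (j + 1)) / (k * x * z) ^ (j + 2)"
    using \<kappa> ts t pos by (intro frac_le power_mono) auto
  also have "\<dots> = F * (D / k) ^ (j + 2) * (z / x) ^ j"
  proof -
    have "A * B ^ (j + 1) = x ^ 2 * z ^ (2 * j + 2)"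
      unfolding x(2)[symmetric] z(2)[symmetric] by (simp only: power_mult[symmetric] distrib_left mult_1_right)
    then have "F * D ^ (j + 2) * A * B ^ (j + 1) = F * D ^ (j + 2) * (x ^ 2 * z ^ (2 * j + 2))"
      by (simp only: mult.assoc)
    moreover have "z ^ (2 * j + 2) = z ^ j * z ^ (j + 2)" by (simp add: mult_2 flip: power_add)
    ultimately show ?thesis using x(1) z(1) k
      by (simp add: power_mult_distrib power_divide power_add power2_eq_square field_simps)
  qed
  also have "\<dots> \<le> F * (q ^ 3) ^ j * (z / x) ^ j"
  proof (intro mult_right_mono mult_left_mono)
    have "(D / k) ^ (j + 2) \<le> q ^ (j + 2)"
      using q pos k by (intro power_mono) (auto simp: k_def)
    also have "\<dots> \<le> q ^ (3 * j)" using q j by (intro power_increasing) auto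
    finally show "(D / k) ^ (j + 2) \<le> (q ^ 3) ^ j" by (simp add: power_mult)
  qed (use x z pos in auto)
  also have "\<dots> = F / (sqrt (A / B) / q ^ 3) ^ j"
    using x z q by (simp add: real_sqrt_divide x_def[symmetric] z_def[symmetric] field_simps power_mult_distrib power_divide)
  finally show ?thesis .
qed

context scaled_count
begin

lemma normalized_count_bound:
  assumes bal: "balanced r m E" and n: "1 \<le> n"
    and i: "i \<in> {1..r}" "card {j \<in> {r+1..r+m}. {i, j} \<in> E} = a"
    and k0: "0 < k0" "row_integral > 0 \<Longrightarrow> k0 \<le> enn2real (edge_integral (two_row {1..r}) (glued_edges r E {1..2} (two_row {1..r})))"
      "row_integral > 0 \<Longrightarrow> k0 \<le> enn2real (edge_integral (two_row {i}) (glued_edges r E {1..2} (two_row {i})))"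
    and q: "(real r * C) ^ r / sqrt k0 \<le> q" "1 \<le> q"
  shows "\<bar>cumulant M (normalized M N) n\<bar> \<le> fact n ^ r / (sqrt (A / max 1 B) / q ^ 3) powi (int n - 2)"
proof (cases "row_integral = 0")
  case True
  \<comment> \<open>The variance is 0, and division by its square root gives 0, so all cumulants of
    the normalized count vanish.\<close>
  then have "normalized M N = (\<lambda>_. 0)" by (simp add: normalized_def variance_zero fun_eq_iff)
  then show ?thesis using n A_pos q by (simp add: cumulant_zero)
next
  case False
  then have pos: "row_integral > 0" by (simp add: zero_less_iff_neq_zero)
  have v: "k0 * A * max 1 B \<le> cumulant M N 2"
    by (rule variance_lower_bound[OF i k0(1) k0(2)[OF pos] k0(3)[OF pos]])
  have A0: "0 < sqrt (A / max 1 B) / q ^ 3" using A_pos q by simp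
  consider "n = 1" | "n = 2" | "3 \<le> n" using n by linarith
  then show ?thesis
  proof cases
    \<comment> \<open>The exponent \<open>int n - 2\<close> is -1 here, so the right-hand side is
      merely a positive number; the left-hand side is 0 by centering.\<close>
    case 1
    then show ?thesis
      using normalized_cumulant_1[OF S.prob_space_axioms, of N] integrable_moment[of 1] A0 by simp
  next
    case 2
    \<comment> \<open>Positivity makes the normalized variance equal to 1, while the bound for n = 2
      is \<open>fact 2 ^ r\<close>.\<close>
    have "cumulant M N 2 > 0" using v A_pos k0(1) by (smt (verit) mult_pos_pos)
    then have "cumulant M (normalized M N) 2 = 1"
      using normalized_cumulant[OF S.prob_space_axioms integrable_moment, of 2] by simp
    then show ?thesis using 2 by simp
  next
    case n3: 3
    define j where "j = n - 2"
    have 3: "n = j + 2" "1 \<le> j" using n3 by (auto simp: j_def)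
    have "\<bar>cumulant M N n\<bar> \<le> fact n ^ r * ((real r * C) ^ r) ^ (j + 2) * A * max 1 B ^ (j + 1)"
      using cumulant_upper_bound[OF bal n] 3 by simp
    then have "\<bar>cumulant M N n / sqrt (cumulant M N 2) ^ (j + 2)\<bar> \<le> fact n ^ r / (sqrt (A / max 1 B) / q ^ 3) ^ j"
      using A_pos k0(1) C1 q 3(2) by (intro normalized_cumulant_bound[OF _ v]) auto
    moreover have "cumulant M (normalized M N) n = cumulant M N n / sqrt (cumulant M N 2) ^ n"
      using 3 by (intro normalized_cumulant[OF S.prob_space_axioms integrable_moment]) simp
    moreover have "int n - 2 = int j" using 3 by simp
    ultimately show ?thesis using 3 by simp
  qed
qed

end

section \<open>Orders of magnitude as the intensity tends to infinity\<close>

lemma asymp_le_iff: "asymp_le f g \<longleftrightarrow> (\<exists>K. eventually (\<lambda>t. f t / g t \<le> K) at_top)"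
proof
  assume "asymp_le f g"
  then have "Limsup at_top (\<lambda>t. ereal (f t / g t)) < \<infinity>" by (simp add: asymp_le_def)
  then obtain K where "Limsup at_top (\<lambda>t. ereal (f t / g t)) < ereal K"
    by (metis less_PInf_Ex_of_nat ereal_less_le order_refl less_ereal.simps)
  then have "eventually (\<lambda>t. ereal (f t / g t) < ereal K) at_top" by (rule Limsup_lessD)
  then show "\<exists>K. eventually (\<lambda>t. f t / g t \<le> K) at_top"
    by (intro exI[of _ K]) (auto elim: eventually_mono)
next
  assume "\<exists>K. eventually (\<lambda>t. f t / g t \<le> K) at_top"
  then obtain K where "eventually (\<lambda>t. f t / g t \<le> K) at_top" by blast
  then have "Limsup at_top (\<lambda>t. ereal (f t / g t)) \<le> ereal K"
    by (intro Limsup_bounded) (auto elim: eventually_mono)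
  then show "asymp_le f g" unfolding asymp_le_def by (rule order.strict_trans1) simp
qed

lemma asymp_ge_iff: "asymp_ge f g \<longleftrightarrow> (\<exists>k>0. eventually (\<lambda>t. k \<le> f t / g t) at_top)"
proof
  assume "asymp_ge f g"
  then have "0 < Liminf at_top (\<lambda>t. ereal (f t / g t))" by (simp add: asymp_ge_def)
  then obtain k where k: "0 < ereal k" "ereal k < Liminf at_top (\<lambda>t. ereal (f t / g t))"
    using ereal_dense2 by blast
  from less_LiminfD[OF k(2)] have "eventually (\<lambda>t. ereal k < ereal (f t / g t)) at_top" .
  then show "\<exists>k>0. eventually (\<lambda>t. k \<le> f t / g t) at_top"
    using k by (intro exI[of _ k]) (auto elim: eventually_mono)
next
  assume "\<exists>k>0. eventually (\<lambda>t. k \<le> f t / g t) at_top"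
  then obtain k where k: "k > 0" "eventually (\<lambda>t. k \<le> f t / g t) at_top" by blast
  then have "ereal k \<le> Liminf at_top (\<lambda>t. ereal (f t / g t))"
    by (intro Liminf_bounded) (auto elim: eventually_mono)
  then show "asymp_ge f g" unfolding asymp_ge_def using k(1) by (metis ereal_less(2) order.strict_trans2)
qed

lemma asymp_eqI:
  assumes "eventually (\<lambda>t. k \<le> f t / g t \<and> f t / g t \<le> K) at_top" "0 < k"
  shows "asymp_eq f g"
  unfolding asymp_eq_def asymp_le_iff asymp_ge_iff
  using assms by (auto elim: eventually_mono)

text \<open>\<open>B\<close> is the ratio of the two candidate orders of magnitude \<open>A * B\<close> and \<open>A\<close> of the variance; both
  regimes of \<open>c\<close> are conditions on \<open>B\<close>.\<close>

lemma scale_asymptotics: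
  fixes c :: "real \<Rightarrow> real" and e a r :: nat and \<delta> :: real
  assumes c: "\<forall>l>0. 0 < c l \<and> c l < 1" and ae: "a < e" and r: "2 \<le> r" and \<delta>: "0 < \<delta>"
  defines "A \<equiv> \<lambda>l. l ^ r * c l ^ e" and "B \<equiv> \<lambda>l. l ^ (r - 1) * c l ^ (e - a)"
  defines "\<Delta> \<equiv> \<lambda>l. \<delta> * sqrt (A l / max 1 (B l))"
  shows "asymp_le c (\<lambda>l. l powr (- (real r - 1) / (real e - real a))) \<Longrightarrow>
      asymp_eq \<Delta> (\<lambda>l. l powr (real r / 2) * c l powr (real e / 2))"
    and "asymp_ge c (\<lambda>l. l powr (- (real r - 1) / (real e - real a))) \<Longrightarrow>
      asymp_eq \<Delta> (\<lambda>l. l powr (1 / 2) * c l powr (real a / 2))"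
proof -
  define g where "g = (\<lambda>l::real. l powr (- (real r - 1) / (real e - real a)))"
  have ea: "0 < real e - real a" using ae by simp
  \<comment> \<open>\<open>g\<close> is the threshold, namely the value of \<open>c\<close> at which
    \<open>B\<close> equals 1; hence \<open>c\<close> is of order at most \<open>g\<close> when
    \<open>B\<close> is bounded, and at least \<open>g\<close> when \<open>B\<close> is bounded away
    from 0.\<close>
  have B: "B l = (c l / g l) ^ (e - a)" if l: "0 < l" for l
  proof -
    have "g l ^ (e - a) = l powr (- (real r - 1))"
      using l ae ea by (simp add: g_def powr_realpow[symmetric] powr_powr of_nat_diff)
    also have "\<dots> = 1 / l ^ (r - 1)"
      unfolding powr_minus_divide using l r by (simp add: powr_realpow[symmetric] of_nat_diff)
    finally show ?thesis using l by (simp add: B_def power_divide mult.commute)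
  qed
  have sA: "sqrt (A l) = l powr (real r / 2) * c l powr (real e / 2)" if l: "0 < l" for l
  proof -
    have "0 < c l" using c l by blast
    then show ?thesis
      using l by (simp add: A_def real_sqrt_mult powr_half_sqrt[symmetric] powr_realpow[symmetric] powr_powr)
  qed
  have sAB: "sqrt (A l / B l) = l powr (1 / 2) * c l powr (real a / 2)" if l: "0 < l" for l
  proof -
    have cl: "0 < c l" using c l by blast
    have "r = Suc (r - 1)" "e = (e - a) + a" using r ae by auto
    then have "A l = B l * (l * c l ^ a)" unfolding A_def B_def by (metis (no_types, lifting) mult.assoc mult.commute power_Suc power_add)
    moreover have "B l \<noteq> 0" using l cl by (simp add: B_def)
    ultimately have "A l / B l = l * c l ^ a" by simp
    then show ?thesis
      using l cl by (simp add: real_sqrt_mult powr_half_sqrt[symmetric] powr_realpow[symmetric] powr_powr)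
  qed
  have pos: "0 < A l" "0 < B l" if l: "0 < l" for l
    using c l by (auto simp: A_def B_def)
  have ev: "eventually (\<lambda>l. l > (0::real)) at_top" by (rule eventually_gt_at_top)
  {
    assume "asymp_le c (\<lambda>l. l powr (- (real r - 1) / (real e - real a)))"
    then obtain K where K: "eventually (\<lambda>l. c l / g l \<le> K) at_top" unfolding asymp_le_iff g_def by blast
    \<comment> \<open>Below the threshold \<open>max 1 (B l)\<close> stays between 1 and
      \<open>b\<close>, so \<Delta> has the order of the square root of \<open>A\<close>.\<close>
    define b where "b = max 1 (K ^ (e - a))"
    show "asymp_eq \<Delta> (\<lambda>l. l powr (real r / 2) * c l powr (real e / 2))"
    proof (rule asymp_eqI)
      show "0 < \<delta> / sqrt b" using \<delta> by (simp add: b_def)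
      show "eventually (\<lambda>l. \<delta> / sqrt b \<le> \<Delta> l / (l powr (real r / 2) * c l powr (real e / 2)) \<and>
          \<Delta> l / (l powr (real r / 2) * c l powr (real e / 2)) \<le> \<delta>) at_top"
        using K ev
      proof eventually_elim
        fix l :: real assume l: "0 < l" and Kl: "c l / g l \<le> K"
        have "0 \<le> c l / g l" using c l by (simp add: g_def less_imp_le)
        then have "B l \<le> K ^ (e - a)" unfolding B[OF l] using Kl by (intro power_mono)
        then have Bb: "max 1 (B l) \<le> b" by (auto simp: b_def)
        have "\<Delta> l / sqrt (A l) = \<delta> / sqrt (max 1 (B l))"
          using pos[OF l] by (simp add: \<Delta>_def real_sqrt_divide)
        moreover have "\<delta> / sqrt b \<le> \<delta> / sqrt (max 1 (B l))"
          using Bb \<delta> by (intro divide_left_mono) (auto simp: b_def)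
        moreover have "\<delta> / sqrt (max 1 (B l)) \<le> \<delta>"
          using \<delta> by (simp add: divide_le_eq)
        ultimately show "\<delta> / sqrt b \<le> \<Delta> l / (l powr (real r / 2) * c l powr (real e / 2)) \<and>
          \<Delta> l / (l powr (real r / 2) * c l powr (real e / 2)) \<le> \<delta>"
          unfolding sA[OF l] by simp
      qed
    qed
  next
    assume "asymp_ge c (\<lambda>l. l powr (- (real r - 1) / (real e - real a)))"
    then obtain k where k: "0 < k" "eventually (\<lambda>l. k \<le> c l / g l) at_top" unfolding asymp_ge_iff g_def by blast
    \<comment> \<open>Above the threshold the ratio of \<open>B l\<close> to
      \<open>max 1 (B l)\<close> stays between \<open>b\<close> and 1, so \<Delta> has the order of
      the square root of A/B, and A/B is \<open>l * c l ^ a\<close>.\<close>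
    define b where "b = min 1 (k ^ (e - a))"
    have b: "0 < b" "b \<le> 1" using k by (auto simp: b_def)
    show "asymp_eq \<Delta> (\<lambda>l. l powr (1 / 2) * c l powr (real a / 2))"
    proof (rule asymp_eqI)
      show "0 < \<delta> * sqrt b" using \<delta> b by simp
      show "eventually (\<lambda>l. \<delta> * sqrt b \<le> \<Delta> l / (l powr (1 / 2) * c l powr (real a / 2)) \<and>
          \<Delta> l / (l powr (1 / 2) * c l powr (real a / 2)) \<le> \<delta>) at_top"
        using k(2) ev
      proof eventually_elim
        fix l :: real assume l: "0 < l" and kl: "k \<le> c l / g l"
        have "k ^ (e - a) \<le> B l" unfolding B[OF l] using kl k(1) by (intro power_mono) auto
        then have bB: "b \<le> B l / max 1 (B l)"
          using b pos(2)[OF l] by (auto simp: b_def max_def)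
        have "\<Delta> l / sqrt (A l / B l) = \<delta> * sqrt (B l / max 1 (B l))"
          using pos[OF l] by (simp add: \<Delta>_def real_sqrt_divide)
        moreover have "\<delta> * sqrt b \<le> \<delta> * sqrt (B l / max 1 (B l))"
          using bB \<delta> by (intro mult_left_mono) auto
        moreover have "\<delta> * sqrt (B l / max 1 (B l)) \<le> \<delta>"
          using \<delta> pos(2)[OF l] by (simp add: divide_le_eq)
        ultimately show "\<delta> * sqrt b \<le> \<Delta> l / (l powr (1 / 2) * c l powr (real a / 2)) \<and>
          \<Delta> l / (l powr (1 / 2) * c l powr (real a / 2)) \<le> \<delta>"
          unfolding sAB[OF l] by simp
      qed
    qed
  }
qed

section \<open>Graphs without endpoints, and the choice of the constants\<close>

lemma max_endpoint_degree_0: "1 \<le> r \<Longrightarrow> max_endpoint_degree r 0 E = 0"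
  by (simp add: max_endpoint_degree_def)

lemma balanced_iff_strongly_balanced:
  assumes "1 \<le> r"
  shows "balanced r 0 E \<longleftrightarrow> strongly_balanced {1..r} E"
  by (simp add: balanced_def strongly_balanced_def max_endpoint_degree_0[OF assms] numeral_2_eq_2)

theorem theorem3p3:
  fixes r m :: nat
    and E :: "nat set set"
    and y :: "nat \<Rightarrow> real ^ 'd"
    and \<mu> :: "(real ^ 'd) measure"
    and \<phi> :: "real ^ 'd \<Rightarrow> real ^ 'd \<Rightarrow> real"
    and c :: "real \<Rightarrow> real"
    and P :: "real \<Rightarrow> 'w measure"
    and \<tau> :: "real \<Rightarrow> 'w \<Rightarrow> enat"
    and X :: "real \<Rightarrow> nat \<Rightarrow> 'w \<Rightarrow> real ^ 'd"
    and \<Gamma> :: "real \<Rightarrow> 'w \<Rightarrow> vertex set set"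
    and a :: nat
    and N :: "real \<Rightarrow> 'w \<Rightarrow> real"
  defines "a \<equiv> max_endpoint_degree r m E"
    and "N \<equiv> (\<lambda>l \<omega>. subgraph_count r m E (\<tau> l \<omega>) (\<Gamma> l \<omega>))"
  assumes r: "r \<ge> 2"
    and G_connected: "connected_graph {1..r+m} E"
    and G_inner_connected: "connected_graph {1..r} (induced_edges E {1..r})"
    and G_endpoints: "\<forall>i\<in>{r+1..r+m}. \<forall>j\<in>{r+1..r+m}. {i, j} \<notin> E"
    and y_distinct: "inj_on y {1..m}"
    and mu: "sets \<mu> = sets borel" "sigma_finite_measure \<mu>" "diffuse \<mu>"
    and phi_range: "\<forall>x z. 0 \<le> \<phi> x z \<and> \<phi> x z \<le> 1"
    and phi_sym: "\<forall>x z. \<phi> x z = \<phi> z x"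
    and phi_meas: "(\<lambda>(x, z). \<phi> x z) \<in> borel_measurable (borel \<Otimes>\<^sub>M borel)"
    and no_endpoints: "m = 0 \<Longrightarrow> finite_measure \<mu>"
    and with_endpoints: "m \<ge> 1 \<Longrightarrow>
          \<mu> = lborel \<and> (\<forall>x z. \<phi> x z = \<phi> 0 (z - x)) \<and> (\<integral>\<^sup>+x. ennreal (\<phi> 0 x) \<partial>lborel) < \<infinity>"
    and c_range: "\<forall>l>0. 0 < c l \<and> c l < 1"
    and rcm: "\<forall>l>0. random_connection_model (P l) (\<tau> l) (X l) (\<Gamma> l) m y
                (scale_measure (ennreal l) \<mu>) (\<lambda>x z. c l * \<phi> x z)"
  shows "(balanced r m E \<longrightarrow>
      (\<forall>l>0. (AE \<omega> in P l. copy_indicator r m E (\<Gamma> l \<omega>) summable_on injective_tuples r (\<tau> l \<omega>)) \<and>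
             (\<forall>n. integrable (P l) (\<lambda>\<omega>. N l \<omega> ^ n))) \<and>
      (\<exists>\<Delta> :: real \<Rightarrow> real.
        (\<forall>l>0. \<Delta> l > 0) \<and>
        (\<forall>l>0. \<forall>n\<ge>1. \<bar>cumulant (P l) (normalized (P l) (N l)) n\<bar>
                         \<le> fact n ^ r / \<Delta> l powi (int n - 2)) \<and>
        (asymp_le c (\<lambda>l. l powr (- (real r - 1) / (real (card E) - real a))) \<longrightarrow>
           asymp_eq \<Delta> (\<lambda>l. l powr (real r / 2) * c l powr (real (card E) / 2))) \<and>
        (asymp_ge (\<lambda>_. 1) c \<and>
         asymp_ge c (\<lambda>l. l powr (- (real r - 1) / (real (card E) - real a))) \<longrightarrow>
           asymp_eq \<Delta> (\<lambda>l. l powr (1 / 2) * c l powr (real a / 2))) \<and>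
        (m = 0 \<longrightarrow>
          (asymp_le c (\<lambda>l. l powr (- (real (card {1..r+m}) - 1) / real (card E))) \<longrightarrow>
             asymp_eq \<Delta> (\<lambda>l. l powr (real (card {1..r+m}) / 2) * c l powr (real (card E) / 2))) \<and>
          (asymp_ge (\<lambda>_. 1) c \<and>
           asymp_ge c (\<lambda>l. l powr (- (real (card {1..r+m}) - 1) / real (card E))) \<longrightarrow>
             asymp_eq \<Delta> (\<lambda>l. l powr (1 / 2)))))) \<and>
    (m = 0 \<longrightarrow> (balanced r m E \<longleftrightarrow> strongly_balanced {1..r+m} E))"
proof -
  interpret G: endpoint_graph r m E
    by (rule endpoint_graph.intro[OF r G_connected G_inner_connected G_endpoints])
  interpret base: glued_integrals r m E \<phi> y \<mu>
  proof (rule glued_integrals.intro[OF G.endpoint_graph_axioms connection_function.intro glued_integrals_axioms.intro])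
    show "\<phi> x z = \<phi> z x" for x z using phi_sym by blast
    show "0 \<le> \<phi> x z \<and> \<phi> x z \<le> 1" for x z using phi_range by blast
  qed (rule phi_meas mu)+
  have "1 \<le> m \<Longrightarrow> \<exists>B<\<infinity>. \<forall>x. (\<integral>\<^sup>+z. ennreal (\<phi> x z) \<partial>\<mu>) \<le> B"
  proof -
    assume m: "1 \<le> m"
    have m0: "(\<lambda>z. ennreal (\<phi> 0 z)) \<in> borel_measurable borel"
    proof -
      have "(\<lambda>z. (0, z)) \<in> measurable borel (borel \<Otimes>\<^sub>M borel)" by measurable
      from measurable_compose[OF this phi_meas] show ?thesis by simp
    qed
    \<comment> \<open>Translation invariance of both \<phi> and Lebesgue measure makes the integral
      independent of \<open>x\<close>, which gives the uniform bound.\<close>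
    have "(\<integral>\<^sup>+z. ennreal (\<phi> x z) \<partial>\<mu>) = (\<integral>\<^sup>+z. ennreal (\<phi> 0 z) \<partial>lborel)" for x
    proof -
      have "(\<integral>\<^sup>+z. ennreal (\<phi> x z) \<partial>\<mu>) = (\<integral>\<^sup>+z. ennreal (\<phi> 0 (- x + z)) \<partial>lborel)"
        using with_endpoints[OF m] by (metis (no_types, lifting) add.commute nn_integral_cong uminus_add_conv_diff)
      also have "\<dots> = (\<integral>\<^sup>+z. ennreal (\<phi> 0 z) \<partial>distr lborel borel ((+) (- x)))"
        using m0 by (subst nn_integral_distr) auto
      finally show ?thesis by (simp add: lborel_distr_plus)
    qed
    then have "\<forall>x. (\<integral>\<^sup>+z. ennreal (\<phi> x z) \<partial>\<mu>) \<le> (\<integral>\<^sup>+z. ennreal (\<phi> 0 z) \<partial>lborel)" by (simp only: order_refl simp_thms)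
    then show ?thesis using with_endpoints[OF m] by blast
  qed
  moreover have "m = 0 \<Longrightarrow> emeasure \<mu> (space \<mu>) < \<infinity>"
    using no_endpoints finite_measure.emeasure_finite[of \<mu>] by (simp add: less_top)
  ultimately obtain C :: real where C: "1 \<le> C"
    "\<And>R \<rho>. finite R \<Longrightarrow> \<rho> \<in> nonflat_partitions R {1..r} \<Longrightarrow>
       base.edge_integral \<rho> (glued_edges r E R \<rho>) \<le> ennreal (C ^ card \<rho>)"
    using base.edge_integral_bounded by metis
  have sc: "scaled_count r m E \<phi> y \<mu> C (P l) (\<tau> l) (X l) (\<Gamma> l) l (c l)" if "0 < l" for l
  proof (rule scaled_count.intro[OF base.glued_integrals_axioms scaled_count_axioms.intro])
    show "0 < c l" "c l < 1" using c_range that by blast+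
    show "random_connection_model (P l) (\<tau> l) (X l) (\<Gamma> l) m y (scale_measure (ennreal l) \<mu>) (\<lambda>x z. c l * \<phi> x z)"
      using rcm that by blast
  qed (use C that in blast)+
  obtain i where i: "i \<in> {1..r}" "card {j \<in> {r+1..r+m}. {i, j} \<in> E} = a"
    unfolding a_def by (rule G.max_endpoint_degree_attained)
  define J where "J = (\<lambda>S. enn2real (base.edge_integral (G.two_row S) (glued_edges r E {1..2} (G.two_row S))))"
  have J_pos: "0 < J S" if S: "S \<subseteq> {1..r}" and pos: "base.row_integral > 0" for S
  proof -
    have "base.edge_integral (G.two_row S) (glued_edges r E {1..2} (G.two_row S)) < top"
      using C(2)[OF finite_atLeastAtMost G.two_row_nonflat[OF S]] by (rule order.strict_trans1) simp
    then show ?thesis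
      unfolding J_def using base.edge_integral_two_row_pos[OF S pos] by (simp add: enn2real_positive_iff)
  qed
  \<comment> \<open>The smaller of the two integrals in the variance bound, computed from \<phi> and
    \<mu> alone. In the degenerate case the value 1 merely keeps \<open>k0\<close> positive.\<close>
  define k0 where "k0 = (if base.row_integral > 0 then min (J {1..r}) (J {i}) else 1)"
  have k0: "0 < k0" using J_pos i by (simp add: k0_def)
  \<comment> \<open>This constant dominates the base of the exponential factor after division by the
    square root of \<open>k0\<close>; it depends neither on n nor on \<lambda>.\<close>
  define q where "q = max 1 ((real r * C) ^ r / sqrt k0)"
  have q: "1 \<le> q" "(real r * C) ^ r / sqrt k0 \<le> q" by (simp_all add: q_def)
  define A where "A = (\<lambda>l. l ^ r * c l ^ card E)"
  define B where "B = (\<lambda>l. l ^ (r - 1) * c l ^ (card E - a))"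
  define \<Delta> where "\<Delta> = (\<lambda>l. 1 / q ^ 3 * sqrt (A l / max 1 (B l)))"
  have ae: "a < card E" unfolding a_def by (rule G.max_endpoint_degree_less)
  have \<Delta>_pos: "\<Delta> l > 0" if "0 < l" for l
    using that c_range q by (simp add: \<Delta>_def A_def)
  have bound: "\<bar>cumulant (P l) (normalized (P l) (N l)) n\<bar> \<le> fact n ^ r / \<Delta> l powi (int n - 2)"
    if "balanced r m E" "0 < l" "1 \<le> n" for l n
  proof -
    interpret L: scaled_count r m E \<phi> y \<mu> C "P l" "\<tau> l" "X l" "\<Gamma> l" l "c l" by (rule sc[OF that(2)])
    have "\<bar>cumulant (P l) (normalized (P l) L.N) n\<bar> \<le> fact n ^ r / (sqrt (L.A / max 1 L.B) / q ^ 3) powi (int n - 2)"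
    proof (rule L.normalized_count_bound[OF that(1,3) i(1) _ k0])
      show "card {j \<in> {r+1..r+m}. {i, j} \<in> E} = max_endpoint_degree r m E" using i(2) by (simp add: a_def)
    qed (use q in \<open>auto simp: k0_def J_def\<close>)
    moreover have "sqrt (L.A / max 1 L.B) / q ^ 3 = \<Delta> l"
      by (simp add: \<Delta>_def A_def B_def L.A_def L.B_def a_def)
    ultimately show ?thesis by (simp add: N_def)
  qed
  have moments: "(AE \<omega> in P l. copy_indicator r m E (\<Gamma> l \<omega>) summable_on injective_tuples r (\<tau> l \<omega>)) \<and>
      (\<forall>n. integrable (P l) (\<lambda>\<omega>. N l \<omega> ^ n))" if "0 < l" for l
  proof -
    interpret L: scaled_count r m E \<phi> y \<mu> C "P l" "\<tau> l" "X l" "\<Gamma> l" l "c l" by (rule sc[OF that])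
    show ?thesis using L.AE_summable L.integrable_moment by (simp add: N_def)
  qed
  have q3: "0 < 1 / q ^ 3" using q by simp
  have asym: "asymp_le c (\<lambda>l. l powr (- (real r - 1) / (real (card E) - real a))) \<Longrightarrow>
      asymp_eq \<Delta> (\<lambda>l. l powr (real r / 2) * c l powr (real (card E) / 2))"
    "asymp_ge c (\<lambda>l. l powr (- (real r - 1) / (real (card E) - real a))) \<Longrightarrow>
      asymp_eq \<Delta> (\<lambda>l. l powr (1 / 2) * c l powr (real a / 2))"
    unfolding \<Delta>_def A_def B_def using scale_asymptotics[OF c_range ae r q3] by blast+
  have a0: "m = 0 \<Longrightarrow> a = 0" using r by (simp add: a_def max_endpoint_degree_0)
  have "m = 0 \<Longrightarrow> asymp_ge c (\<lambda>l. l powr (- (real r - 1) / real (card E))) \<Longrightarrow> asymp_eq \<Delta> (\<lambda>l. l powr (1 / 2))"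
  proof -
    assume "m = 0" "asymp_ge c (\<lambda>l. l powr (- (real r - 1) / real (card E)))"
    then have "asymp_ge c (\<lambda>l. l powr (- (real r - 1) / (real (card E) - real a)))" using a0 by simp
    from asym(2)[OF this] obtain k K where kK: "0 < k" "eventually (\<lambda>l. k \<le> \<Delta> l / (l powr (1 / 2) * c l powr (real a / 2))) at_top"
      "eventually (\<lambda>l. \<Delta> l / (l powr (1 / 2) * c l powr (real a / 2)) \<le> K) at_top"
      unfolding asymp_eq_def asymp_le_iff asymp_ge_iff by blast
    have "eventually (\<lambda>l. k \<le> \<Delta> l / l powr (1 / 2) \<and> \<Delta> l / l powr (1 / 2) \<le> K) at_top"
      using kK(2,3) eventually_gt_at_top[of 0]
    proof eventually_elim
      fix l :: real
      assume "0 < l" and *: "k \<le> \<Delta> l / (l powr (1 / 2) * c l powr (real a / 2))"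
        "\<Delta> l / (l powr (1 / 2) * c l powr (real a / 2)) \<le> K"
      \<comment> \<open>With a = 0 the factor \<open>c l powr 0\<close> equals 1 only for nonzero
        \<open>c l\<close>, which holds for positive \<open>l\<close> and hence eventually.\<close>
      then have "c l \<noteq> 0" using c_range by force
      then show "k \<le> \<Delta> l / l powr (1 / 2) \<and> \<Delta> l / l powr (1 / 2) \<le> K"
        using * a0[OF \<open>m = 0\<close>] by simp
    qed
    then show ?thesis using kK(1) by (rule asymp_eqI)
  qed
  note asym0 = this
  show ?thesis
  proof (rule conjI)
    show "m = 0 \<longrightarrow> (balanced r m E \<longleftrightarrow> strongly_balanced {1..r+m} E)"
      using balanced_iff_strongly_balanced[of r E] r by auto
    show "balanced r m E \<longrightarrow>
      (\<forall>l>0. (AE \<omega> in P l. copy_indicator r m E (\<Gamma> l \<omega>) summable_on injective_tuples r (\<tau> l \<omega>)) \<and>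
             (\<forall>n. integrable (P l) (\<lambda>\<omega>. N l \<omega> ^ n))) \<and>
      (\<exists>\<Delta> :: real \<Rightarrow> real.
        (\<forall>l>0. \<Delta> l > 0) \<and>
        (\<forall>l>0. \<forall>n\<ge>1. \<bar>cumulant (P l) (normalized (P l) (N l)) n\<bar>
                         \<le> fact n ^ r / \<Delta> l powi (int n - 2)) \<and>
        (asymp_le c (\<lambda>l. l powr (- (real r - 1) / (real (card E) - real a))) \<longrightarrow>
           asymp_eq \<Delta> (\<lambda>l. l powr (real r / 2) * c l powr (real (card E) / 2))) \<and>
        (asymp_ge (\<lambda>_. 1) c \<and>
         asymp_ge c (\<lambda>l. l powr (- (real r - 1) / (real (card E) - real a))) \<longrightarrow>
           asymp_eq \<Delta> (\<lambda>l. l powr (1 / 2) * c l powr (real a / 2))) \<and>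
        (m = 0 \<longrightarrow>
          (asymp_le c (\<lambda>l. l powr (- (real (card {1..r+m}) - 1) / real (card E))) \<longrightarrow>
             asymp_eq \<Delta> (\<lambda>l. l powr (real (card {1..r+m}) / 2) * c l powr (real (card E) / 2))) \<and>
          (asymp_ge (\<lambda>_. 1) c \<and>
           asymp_ge c (\<lambda>l. l powr (- (real (card {1..r+m}) - 1) / real (card E))) \<longrightarrow>
             asymp_eq \<Delta> (\<lambda>l. l powr (1 / 2)))))"
    proof (intro impI conjI exI[of _ \<Delta>] allI)
      assume "m = 0" "asymp_le c (\<lambda>l. l powr (- (real (card {1..r+m}) - 1) / real (card E)))"
      then have "asymp_le c (\<lambda>l. l powr (- (real r - 1) / (real (card E) - real a)))" "card {1..r+m} = r"
        using a0 by simp_all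
      with asym(1) show "asymp_eq \<Delta> (\<lambda>l. l powr (real (card {1..r+m}) / 2) * c l powr (real (card E) / 2))"
        by simp
    next
      assume "m = 0" "asymp_ge (\<lambda>_. 1) c \<and> asymp_ge c (\<lambda>l. l powr (- (real (card {1..r+m}) - 1) / real (card E)))"
      then show "asymp_eq \<Delta> (\<lambda>l. l powr (1 / 2))" using asym0 by simp
    qed (use moments \<Delta>_pos bound asym in blast)+
  qed
qed

end
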